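(* Let $\mathbf{A}$ be a finite simple non-abelian Mal'cev algebra and let $\mathbf{B}$ be the countable atomless Boolean algebra, whose Stone space is the Cantor space $2^\omega$. Let $n\geq 0$, let $\mathbf{e}=(e_1,\dots,e_n)$ be a (possibly empty) tuple of idempotents of $\mathbf{A}$, and let $\mathbf{x}=(x_1,\dots,x_n)$ be a tuple of distinct points of $2^\omega$. Then the automorphism group of the filtered Boolean power $(\mathbf{A}^{\mathbf{B}})^{\mathbf{x}}_{\mathbf{e}}$ has ample generics.
   Context: An algebra $\mathbf{A}$ is a set $A$ with finitary operations. It is simple if $|A|>1$ and its only congruences are the equality relation and the total relation. It is Mal'cev if it has a ternary term operation $m$ with $m(x,x,y)=y=m(y,x,x)$ for all $x,y$. A Mal'cev algebra is abelian (in the sense of commutator theory) if it is polynomially equivalent to a module, i.e. all its operations are affine over some module; otherwise it is non-abelian (for groups this is the usual notion; a ring is abelian iff its multiplication is constantly $0$). An element $e\in A$ is an idempotent if $\{e\}$ is a subuniverse of $\mathbf{A}$. For a Boolean algebra $\mathbf{B}$ with Stone space $X$ and a finite algebra $\mathbf{A}$ (with discrete topology), the Boolean power $\mathbf{A}^{\mathbf{B}}$ is the subalgebra of $\mathbf{A}^X$ consisting of all continuous $f\colon X\to A$; the filtered Boolean power $(\mathbf{A}^{\mathbf{B}})^{\mathbf{x}}_{\mathbf{e}}$ is its subalgebra $\{f\in A^{\mathbf{B}}: f(x_i)=e_i \text{ for all } i\in[n]\}$. Automorphism groups of countable structures carry the topology of pointwise convergence. For a topological group $G$ and $n\in\mathbb{N}$,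 $G$ acts on $G^n$ by diagonal conjugation $(h_1,\dots,h_n)^g=(g^{-1}h_1g,\dots,g^{-1}h_ng)$; a tuple $\mathbf{h}\in G^n$ is generic if its orbit under this action is comeagre in $G^n$; $G$ has ample generics if it has a generic $n$-tuple for every $n\in\mathbb{N}$. *)

theory Defs
  imports "HOL-Analysis.Analysis"
begin

definition is_algebra :: "'a set \<Rightarrow> ('f \<Rightarrow> nat) \<Rightarrow> ('f \<Rightarrow> 'a list \<Rightarrow> 'a) \<Rightarrow> bool" where
  "is_algebra A ar ops \<longleftrightarrow> (\<forall>f xs. length xs = ar f \<and> set xs \<subseteq> A \<longrightarrow> ops f xs \<in> A)"

definition congruence_of :: "'a set \<Rightarrow> ('f \<Rightarrow> nat) \<Rightarrow> ('f \<Rightarrow> 'a list \<Rightarrow> 'a) \<Rightarrow> ('a \<times> 'a) set \<Rightarrow> bool" where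
  "congruence_of A ar ops \<theta> \<longleftrightarrow> equiv A \<theta> \<and>
     (\<forall>f xs ys. length xs = ar f \<and> list_all2 (\<lambda>x y. (x, y) \<in> \<theta>) xs ys
        \<longrightarrow> (ops f xs, ops f ys) \<in> \<theta>)"

definition simple_alg :: "'a set \<Rightarrow> ('f \<Rightarrow> nat) \<Rightarrow> ('f \<Rightarrow> 'a list \<Rightarrow> 'a) \<Rightarrow> bool" where
  "simple_alg A ar ops \<longleftrightarrow> (\<exists>a\<in>A. \<exists>b\<in>A. a \<noteq> b) \<and>
     (\<forall>\<theta>. congruence_of A ar ops \<theta> \<longrightarrow> \<theta> = Id_on A \<or> \<theta> = A \<times> A)"

text \<open>n-ary term operations (clone generated by the basic operations), as functions on lists;
only their values on lists of length n over A matter.\<close>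

inductive_set term_ops :: "('f \<Rightarrow> nat) \<Rightarrow> ('f \<Rightarrow> 'a list \<Rightarrow> 'a) \<Rightarrow> nat \<Rightarrow> ('a list \<Rightarrow> 'a) set"
  for ar ops n where
  proj: "i < n \<Longrightarrow> (\<lambda>xs. xs ! i) \<in> term_ops ar ops n"
| comp: "length gs = ar f \<Longrightarrow> (\<forall>g\<in>set gs. g \<in> term_ops ar ops n) \<Longrightarrow>
           (\<lambda>xs. ops f (map (\<lambda>g. g xs) gs)) \<in> term_ops ar ops n"

inductive_set poly_ops :: "'a set \<Rightarrow> ('f \<Rightarrow> nat) \<Rightarrow> ('f \<Rightarrow> 'a list \<Rightarrow> 'a) \<Rightarrow> nat \<Rightarrow> ('a list \<Rightarrow> 'a) set"
  for A ar ops n where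
  proj: "i < n \<Longrightarrow> (\<lambda>xs. xs ! i) \<in> poly_ops A ar ops n"
| const: "c \<in> A \<Longrightarrow> (\<lambda>xs. c) \<in> poly_ops A ar ops n"
| comp: "length gs = ar f \<Longrightarrow> (\<forall>g\<in>set gs. g \<in> poly_ops A ar ops n) \<Longrightarrow>
           (\<lambda>xs. ops f (map (\<lambda>g. g xs) gs)) \<in> poly_ops A ar ops n"

definition malcev_alg :: "'a set \<Rightarrow> ('f \<Rightarrow> nat) \<Rightarrow> ('f \<Rightarrow> 'a list \<Rightarrow> 'a) \<Rightarrow> bool" where
  "malcev_alg A ar ops \<longleftrightarrow>
     (\<exists>m\<in>term_ops ar ops 3. \<forall>x\<in>A. \<forall>y\<in>A. m [x, x, y] = y \<and> m [y, x, x] = y)"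

text \<open>A module structure on A: an abelian group (A, pl, ng, z) together with a ring R of
additive endomorphisms of (A, pl) (the image of the scalar ring in End(A)), i.e. R contains
the identity and zero map and is closed under sum, negation and composition (all up to
equality on A).\<close>

definition module_on :: "'a set \<Rightarrow> ('a \<Rightarrow> 'a \<Rightarrow> 'a) \<Rightarrow> ('a \<Rightarrow> 'a) \<Rightarrow> 'a \<Rightarrow> ('a \<Rightarrow> 'a) set \<Rightarrow> bool" where
  "module_on A pl ng z R \<longleftrightarrow>
     z \<in> A \<and> (\<forall>x\<in>A. \<forall>y\<in>A. pl x y \<in> A) \<and> (\<forall>x\<in>A. ng x \<in> A) \<and>
     (\<forall>x\<in>A. \<forall>y\<in>A. \<forall>w\<in>A. pl (pl x y) w = pl x (pl y w)) \<and>
     (\<forall>x\<in>A. \<forall>y\<in>A. pl x y = pl y x) \<and>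
     (\<forall>x\<in>A. pl z x = x) \<and> (\<forall>x\<in>A. pl (ng x) x = z) \<and>
     (\<forall>r\<in>R. (\<forall>x\<in>A. r x \<in> A) \<and> (\<forall>x\<in>A. \<forall>y\<in>A. r (pl x y) = pl (r x) (r y))) \<and>
     (\<exists>r\<in>R. \<forall>x\<in>A. r x = x) \<and> (\<exists>r\<in>R. \<forall>x\<in>A. r x = z) \<and>
     (\<forall>r\<in>R. \<forall>s\<in>R. \<exists>t\<in>R. \<forall>x\<in>A. t x = pl (r x) (s x)) \<and>
     (\<forall>r\<in>R. \<exists>t\<in>R. \<forall>x\<in>A. t x = ng (r x)) \<and>
     (\<forall>r\<in>R. \<forall>s\<in>R. \<exists>t\<in>R. \<forall>x\<in>A. t x = r (s x))"

definition affine_map :: "('a \<Rightarrow> 'a \<Rightarrow> 'a) \<Rightarrow> ('a \<Rightarrow> 'a) list \<Rightarrow> 'a \<Rightarrow> 'a list \<Rightarrow> 'a" where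
  "affine_map pl rs c xs = foldr pl (map2 (\<lambda>r x. r x) rs xs) c"

text \<open>The polynomial operations of the module are exactly the affine maps; A is polynomially
equivalent to the module iff the two n-ary polynomial clones coincide (on A^n) for all n.\<close>

definition poly_equiv_module ::
  "'a set \<Rightarrow> ('f \<Rightarrow> nat) \<Rightarrow> ('f \<Rightarrow> 'a list \<Rightarrow> 'a) \<Rightarrow> ('a \<Rightarrow> 'a \<Rightarrow> 'a) \<Rightarrow> ('a \<Rightarrow> 'a) set \<Rightarrow> bool" where
  "poly_equiv_module A ar ops pl R \<longleftrightarrow>
     (\<forall>n. \<forall>p\<in>poly_ops A ar ops n. \<exists>rs c. length rs = n \<and> set rs \<subseteq> R \<and> c \<in> A \<and>
          (\<forall>xs. length xs = n \<and> set xs \<subseteq> A \<longrightarrow> p xs = affine_map pl rs c xs)) \<and>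
     (\<forall>n rs c. length rs = n \<and> set rs \<subseteq> R \<and> c \<in> A \<longrightarrow>
          (\<exists>p\<in>poly_ops A ar ops n.
             \<forall>xs. length xs = n \<and> set xs \<subseteq> A \<longrightarrow> p xs = affine_map pl rs c xs))"

definition abelian_alg :: "'a set \<Rightarrow> ('f \<Rightarrow> nat) \<Rightarrow> ('f \<Rightarrow> 'a list \<Rightarrow> 'a) \<Rightarrow> bool" where
  "abelian_alg A ar ops \<longleftrightarrow>
     (\<exists>pl ng z R. module_on A pl ng z R \<and> poly_equiv_module A ar ops pl R)"

definition idempotent_el :: "'a set \<Rightarrow> ('f \<Rightarrow> nat) \<Rightarrow> ('f \<Rightarrow> 'a list \<Rightarrow> 'a) \<Rightarrow> 'a \<Rightarrow> bool" where
  "idempotent_el A ar ops e \<longleftrightarrow> e \<in> A \<and> (\<forall>f. ops f (replicate (ar f) e) = e)"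

definition cantor_space :: "(nat \<Rightarrow> bool) topology" where
  "cantor_space = product_topology (\<lambda>_. discrete_topology (UNIV :: bool set)) UNIV"

definition filtered_bpower :: "'a set \<Rightarrow> (nat \<Rightarrow> bool) list \<Rightarrow> 'a list \<Rightarrow> ((nat \<Rightarrow> bool) \<Rightarrow> 'a) set" where
  "filtered_bpower A xs es =
     {f. continuous_map cantor_space (discrete_topology A) f \<and>
         (\<forall>i<length xs. f (xs ! i) = es ! i)}"

definition bpower_ops ::
  "('f \<Rightarrow> 'a list \<Rightarrow> 'a) \<Rightarrow> 'f \<Rightarrow> ((nat \<Rightarrow> bool) \<Rightarrow> 'a) list \<Rightarrow> ((nat \<Rightarrow> bool) \<Rightarrow> 'a)" where
  "bpower_ops ops f fs = (\<lambda>x. ops f (map (\<lambda>g. g x) fs))"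

definition automorphisms :: "'b set \<Rightarrow> ('f \<Rightarrow> nat) \<Rightarrow> ('f \<Rightarrow> 'b list \<Rightarrow> 'b) \<Rightarrow> ('b \<Rightarrow> 'b) set" where
  "automorphisms C ar ops =
     {g \<in> C \<rightarrow>\<^sub>E C. bij_betw g C C \<and>
        (\<forall>f xs. length xs = ar f \<and> set xs \<subseteq> C \<longrightarrow> g (ops f xs) = ops f (map g xs))}"

definition pointwise_top :: "'b set \<Rightarrow> ('b \<Rightarrow> 'b) set \<Rightarrow> ('b \<Rightarrow> 'b) topology" where
  "pointwise_top C G = subtopology (product_topology (\<lambda>_. discrete_topology C) C) G"

definition tuple_top :: "'b set \<Rightarrow> ('b \<Rightarrow> 'b) set \<Rightarrow> nat \<Rightarrow> (nat \<Rightarrow> ('b \<Rightarrow> 'b)) topology" where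
  "tuple_top C G n = product_topology (\<lambda>_. pointwise_top C G) {..<n}"

definition comeagre_in :: "'x topology \<Rightarrow> 'x set \<Rightarrow> bool" where
  "comeagre_in T S \<longleftrightarrow> S \<subseteq> topspace T \<and>
     (\<exists>U :: nat \<Rightarrow> 'x set. (\<forall>k. openin T (U k) \<and> T closure_of (U k) = topspace T) \<and>
        topspace T \<inter> (\<Inter>k. U k) \<subseteq> S)"

definition perm_inv :: "'b set \<Rightarrow> ('b \<Rightarrow> 'b) \<Rightarrow> ('b \<Rightarrow> 'b)" where
  "perm_inv C g = restrict (inv_into C g) C"

definition conj_orbit :: "'b set \<Rightarrow> ('b \<Rightarrow> 'b) set \<Rightarrow> nat \<Rightarrow> (nat \<Rightarrow> ('b \<Rightarrow> 'b)) \<Rightarrow> (nat \<Rightarrow> ('b \<Rightarrow> 'b)) set" where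
  "conj_orbit C G n h =
     {(\<lambda>i\<in>{..<n}. compose C (perm_inv C g) (compose C (h i) g)) | g. g \<in> G}"

definition generic_tuple :: "'b set \<Rightarrow> ('b \<Rightarrow> 'b) set \<Rightarrow> nat \<Rightarrow> (nat \<Rightarrow> ('b \<Rightarrow> 'b)) \<Rightarrow> bool" where
  "generic_tuple C G n h \<longleftrightarrow> h \<in> topspace (tuple_top C G n) \<and>
     comeagre_in (tuple_top C G n) (conj_orbit C G n h)"

definition ample_generics :: "'b set \<Rightarrow> ('b \<Rightarrow> 'b) set \<Rightarrow> bool" where
  "ample_generics C G \<longleftrightarrow> (\<forall>n. \<exists>h. generic_tuple C G n h)"

end

(*
  A surjective homomorphism from the filtered power onto A is evaluation at a point followed by an
  automorphism of A: otherwise a Mal'cev term of A would commute with all operations and A would be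
  abelian. Hence a tuple h of automorphisms is described, on a finite tuple of elements, by a finite
  graph whose vertices are the values of the elements and whose edges, coloured by the members of h,
  are the pairs (value at y, value of the image at y), all up to automorphisms of A. Conversely
  every finite graph refining a given one is realised, because clopen sets can be split at will and
  the filtered power is homogeneous.

  The graphs in which every vertex has at most one branching direction, and in which a walk leaving a
  vertex in another direction stays deterministic, are amalgamation bases (the fibre product, cut
  down to the pairs that can be continued backwards, is again edge-surjective), and every graph is
  refined by such a graph, obtained by unfolding it along a fixed choice of neighbours. So the
  tuples h that realise all extensions of such graphs form a dense G-delta set, and a back-and-forth
  argument shows that any two of them are conjugate.
*)
theory Submission
  imports Defs
begin

section \<open>Affine Mal'cev algebras\<close>

text \<open>The obstacle is that arbitrary graphs do not amalgamate. Let v have incoming neighbours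
  u1, u2 and outgoing neighbours w1, w2. One refinement may split v into copies with edges (u1, w1)
  and (u2, w2), another into (u1, w2) and (u2, w1); then no pair of copies can be continued both
  ways, and the fibre over v dies. If v branches in one direction only, a partner for a copy b of v
  is found by stepping in that direction, choosing a partner there, and returning along the
  deterministic direction. It is enough that every graph can be refined to such a base, since a
  generic tuple can be made to pass through bases at every stage of the back-and-forth. The filter
  points contribute constant tuples: all elements of the power agree at x_i, so the constant tuple
  e_i, with a loop of each colour, is a vertex of every graph and must survive both the unfolding
  and the cutting down. Existence of a generic tuple is Baire category: the automorphism group is a
  G-delta in the completely metrizable space of self-maps of the countable power.\<close>

lemma term_ops_closed:
  assumes "is_algebra A ar ops" "t \<in> term_ops ar ops n" "length xs = n" "set xs \<subseteq> A"
  shows "t xs \<in> A"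
  using assms(2)
proof induction
  case (proj i)
  then show ?case using assms(3,4) by auto
next
  case (comp gs f)
  have "set (map (\<lambda>g. g xs) gs) \<subseteq> A" using comp by auto
  then show ?case using assms(1) comp(1) unfolding is_algebra_def
    by (metis length_map)
qed

lemma poly_ops_closed:
  assumes "is_algebra A ar ops" "t \<in> poly_ops A ar ops n" "length xs = n" "set xs \<subseteq> A"
  shows "t xs \<in> A"
  using assms(2)
proof induction
  case (proj i)
  then show ?case using assms(3,4) by auto
next
  case (comp gs f)
  have "set (map (\<lambda>g. g xs) gs) \<subseteq> A" using comp by auto
  then show ?case using assms(1) comp(1) unfolding is_algebra_def
    by (metis length_map)
qed auto

lemma poly_ops_subst_term:
  assumes "t \<in> term_ops ar ops k" "length ps = k" "set ps \<subseteq> poly_ops A ar ops n"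
  shows "(\<lambda>xs. t (map (\<lambda>p. p xs) ps)) \<in> poly_ops A ar ops n"
  using assms(1)
proof induction
  case (proj i)
  then have "(\<lambda>xs. (map (\<lambda>p. p xs) ps) ! i) = ps ! i" using assms(2) by auto
  then show ?case using proj assms(2,3) by auto
next
  case (comp gs f)
  have "(\<lambda>xs. ops f (map (\<lambda>g. g xs) (map (\<lambda>g xs. g (map (\<lambda>p. p xs) ps)) gs)))
      \<in> poly_ops A ar ops n"
    by (rule poly_ops.comp) (use comp in auto)
  then show ?case by (simp add: comp_def)
qed

lemma poly_ops_subst:
  assumes "t \<in> poly_ops A ar ops k" "length ps = k" "set ps \<subseteq> poly_ops A ar ops n"
  shows "(\<lambda>xs. t (map (\<lambda>p. p xs) ps)) \<in> poly_ops A ar ops n"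
  using assms(1)
proof induction
  case (proj i)
  then have "(\<lambda>xs. (map (\<lambda>p. p xs) ps) ! i) = ps ! i" using assms(2) by auto
  then show ?case using proj assms(2,3) by auto
next
  case (const c)
  then show ?case by (simp add: poly_ops.const)
next
  case (comp gs f)
  have "(\<lambda>xs. ops f (map (\<lambda>g. g xs) (map (\<lambda>g xs. g (map (\<lambda>p. p xs) ps)) gs)))
      \<in> poly_ops A ar ops n"
    by (rule poly_ops.comp) (use comp in auto)
  then show ?case by (simp add: comp_def)
qed

text \<open>\<open>m_ops\<close> says that m is a homomorphism from the cube of the algebra to the
  algebra. For Mal'cev algebras this centrality condition amounts to being abelian; the direction
  from \<open>m_ops\<close> to a module is carried out here.\<close>

locale central_malcev =
  fixes A :: "'a set" and ar :: "'f \<Rightarrow> nat" and ops :: "'f \<Rightarrow> 'a list \<Rightarrow> 'a"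
    and m :: "'a list \<Rightarrow> 'a"
  assumes alg: "is_algebra A ar ops"
    and m_term: "m \<in> term_ops ar ops 3"
    and mal1: "\<And>x y. x \<in> A \<Longrightarrow> y \<in> A \<Longrightarrow> m [x, x, y] = y"
    and mal2: "\<And>x y. x \<in> A \<Longrightarrow> y \<in> A \<Longrightarrow> m [y, x, x] = y"
    and m_ops: "\<And>f as cs bs. length as = ar f \<Longrightarrow> length cs = ar f \<Longrightarrow> length bs = ar f \<Longrightarrow>
       set as \<subseteq> A \<Longrightarrow> set cs \<subseteq> A \<Longrightarrow> set bs \<subseteq> A \<Longrightarrow>
       ops f (map (\<lambda>i. m [as ! i, cs ! i, bs ! i]) [0..<ar f]) = m [ops f as, ops f cs, ops f bs]"
begin

lemma m_closed: "x \<in> A \<Longrightarrow> y \<in> A \<Longrightarrow> w \<in> A \<Longrightarrow> m [x, y, w] \<in> A"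
  by (rule term_ops_closed[OF alg m_term]) auto

text \<open>Constants cause no trouble because m is idempotent, so commuting with m passes from the
  basic operations to the whole polynomial clone.\<close>

lemma m_poly:
  assumes "p \<in> poly_ops A ar ops n" "length as = n" "length cs = n" "length bs = n"
     "set as \<subseteq> A" "set cs \<subseteq> A" "set bs \<subseteq> A"
  shows "p (map (\<lambda>i. m [as ! i, cs ! i, bs ! i]) [0..<n]) = m [p as, p cs, p bs]"
  using assms(1)
proof induction
  case (proj i)
  then show ?case by simp
next
  case (const c)
  then show ?case by (simp add: mal1)
next
  case (comp gs f)
  have cl: "set (map (\<lambda>g. g l) gs) \<subseteq> A" if "length l = n" "set l \<subseteq> A" for l
    using comp poly_ops_closed[OF alg _ that] by auto
  have "map (\<lambda>g. g (map (\<lambda>i. m [as ! i, cs ! i, bs ! i]) [0..<n])) gs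
     = map (\<lambda>g. m [g as, g cs, g bs]) gs"
    using comp by auto
  also have "\<dots> = map (\<lambda>i. m [map (\<lambda>g. g as) gs ! i, map (\<lambda>g. g cs) gs ! i, map (\<lambda>g. g bs) gs ! i]) [0..<ar f]"
    by (rule nth_equalityI) (auto simp: comp(1))
  finally show ?case
    using m_ops[of "map (\<lambda>g. g as) gs" f "map (\<lambda>g. g cs) gs" "map (\<lambda>g. g bs) gs"]
    by (simp add: comp(1) cl assms del: set_map)
qed

lemma m_in_poly: "m \<in> poly_ops A ar ops 3"
proof -
  show ?thesis
    using m_term
  proof induction
    case (proj i)
    then show ?case by (rule poly_ops.proj)
  next
    case (comp gs f)
    then show ?case by (intro poly_ops.comp) auto
  qed
qed

text \<open>The entropic law: m over the rows and m over the columns of a 3 by 3 matrix agree. The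
  group laws below are this identity with most entries set to z.\<close>

lemma mm:
  assumes "a1 \<in> A" "a2 \<in> A" "a3 \<in> A" "b1 \<in> A" "b2 \<in> A" "b3 \<in> A" "c1 \<in> A" "c2 \<in> A" "c3 \<in> A"
  shows "m [m [a1, a2, a3], m [b1, b2, b3], m [c1, c2, c3]]
       = m [m [a1, b1, c1], m [a2, b2, c2], m [a3, b3, c3]]"
proof -
  have "[0..<3] = [0, 1, 2::nat]" by (simp add: upt_rec)
  then show ?thesis
    using m_poly[OF m_in_poly, of "[a1,b1,c1]" "[a2,b2,c2]" "[a3,b3,c3]"] assms by simp
qed

text \<open>Any element z can be the zero, and x - y + w is m(x, y, w). The scalars have to be the
  unary polynomials fixing z, since these are the linear parts of the polynomials in one variable; a
  polynomial in several variables is then expanded one variable at a time.\<close>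

theorem abelian:
  assumes "A \<noteq> {}"
  shows "abelian_alg A ar ops"
proof -
  note [simp del] = One_nat_def
  obtain z where z: "z \<in> A" using assms by auto
  define pl where "pl = (\<lambda>x y. m [x, z, y])"
  define ng where "ng = (\<lambda>x. m [z, x, z])"
  define R where "R = {r. \<exists>p\<in>poly_ops A ar ops 1. (\<forall>x\<in>A. r x = p [x]) \<and> p [z] = z}"
  have pl_cl: "pl x y \<in> A" if "x \<in> A" "y \<in> A" for x y using that z m_closed by (simp add: pl_def)
  have ng_cl: "ng x \<in> A" if "x \<in> A" for x using that z m_closed by (simp add: ng_def)
  have assoc: "pl (pl x y) w = pl x (pl y w)" if "x \<in> A" "y \<in> A" "w \<in> A" for x y w
    using mm[of x z y z z z z z w] that z by (simp add: pl_def mal1 mal2)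
  have comm: "pl x y = pl y x" if "x \<in> A" "y \<in> A" for x y
    using mm[of z z x z z z y z z] that z by (simp add: pl_def mal1 mal2)
  have inv: "pl (ng x) x = z" if "x \<in> A" for x
    using mm[of z x z z z z z z x] that z by (simp add: pl_def ng_def mal1 mal2)
  \<comment> \<open>\<open>m [a, c, z]\<close> is the difference a - c, so this reads m(a, c, b) =
    (a - c) + b.\<close>
  have split: "m [a, c, b] = pl (m [a, c, z]) b" if "a \<in> A" "b \<in> A" "c \<in> A" for a b c
    using mm[of a c z z z z z z b] that z by (simp add: pl_def mal1 mal2)
  have id1: "(\<lambda>xs. xs ! 0) \<in> poly_ops A ar ops 1" by (rule poly_ops.proj) simp
  have cz: "(\<lambda>xs. z) \<in> poly_ops A ar ops n" for n by (rule poly_ops.const[OF z])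
  have plp: "(\<lambda>xs. pl (p xs) (q xs)) \<in> poly_ops A ar ops n"
    if "p \<in> poly_ops A ar ops n" "q \<in> poly_ops A ar ops n" for p q n
    using poly_ops_subst_term[OF m_term, of "[p, \<lambda>xs. z, q]" A n] that cz by (simp add: pl_def)
  have R_cl: "r x \<in> A" if "r \<in> R" "x \<in> A" for r x
    using that poly_ops_closed[OF alg, of _ 1 "[x]"] by (fastforce simp: R_def)
  have p1_add: "p [m [x, w, y]] = m [p [x], p [w], p [y]]"
    if "p \<in> poly_ops A ar ops 1" "x \<in> A" "y \<in> A" "w \<in> A" for p x y w
    using m_poly[OF that(1), of "[x]" "[w]" "[y]"] that by (simp add: One_nat_def)
  have R_add: "r (pl x y) = pl (r x) (r y)" if rR: "r \<in> R" and xy: "x \<in> A" "y \<in> A" for r x y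
  proof -
    obtain p where p: "p\<in>poly_ops A ar ops 1" "\<forall>x\<in>A. r x = p [x]" "p [z] = z"
      using rR unfolding R_def by blast
    then show ?thesis using p1_add[OF p(1) xy z] xy z pl_cl[OF xy]
      by (simp add: pl_def)
  qed
  have R_id: "\<exists>r\<in>R. \<forall>x\<in>A. r x = x"
    by (rule bexI[of _ "\<lambda>x. x"]) (auto simp: R_def intro!: bexI[OF _ id1])
  have R_zero: "\<exists>r\<in>R. \<forall>x\<in>A. r x = z"
    by (rule bexI[of _ "\<lambda>x. z"]) (auto simp: R_def intro!: bexI[OF _ cz])
  have R_sum: "\<exists>t\<in>R. \<forall>x\<in>A. t x = pl (r x) (s x)" if rs: "r \<in> R" "s \<in> R" for r s
  proof -
    obtain p where p: "p\<in>poly_ops A ar ops 1" "\<forall>x\<in>A. r x = p [x]" "p [z] = z"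
      using rs(1) unfolding R_def by blast
    obtain q where q: "q\<in>poly_ops A ar ops 1" "\<forall>x\<in>A. s x = q [x]" "q [z] = z"
      using rs(2) unfolding R_def by blast
    show ?thesis
      by (rule bexI[of _ "\<lambda>x. pl (r x) (s x)"])
        (use p q z in \<open>auto simp: R_def intro!: bexI[OF _ plp[OF p(1) q(1)]] simp: pl_def mal1\<close>)
  qed
  have R_neg: "\<exists>t\<in>R. \<forall>x\<in>A. t x = ng (r x)" if rs: "r \<in> R" for r
  proof -
    obtain p where p: "p\<in>poly_ops A ar ops 1" "\<forall>x\<in>A. r x = p [x]" "p [z] = z"
      using rs unfolding R_def by blast
    have "(\<lambda>xs. ng (p xs)) \<in> poly_ops A ar ops 1"
      using poly_ops_subst_term[OF m_term, of "[\<lambda>xs. z, p, \<lambda>xs. z]" A 1] p cz by (simp add: ng_def)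
    then show ?thesis
      by (intro bexI[of _ "\<lambda>x. ng (r x)"])
        (use p z in \<open>auto simp: R_def ng_def mal1 intro!: bexI[of _ "\<lambda>xs. ng (p xs)"]\<close>)
  qed
  have R_comp: "\<exists>t\<in>R. \<forall>x\<in>A. t x = r (s x)" if rs: "r \<in> R" "s \<in> R" for r s
  proof -
    obtain p where p: "p\<in>poly_ops A ar ops 1" "\<forall>x\<in>A. r x = p [x]" "p [z] = z"
      using rs(1) unfolding R_def by blast
    obtain q where q: "q\<in>poly_ops A ar ops 1" "\<forall>x\<in>A. s x = q [x]" "q [z] = z"
      using rs(2) unfolding R_def by blast
    have pq: "(\<lambda>xs. p [q xs]) \<in> poly_ops A ar ops 1"
      using poly_ops_subst[OF p(1), of "[q]"] q by simp
    have "\<forall>x\<in>A. r (s x) = p [q [x]]"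
      using p q R_cl[OF rs(2)] by auto
    then show ?thesis
      by (intro bexI[of _ "\<lambda>x. r (s x)"])
        (use p q z in \<open>auto simp: R_def intro!: bexI[OF _ pq]\<close>)
  qed
  have mod: "module_on A pl ng z R"
    unfolding module_on_def
    using z pl_cl ng_cl assoc comm inv R_cl R_add R_id R_zero R_sum R_neg R_comp
    by (auto simp: pl_def mal1)
  have fwd: "\<exists>rs c. length rs = n \<and> set rs \<subseteq> R \<and> c \<in> A \<and>
          (\<forall>xs. length xs = n \<and> set xs \<subseteq> A \<longrightarrow> p xs = affine_map pl rs c xs)"
    if p: "p \<in> poly_ops A ar ops n" for p n
  proof -
    define zs where "zs = replicate n z"
    define c where "c = p zs"
    \<comment> \<open>The i-th coefficient: p with only its i-th variable moving away from z, minus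
      the value c at the origin, so that z is fixed.\<close>
    define r where "r = (\<lambda>i x. m [p (zs[i := x]), c, z])"
    define rs where "rs = map r [0..<n]"
    have zsA: "set zs \<subseteq> A" "length zs = n" using z by (auto simp: zs_def)
    have cA: "c \<in> A" unfolding c_def by (rule poly_ops_closed[OF alg p]) (use zsA in auto)
    have rR: "r i \<in> R" if i: "i < n" for i
    proof -
      have 1: "(\<lambda>xs. p (map (\<lambda>p. p xs) ((replicate n (\<lambda>xs. z))[i := (\<lambda>xs. xs ! 0)]))) \<in> poly_ops A ar ops 1"
        by (rule poly_ops_subst[OF p])
          (auto intro: id1 cz dest!: set_update_subset_insert[THEN subsetD])
      have e: "map (\<lambda>p. p xs) ((replicate n (\<lambda>xs. z))[i := (\<lambda>xs. xs ! 0)]) = zs[i := xs ! 0]" for xs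
        by (simp add: map_update zs_def)
      have q: "(\<lambda>xs. m [p (zs[i := xs ! 0]), c, z]) \<in> poly_ops A ar ops 1"
        using poly_ops_subst_term[OF m_term, of "[\<lambda>xs. p (zs[i := xs ! 0]), \<lambda>xs. c, \<lambda>xs. z]" A 1]
          1 cA cz by (auto simp: e intro: poly_ops.const)
      have "zs[i := z] = zs" using i by (simp add: zs_def list_eq_iff_nth_eq nth_list_update)
      then show ?thesis
        unfolding R_def r_def by (auto intro!: bexI[OF _ q] simp: mal1 cA z c_def[symmetric])
    qed
    have main: "p (take k zs @ drop k xs) = foldr pl (map2 (\<lambda>r x. r x) (drop k rs) (drop k xs)) c"
      if "length xs = n" "set xs \<subseteq> A" "k \<le> n" for k xs
      using that(3)
    proof (induction k rule: inc_induct)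
      case base
      then show ?case using that by (simp add: c_def zsA rs_def)
    next
      case (step k)
      have xk: "xs ! k \<in> A" using step that by auto
      let ?l = "take (Suc k) zs @ drop (Suc k) xs"
      have lA: "set ?l \<subseteq> A" "length ?l = n"
        using that zsA step by (auto dest!: in_set_takeD in_set_dropD)
      have uA: "set (zs[k := xs ! k]) \<subseteq> A"
        using xk zsA(1) by (auto dest!: set_update_subset_insert[THEN subsetD])
      \<comment> \<open>Coordinatewise this is m(z, z, z) before k, m(xs ! k, z, z) at k and m(z, z,
        xs ! i) after k. Applying \<open>m_poly\<close> to it splits off the k-th variable.\<close>
      have "take k zs @ drop k xs = map (\<lambda>i. m [zs[k := xs ! k] ! i, zs ! i, ?l ! i]) [0..<n]"
      proof (rule nth_equalityI)
        fix i assume i: "i < length (take k zs @ drop k xs)"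
        then have i: "i < n" using that zsA step by auto
        have xi: "xs ! i \<in> A" using i that by auto
        have zi: "zs ! i = z" using i by (simp add: zs_def)
        show "(take k zs @ drop k xs) ! i = map (\<lambda>i. m [zs[k := xs ! k] ! i, zs ! i, ?l ! i]) [0..<n] ! i"
          using i zi xi z xk zsA that step
          by (cases "i < k"; cases "i = k") (auto simp: nth_append mal1 mal2 min_def less_Suc_eq)
      qed (use that zsA step in auto)
      then have "p (take k zs @ drop k xs) = m [p (zs[k := xs ! k]), c, p ?l]"
        using m_poly[OF p _ _ _ uA zsA(1) lA(1)] zsA lA by (simp add: c_def)
      also have "\<dots> = pl (r k (xs ! k)) (p ?l)"
        unfolding r_def
        by (rule split) (use poly_ops_closed[OF alg p] uA zsA lA cA in auto)
      also have "\<dots> = foldr pl (map2 (\<lambda>r x. r x) (drop k rs) (drop k xs)) c"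
        using step that by (simp add: step.IH rs_def Cons_nth_drop_Suc[symmetric])
      finally show ?case .
    qed
    show ?thesis
    proof (intro exI conjI allI impI)
      show "length rs = n" by (simp add: rs_def)
      show "set rs \<subseteq> R" using rR by (auto simp: rs_def)
      show "c \<in> A" by (rule cA)
      fix xs assume "length xs = n \<and> set xs \<subseteq> A"
      then show "p xs = affine_map pl rs c xs"
        using main[of xs 0] by (simp add: affine_map_def)
    qed
  qed
  have bwd: "\<exists>p\<in>poly_ops A ar ops n.
             \<forall>xs. length xs = n \<and> set xs \<subseteq> A \<longrightarrow> p xs = affine_map pl rs c xs"
    if rs: "length rs = n" "set rs \<subseteq> R" and c: "c \<in> A" for n rs c
  proof -
    have "\<exists>p\<in>poly_ops A ar ops n. \<forall>xs. length xs = n \<and> set xs \<subseteq> A \<longrightarrow>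
         p xs = foldr pl (map2 (\<lambda>r x. r x) (drop k rs) (drop k xs)) c" if "k \<le> n" for k
      using that
    proof (induction k rule: inc_induct)
      case base
      show ?case using rs by (intro bexI[OF _ poly_ops.const[OF c]]) auto
    next
      case (step k)
      obtain q where q: "q\<in>poly_ops A ar ops n" "\<forall>xs. length xs = n \<and> set xs \<subseteq> A \<longrightarrow>
         q xs = foldr pl (map2 (\<lambda>r x. r x) (drop (Suc k) rs) (drop (Suc k) xs)) c"
        using step by blast
      have "rs ! k \<in> R" using rs step by auto
      then obtain p where p: "p \<in> poly_ops A ar ops 1" "\<forall>x\<in>A. (rs ! k) x = p [x]"
        by (auto simp: R_def)
      have pk: "(\<lambda>xs. p [xs ! k]) \<in> poly_ops A ar ops n"
        using poly_ops_subst[OF p(1), of "[\<lambda>xs. xs ! k]"] step by (simp add: poly_ops.proj)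
      show ?case
      proof (intro bexI[OF _ plp[OF pk q(1)]] allI impI)
        fix xs assume xs: "length xs = n \<and> set xs \<subseteq> A"
        then have "xs ! k \<in> A" using step by auto
        then show "pl (p [xs ! k]) (q xs) = foldr pl (map2 (\<lambda>r x. r x) (drop k rs) (drop k xs)) c"
          using xs q(2) p(2) step rs by (simp add: Cons_nth_drop_Suc[symmetric])
      qed
    qed
    from this[of 0] show ?thesis by (simp add: affine_map_def)
  qed
  have "poly_equiv_module A ar ops pl R"
    unfolding poly_equiv_module_def using fwd bwd by blast
  with mod show ?thesis unfolding abelian_alg_def by blast
qed

end

section \<open>Locally constant functions on the Cantor space\<close>

definition agree :: "nat \<Rightarrow> (nat \<Rightarrow> bool) \<Rightarrow> (nat \<Rightarrow> bool) \<Rightarrow> bool" where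
  "agree N x y \<longleftrightarrow> (\<forall>i<N. x i = y i)"

type_synonym 'a cantor_fun = "(nat \<Rightarrow> bool) \<Rightarrow> 'a"

text \<open>Uniform local constancy: f depends on the first N coordinates only. With values in
  \<open>bool\<close> it says that a predicate defines a clopen set.\<close>

definition unif :: "nat \<Rightarrow> ((nat \<Rightarrow> bool) \<Rightarrow> 'b) \<Rightarrow> bool" where
  "unif N f \<longleftrightarrow> (\<forall>x y. agree N x y \<longrightarrow> f x = f y)"

lemma agree_refl [simp]: "agree N x x"
  and agree_sym: "agree N x y \<Longrightarrow> agree N y x"
  and agree_trans: "agree N x y \<Longrightarrow> agree N y z \<Longrightarrow> agree N x z"
  and agree_mono: "agree N x y \<Longrightarrow> M \<le> N \<Longrightarrow> agree M x y"
  by (auto simp: agree_def)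

lemma unif_mono: "unif N f \<Longrightarrow> N \<le> M \<Longrightarrow> unif M f"
  unfolding unif_def by (meson agree_mono)

lemma unifD: "unif N f \<Longrightarrow> agree N x y \<Longrightarrow> f x = f y"
  by (simp add: unif_def)

lemma topspace_cantor [simp]: "topspace cantor_space = UNIV"
  by (simp add: cantor_space_def)

lemma openin_cylinder: "openin cantor_space {y. agree N x y}"
proof -
  have "{y. agree N x y} = {y \<in> topspace cantor_space. \<forall>i\<in>{..<N}. y i \<in> {x i}}"
    by (auto simp: agree_def)
  also have "\<dots> = topspace cantor_space \<inter> (\<Inter>i\<in>{..<N}. {y \<in> topspace cantor_space. y i \<in> {x i}})"
    by auto
  also have "openin cantor_space \<dots>"
  proof (intro openin_Int_Inter finite_imageI openin_topspace)
    fix S assume "S \<in> (\<lambda>i. {y \<in> topspace cantor_space. y i \<in> {x i}}) ` {..<N}"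
    then obtain i where S: "S = {y \<in> topspace cantor_space. y i \<in> {x i}}" by auto
    have "continuous_map cantor_space (discrete_topology UNIV) (\<lambda>y. y i)"
      unfolding cantor_space_def by (rule continuous_map_product_projection) simp
    then show "openin cantor_space S"
      unfolding S by (rule openin_continuous_map_preimage) simp
  qed simp
  finally show ?thesis .
qed

lemma openin_cantor_cylinder:
  assumes "openin cantor_space S" "x \<in> S"
  shows "\<exists>N. \<forall>y. agree N x y \<longrightarrow> y \<in> S"
proof -
  obtain U where U: "finite {i \<in> UNIV. U i \<noteq> topspace (discrete_topology (UNIV :: bool set))}"
    "x \<in> Pi\<^sub>E UNIV U" "Pi\<^sub>E UNIV U \<subseteq> S"
    using assms unfolding cantor_space_def openin_product_topology_alt by blast
  then have fin: "finite {i. U i \<noteq> UNIV}" by simp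
  obtain N where N: "\<forall>i\<in>{i. U i \<noteq> UNIV}. i < N"
    using fin finite_nat_set_iff_bounded by blast
  have "y \<in> S" if "agree N x y" for y
  proof -
    have "x i \<in> U i" for i using U(2) by (auto simp: PiE_UNIV_domain)
    then have "y i \<in> U i" for i
    proof (cases "U i = UNIV")
      case False
      then have "y i = x i" using N that unfolding agree_def by blast
      with \<open>x i \<in> U i\<close> show ?thesis by (simp only:)
    qed simp
    then show ?thesis using U(3) by (auto simp: PiE_UNIV_domain)
  qed
  then show ?thesis by blast
qed

lemma compact_cantor: "compact_space cantor_space"
  unfolding cantor_space_def
  by (auto simp: compact_space_product_topology compact_space_discrete_topology)

text \<open>Continuity gives each point a cylinder on which f is constant; a finite subcover exists
  by compactness, and the largest depth in it serves for all points.\<close>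

lemma continuous_cantor_discrete_iff:
  "continuous_map cantor_space (discrete_topology A) f \<longleftrightarrow> range f \<subseteq> A \<and> (\<exists>N. unif N f)"
proof
  assume c: "continuous_map cantor_space (discrete_topology A) f"
  then have r: "range f \<subseteq> A" by (auto simp: continuous_map_def)
  have "\<exists>N. \<forall>y. agree N x y \<longrightarrow> f y = f x" for x
  proof -
    have "openin cantor_space {y \<in> topspace cantor_space. f y \<in> {f x}}"
      by (rule openin_continuous_map_preimage[OF c]) (use r in auto)
    from openin_cantor_cylinder[OF this, of x] show ?thesis by auto
  qed
  then obtain N where N: "\<And>x y. agree (N x) x y \<Longrightarrow> f y = f x" by metis
  define cyl where "cyl = (\<lambda>x. {y. agree (N x) x y})"
  have "\<exists>\<F>. finite \<F> \<and> \<F> \<subseteq> range cyl \<and> topspace cantor_space \<subseteq> \<Union>\<F>"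
    using compact_cantor unfolding compact_space_alt
  proof (elim allE[of _ "range cyl"] impE)
    show "(\<forall>U\<in>range cyl. openin cantor_space U) \<and> topspace cantor_space \<subseteq> \<Union> (range cyl)"
      by (auto simp: cyl_def openin_cylinder intro: agree_refl)
  qed
  then obtain X where X: "finite X" "UNIV \<subseteq> \<Union>(cyl ` X)"
    by (metis finite_subset_image topspace_cantor)
  define M where "M = Max (insert 0 (N ` X))"
  have "unif M f"
    unfolding unif_def
  proof (intro allI impI)
    fix y z assume a: "agree M y z"
    obtain x where x: "x \<in> X" "agree (N x) x y" using X(2) by (auto simp: cyl_def)
    have "N x \<le> M" using X(1) x by (auto simp: M_def)
    then have "agree (N x) x z" using a x by (meson agree_mono agree_trans)
    then show "f y = f z" using N x by metis
  qed
  with r show "range f \<subseteq> A \<and> (\<exists>N. unif N f)" by blast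
next
  assume a: "range f \<subseteq> A \<and> (\<exists>N. unif N f)"
  then obtain N where N: "unif N f" by blast
  show "continuous_map cantor_space (discrete_topology A) f"
    unfolding continuous_map_def
  proof (intro conjI allI impI)
    fix U assume "openin (discrete_topology A) U"
    show "openin cantor_space {x \<in> topspace cantor_space. f x \<in> U}"
    proof (subst openin_subopen, intro ballI)
      fix x assume x: "x \<in> {x \<in> topspace cantor_space. f x \<in> U}"
      show "\<exists>T. openin cantor_space T \<and> x \<in> T \<and> T \<subseteq> {x \<in> topspace cantor_space. f x \<in> U}"
        by (rule exI[of _ "{y. agree N x y}"])
          (use x N in \<open>auto simp: openin_cylinder dest: unifD\<close>)
    qed
  qed (use a in auto)
qed

lemma infinite_cylinder: "infinite {y. agree N x y}"
proof
  assume fin: "finite {y. agree N x y}"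
  define g where "g = (\<lambda>k i. if i < N then x i else i = k)"
  have "inj_on g {N..}"
    by (rule inj_onI) (metis (mono_tags, lifting) atLeast_iff g_def linorder_not_less)
  moreover have "g ` {N..} \<subseteq> {y. agree N x y}" by (auto simp: g_def agree_def)
  ultimately show False
    using fin infinite_Ici[of N] by (meson finite_imageD finite_subset)
qed

text \<open>The last clause carries the applications: a value v s is used only within depth N of s,
  so a property of the values that is tied to the depth-N cylinder of the argument, and holds for d
  and v, also holds for f.\<close>

lemma unif_interpolate:
  assumes "finite S" "unif M d"
  shows "\<exists>f. (\<exists>L. unif L f) \<and> (\<forall>s\<in>S. f s = v s) \<and>
     (\<forall>y. f y = d y \<or> (\<exists>s\<in>S. f y = v s \<and> agree N y s))"
proof -
  have "\<exists>L. \<forall>s\<in>S. \<forall>t\<in>S. agree L s t \<longrightarrow> s = t"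
  proof -
    have "\<forall>p\<in>S\<times>S. \<exists>n. agree n (fst p) (snd p) \<longrightarrow> fst p = snd p"
      by (auto simp: agree_def)
    then obtain n where n: "\<forall>p\<in>S\<times>S. agree (n p) (fst p) (snd p) \<longrightarrow> fst p = snd p"
      by metis
    define L where "L = Max (insert 0 (n ` (S\<times>S)))"
    have le: "n p \<le> L" if "p \<in> S\<times>S" for p using that assms by (auto simp: L_def)
    have "s = t" if st: "s \<in> S" "t \<in> S" "agree L s t" for s t
    proof -
      have "agree (n (s, t)) s t" using agree_mono[OF st(3) le] st by simp
      then show ?thesis using n st by force
    qed
    then show ?thesis by blast
  qed
  then obtain L0 where L0: "\<And>s t. s\<in>S \<Longrightarrow> t\<in>S \<Longrightarrow> agree L0 s t \<Longrightarrow> s = t" by blast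
  \<comment> \<open>Cylinders of depth L must separate the points of S (L0), keep d constant (M) and
    stay within the prescribed distance (N).\<close>
  define L where "L = max L0 (max M N)"
  have L: "s = t" if "s\<in>S" "t\<in>S" "agree L s t" for s t
    using that L0 agree_mono unfolding L_def by (metis max.cobounded1)
  define f where "f = (\<lambda>y. if \<exists>s\<in>S. agree L y s then v (SOME s. s \<in> S \<and> agree L y s) else d y)"
  have some: "(SOME s'. s' \<in> S \<and> agree L y s') = s" if "s \<in> S" "agree L y s" for y s
    using that L[OF _ _ agree_trans[OF agree_sym]] by (intro some_equality) blast+
  have 1: "unif L f"
    unfolding unif_def
  proof (intro allI impI)
    fix x y assume a: "agree L x y"
    have e: "agree L x s \<longleftrightarrow> agree L y s" for s using a agree_trans agree_sym by blast
    have "d x = d y" by (rule unifD[OF assms(2) agree_mono[OF a]]) (auto simp: L_def)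
    then show "f x = f y" unfolding f_def e by simp
  qed
  have 2: "f s = v s" if "s \<in> S" for s
    using that some[OF that, of s] by (auto simp: f_def)
  have 3: "f y = d y \<or> (\<exists>s\<in>S. f y = v s \<and> agree N y s)" for y
  proof (cases "\<exists>s\<in>S. agree L y s")
    case True
    then obtain s where s: "s \<in> S" "agree L y s" by blast
    then have "f y = v s" using some[OF s] by (auto simp: f_def)
    moreover have "agree N y s" using s agree_mono unfolding L_def by (meson max.cobounded2 max.coboundedI2)
    ultimately show ?thesis using s by blast
  qed (auto simp: f_def)
  show ?thesis using 1 2 3 by blast
qed

lemma inj_choice_infinite:
  assumes "finite D" "\<And>d. d \<in> D \<Longrightarrow> infinite (B d)"
  shows "\<exists>p. inj_on p D \<and> (\<forall>d\<in>D. p d \<in> B d)"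
  using assms
proof (induction D)
  case empty
  then show ?case by auto
next
  case (insert d D)
  then obtain p where p: "inj_on p D" "\<forall>d\<in>D. p d \<in> B d" by auto
  have "infinite (B d - p ` D)" using insert by auto
  then have "B d - p ` D \<noteq> {}" by (metis finite.emptyI)
  then obtain b where b: "b \<in> B d" "b \<notin> p ` D" by auto
  have eq: "(p(d := b)) x = p x" if "x \<in> D" for x using that insert.hyps(2) by auto
  have "p x \<noteq> b" if "x \<in> D" for x using b(2) that by blast
  then have "inj_on (p(d := b)) (insert d D)"
    using p(1) insert.hyps(2) unfolding inj_on_def by (metis fun_upd_apply insertE)
  moreover have "\<forall>x\<in>insert d D. (p(d := b)) x \<in> B x" using p(2) b eq by simp
  ultimately show ?case by blast
qed

section \<open>Filtered Boolean powers as sets of locally constant functions\<close>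

definition is_hom :: "'b set \<Rightarrow> ('f \<Rightarrow> nat) \<Rightarrow> ('f \<Rightarrow> 'b list \<Rightarrow> 'b) \<Rightarrow> 'a set \<Rightarrow> ('f \<Rightarrow> 'a list \<Rightarrow> 'a) \<Rightarrow> ('b \<Rightarrow> 'a) \<Rightarrow> bool" where
  "is_hom B ar ops' A ops g \<longleftrightarrow> g ` B \<subseteq> A \<and>
     (\<forall>f xs. length xs = ar f \<and> set xs \<subseteq> B \<longrightarrow> g (ops' f xs) = ops f (map g xs))"

locale filtered_power =
  fixes A :: "'a set" and ar :: "'f \<Rightarrow> nat" and ops :: "'f \<Rightarrow> 'a list \<Rightarrow> 'a"
    and xs :: "(nat \<Rightarrow> bool) list" and es :: "'a list"
  assumes alg: "is_algebra A ar ops"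
    and finA: "finite A"
    and A2: "\<exists>a\<in>A. \<exists>b\<in>A. a \<noteq> b"
    and len_es: "length es = length xs"
    and idem: "\<forall>e\<in>set es. idempotent_el A ar ops e"
    and dist_xs: "distinct xs"
begin

abbreviation "C \<equiv> filtered_bpower A xs es"
abbreviation "bops \<equiv> bpower_ops ops"
abbreviation "G \<equiv> automorphisms C ar bops"

definition auts :: "('a \<Rightarrow> 'a) set" where
  "auts = {g. bij_betw g A A \<and> is_hom A ar ops A ops g}"

lemma C_iff: "f \<in> C \<longleftrightarrow> range f \<subseteq> A \<and> (\<exists>N. unif N f) \<and> (\<forall>i<length xs. f (xs ! i) = es ! i)"
  by (auto simp: filtered_bpower_def continuous_cantor_discrete_iff)

lemma es_A: "e \<in> set es \<Longrightarrow> e \<in> A"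
  using idem by (auto simp: idempotent_el_def)

lemma C_A: "f \<in> C \<Longrightarrow> f y \<in> A" by (auto simp: C_iff)

lemma C_pt: "f \<in> C \<Longrightarrow> y \<in> set xs \<Longrightarrow> g \<in> C \<Longrightarrow> f y = g y"
  by (auto simp: C_iff in_set_conv_nth)

lemma unif_list:
  assumes "set fs \<subseteq> C"
  shows "\<exists>N. \<forall>f\<in>set fs. unif N f"
  using assms
proof (induction fs)
  case (Cons f fs)
  then obtain N M where "\<forall>f\<in>set fs. unif N f" "unif M f" by (auto simp: C_iff)
  then show ?case by (intro exI[of _ "max N M"]) (auto intro: unif_mono)
qed auto

lemma bops_C: "is_algebra C ar bops"
  unfolding is_algebra_def
proof (intro allI impI)
  fix f fs assume a: "length fs = ar f \<and> set fs \<subseteq> C"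
  have A: "bops f fs y \<in> A" for y
    using a alg C_A unfolding bpower_ops_def is_algebra_def
    by (metis (no_types, lifting) imageE length_map list.set_map subset_code(1))
  obtain N where N: "\<forall>g\<in>set fs. unif N g" using unif_list a by blast
  have u: "unif N (bops f fs)"
    unfolding unif_def
  proof (intro allI impI)
    fix x y assume "agree N x y"
    then have "map (\<lambda>g. g x) fs = map (\<lambda>g. g y) fs" using N by (intro map_cong refl) (blast intro: unifD)
    then show "bops f fs x = bops f fs y" by (simp only: bpower_ops_def)
  qed
  have e: "bops f fs (xs ! i) = es ! i" if "i < length xs" for i
  proof -
    have "map (\<lambda>g. g (xs ! i)) fs = replicate (ar f) (es ! i)"
    proof (rule replicate_eqI)
      fix z assume "z \<in> set (map (\<lambda>g. g (xs ! i)) fs)"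
      then obtain g where "g \<in> set fs" "z = g (xs ! i)" by auto
      then show "z = es ! i" using a that C_iff by blast
    qed (use a in simp)
    then show ?thesis
      using idem that len_es by (auto simp: bpower_ops_def idempotent_el_def)
  qed
  show "bops f fs \<in> C" using A u e by (auto simp: C_iff)
qed

lemma term_pointwise:
  assumes "t \<in> term_ops ar ops n" "set fs \<subseteq> C" "length fs = n"
  shows "(\<lambda>y. t (map (\<lambda>f. f y) fs)) \<in> C \<and>
    (\<forall>psi. is_hom C ar bops A ops psi \<longrightarrow> psi (\<lambda>y. t (map (\<lambda>f. f y) fs)) = t (map psi fs))"
  using assms(1)
proof induction
  case (proj i)
  then show ?case using assms by (auto simp: nth_mem subset_iff)
next
  case (comp gs f)
  define ks where "ks = map (\<lambda>g y. g (map (\<lambda>f. f y) fs)) gs"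
  have e: "(\<lambda>y. ops f (map (\<lambda>g. g (map (\<lambda>f. f y) fs)) gs)) = bops f ks"
    by (simp add: bpower_ops_def ks_def comp_def)
  have k: "length ks = ar f" "set ks \<subseteq> C" using comp by (auto simp: ks_def)
  have "bops f ks \<in> C" using k bops_C by (auto simp: is_algebra_def)
  moreover have "psi (bops f ks) = ops f (map (\<lambda>g. g (map psi fs)) gs)"
    if "is_hom C ar bops A ops psi" for psi
  proof -
    have "psi (bops f ks) = ops f (map psi ks)" using that k by (auto simp: is_hom_def)
    also have "map psi ks = map (\<lambda>g. g (map psi fs)) gs"
      using comp that by (auto simp: ks_def)
    finally show ?thesis .
  qed
  ultimately show ?case unfolding e by blast
qed

lemma C_glue:
  assumes "f \<in> C" "g \<in> C" "unif N U"
  shows "(\<lambda>y. if U y then f y else g y) \<in> C"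
proof -
  obtain M where M: "unif M f" "unif M g"
    using unif_list[of "[f,g]"] assms by auto
  have "unif (max N M) (\<lambda>y. if U y then f y else g y)"
    unfolding unif_def
  proof (intro allI impI)
    fix x y assume "agree (max N M) x y"
    then have "agree N x y" "agree M x y" by (auto intro: agree_mono)
    then show "(if U x then f x else g x) = (if U y then f y else g y)"
      using M assms(3) by (metis unifD)
  qed
  then show ?thesis using assms by (auto simp: C_iff image_subset_iff)
qed

lemma C_interpolate:
  assumes "finite S" "S \<inter> set xs = {}" "v ` S \<subseteq> A"
  shows "\<exists>f\<in>C. \<forall>s\<in>S. f s = v s"
proof -
  obtain a where a: "a \<in> A" using A2 by blast
  define v' where "v' = (\<lambda>s. if s \<in> S then v s else es ! (SOME i. i < length xs \<and> s = xs ! i))"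
  obtain f where f: "\<exists>L. unif L f" "\<forall>s\<in>S \<union> set xs. f s = v' s"
    "\<forall>y. f y = a \<or> (\<exists>s\<in>S \<union> set xs. f y = v' s \<and> agree 0 y s)"
    using unif_interpolate[of "S \<union> set xs" 0 "\<lambda>_. a" v' 0] assms by (auto simp: unif_def)
  have some: "(SOME j. j < length xs \<and> xs ! i = xs ! j) = i" if "i < length xs" for i
    using that dist_xs by (intro some_equality) (auto simp: nth_eq_iff_index_eq)
  have v'x: "v' (xs ! i) = es ! i" if "i < length xs" for i
    using that assms(2) some[OF that] by (auto simp: v'_def)
  have v'A: "v' s \<in> A" if sS: "s \<in> S \<union> set xs" for s
  proof (cases "s \<in> S")
    case True then show ?thesis using assms(3) by (auto simp: v'_def)
  next
    case False
    then obtain i where "i < length xs" "s = xs ! i" using sS by (auto simp: in_set_conv_nth)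
    then show ?thesis using v'x es_A len_es by auto
  qed
  have "f \<in> C"
    unfolding C_iff
  proof (intro conjI allI impI)
    show "range f \<subseteq> A" using f(3) v'A a by (metis image_subsetI)
    show "\<exists>N. unif N f" by (rule f(1))
    show "f (xs ! i) = es ! i" if "i < length xs" for i using that f(2) v'x by auto
  qed
  moreover have "\<forall>s\<in>S. f s = v s" using f(2) by (auto simp: v'_def)
  ultimately show ?thesis by blast
qed

text \<open>An element of level N is given by a map from bit strings of length N to the finite set
  A.\<close>

lemma C_countable: "countable C"
proof -
  define F where "F = (\<lambda>N::nat. (\<lambda>k::bool list \<Rightarrow> 'a. \<lambda>y. k (map y [0..<N])) ` (PiE {l. set l \<subseteq> UNIV \<and> length l = N} (\<lambda>_. A)))"
  have "C \<subseteq> (\<Union>N. F N)"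
  proof
    fix f assume f: "f \<in> C"
    then obtain N where N: "unif N f" by (auto simp: C_iff)
    define k where "k = (\<lambda>l\<in>{l. set l \<subseteq> UNIV \<and> length l = N}. f (\<lambda>i. if i < N then l ! i else False))"
    have "f y = k (map y [0..<N])" for y
      using N by (auto simp: k_def agree_def intro!: unifD)
    then have "f = (\<lambda>y. k (map y [0..<N]))" by auto
    moreover have "k \<in> PiE {l. set l \<subseteq> UNIV \<and> length l = N} (\<lambda>_. A)"
      using C_A[OF f] by (auto simp: k_def)
    ultimately show "f \<in> (\<Union>N. F N)" by (auto simp: F_def)
  qed
  moreover have "countable (F N)" for N
    unfolding F_def
    by (intro countable_finite finite_imageI finite_PiE finite_lists_length_eq) (auto simp: finA)
  ultimately show ?thesis by (meson countable_UN countable_subset countableI_type)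
qed

end

section \<open>Homomorphisms from a filtered power to its factor\<close>

context filtered_power
begin

lemma auts_closed: "g \<in> auts \<Longrightarrow> a \<in> A \<Longrightarrow> g a \<in> A"
  by (auto simp: auts_def bij_betw_def)

lemma auts_inj: "g \<in> auts \<Longrightarrow> a \<in> A \<Longrightarrow> b \<in> A \<Longrightarrow> g a = g b \<longleftrightarrow> a = b"
  by (auto simp: auts_def bij_betw_def inj_on_def)

lemma auts_ops: "g \<in> auts \<Longrightarrow> length l = ar f \<Longrightarrow> set l \<subseteq> A \<Longrightarrow> g (ops f l) = ops f (map g l)"
  by (simp add: auts_def is_hom_def)

lemma auts_id: "(\<lambda>x. x) \<in> auts"
  using bij_betw_id[of A] by (simp add: auts_def is_hom_def id_def)

lemma auts_comp:
  assumes "g \<in> auts" "h \<in> auts" shows "(\<lambda>x. g (h x)) \<in> auts"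
proof -
  have "bij_betw (\<lambda>x. g (h x)) A A"
    using assms bij_betw_trans[of h A A g A] by (auto simp: auts_def comp_def)
  moreover have "g (h (ops f l)) = ops f (map (\<lambda>x. g (h x)) l)" if "length l = ar f" "set l \<subseteq> A" for f l
  proof -
    have "set (map h l) \<subseteq> A" using that auts_closed[OF assms(2)] by auto
    then show ?thesis using that auts_ops[OF assms(1), of "map h l" f] auts_ops[OF assms(2) that]
      by (simp add: comp_def)
  qed
  ultimately show ?thesis
    using auts_closed assms by (auto simp: auts_def is_hom_def)
qed

lemma auts_inv:
  assumes "g \<in> auts"
  shows "\<exists>h\<in>auts. \<forall>a\<in>A. h (g a) = a \<and> g (h a) = a"
proof -
  have b: "bij_betw g A A" using assms by (simp add: auts_def)
  define h where "h = inv_into A g"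
  have hb: "bij_betw h A A" unfolding h_def by (rule bij_betw_inv_into[OF b])
  have hg: "h (g a) = a" "g (h a) = a" "h a \<in> A" if "a \<in> A" for a
    using b that unfolding h_def
    by (auto simp: bij_betw_inv_into_left bij_betw_inv_into_right) (metis bij_betw_def inv_into_into)
  have "h (ops f l) = ops f (map h l)" if l: "length l = ar f" "set l \<subseteq> A" for f l
  proof -
    have s: "set (map h l) \<subseteq> A" using l hg by auto
    then have c: "ops f (map h l) \<in> A" using alg l by (simp add: is_algebra_def)
    have "g (ops f (map h l)) = ops f (map g (map h l))"
      by (rule auts_ops[OF assms]) (use s l in auto)
    also have "map g (map h l) = l" using l hg by (auto intro!: map_idI)
    finally show ?thesis using hg(1)[OF c] by simp
  qed
  then have "h \<in> auts" using hb hg by (auto simp: auts_def is_hom_def)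
  then show ?thesis using hg by blast
qed

end

locale malcev_filtered_power = filtered_power +
  assumes simp_A: "simple_alg A ar ops"
    and malcev_A: "malcev_alg A ar ops"
    and nab_A: "\<not> abelian_alg A ar ops"
begin

definition "malcev_term = (SOME m. m \<in> term_ops ar ops 3 \<and> (\<forall>x\<in>A. \<forall>y\<in>A. m [x, x, y] = y \<and> m [y, x, x] = y))"

lemma malcev_term: "malcev_term \<in> term_ops ar ops 3" "x \<in> A \<Longrightarrow> y \<in> A \<Longrightarrow> malcev_term [x, x, y] = y"
  "x \<in> A \<Longrightarrow> y \<in> A \<Longrightarrow> malcev_term [y, x, x] = y"
proof -
  have "\<exists>m. m \<in> term_ops ar ops 3 \<and> (\<forall>x\<in>A. \<forall>y\<in>A. m [x, x, y] = y \<and> m [y, x, x] = y)"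
    using malcev_A by (auto simp: malcev_alg_def)
  from someI_ex[OF this] show "malcev_term \<in> term_ops ar ops 3" "x \<in> A \<Longrightarrow> y \<in> A \<Longrightarrow> malcev_term [x, x, y] = y"
    "x \<in> A \<Longrightarrow> y \<in> A \<Longrightarrow> malcev_term [y, x, x] = y"
    unfolding malcev_term_def[symmetric] by blast+
qed

definition "malcev_op f g h = (\<lambda>y. malcev_term [f y, g y, h y])"

lemma malcev_op: assumes "f \<in> C" "g \<in> C" "h \<in> C"
  shows "malcev_op f g h \<in> C" "is_hom C ar bops A ops psi \<Longrightarrow> psi (malcev_op f g h) = malcev_term [psi f, psi g, psi h]"
  using term_pointwise[OF malcev_term(1), of "[f,g,h]"] assms by (auto simp: malcev_op_def)

text \<open>The relation that fails to be the identity when \<open>psi\<close> is not determined on \<open>U\<close>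
  is a congruence of the simple algebra, hence everything.\<close>

lemma full_relation:
  assumes psi: "is_hom C ar bops A ops psi" "psi ` C = A"
    and nd: "f0 \<in> C" "g0 \<in> C" "\<forall>y. U y \<longrightarrow> f0 y = g0 y" "psi f0 \<noteq> psi g0"
    and f: "f \<in> C" "a \<in> A"
  shows "\<exists>f'\<in>C. psi f' = a \<and> (\<forall>y. U y \<longrightarrow> f' y = f y)"
proof -
  define T where "T = {(psi f, psi g) | f g. f \<in> C \<and> g \<in> C \<and> (\<forall>y. U y \<longrightarrow> f y = g y)}"
  have TI: "(psi p, psi q) \<in> T" if "p \<in> C" "q \<in> C" "\<And>y. U y \<Longrightarrow> p y = q y" for p q
    using that unfolding T_def by blast
  have psiA: "psi f \<in> A" if "f \<in> C" for f using psi that by auto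
  \<comment> \<open>As always in a Mal'cev algebra, a reflexive compatible relation is transitive:
    m(f1, g1, f2) and m(g1, g1, g2) agree on U, and psi sends them to m(a, b, b) = a and m(b, b, c)
    = c.\<close>
  have tr: "(a, c) \<in> T" if ab: "(a, b) \<in> T" and bc: "(b, c) \<in> T" for a b c
  proof -
    obtain f1 g1 where 1: "f1 \<in> C" "g1 \<in> C" "\<forall>y. U y \<longrightarrow> f1 y = g1 y" "a = psi f1" "b = psi g1"
      using ab by (auto simp: T_def)
    obtain f2 g2 where 2: "f2 \<in> C" "g2 \<in> C" "\<forall>y. U y \<longrightarrow> f2 y = g2 y" "b = psi f2" "c = psi g2"
      using bc by (auto simp: T_def)
    have "psi (malcev_op f1 g1 f2) = a" using malcev_op[OF 1(1,2) 2(1)] psi 1 2 psiA by (metis malcev_term(3))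
    moreover have "psi (malcev_op g1 g1 g2) = c" using malcev_op[OF 1(2,2) 2(2)] psi 1 2 psiA by (metis malcev_term(2))
    moreover have "\<forall>y. U y \<longrightarrow> malcev_op f1 g1 f2 y = malcev_op g1 g1 g2 y" using 1 2 by (simp add: malcev_op_def)
    ultimately show ?thesis using malcev_op 1 2 unfolding T_def by blast
  qed
  have cong: "congruence_of A ar ops T"
    unfolding congruence_of_def equiv_def
  proof (intro conjI allI impI)
    show "refl_on A T"
    proof (rule refl_onI)
      fix x assume "x \<in> A"
      then obtain f where "f \<in> C" "x = psi f" using psi(2) by blast
      then show "(x, x) \<in> T" unfolding T_def by blast
    qed
    show "T \<subseteq> A \<times> A" using psiA by (auto simp: T_def)
    show "sym T" by (auto simp: sym_def T_def) metis
    show "trans T" using tr by (auto intro: transI)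
    fix f l k assume lk: "length l = ar f \<and> list_all2 (\<lambda>x y. (x, y) \<in> T) l k"
    have len: "length k = length l" using lk by (metis list_all2_lengthD)
    have "\<forall>i<length l. \<exists>p q. p \<in> C \<and> q \<in> C \<and> (\<forall>y. U y \<longrightarrow> p y = q y) \<and> l ! i = psi p \<and> k ! i = psi q"
      using lk by (auto simp: list_all2_conv_all_nth T_def) blast
    then obtain p q where pq: "\<And>i. i < length l \<Longrightarrow> p i \<in> C \<and> q i \<in> C \<and> (\<forall>y. U y \<longrightarrow> p i y = q i y) \<and> l ! i = psi (p i) \<and> k ! i = psi (q i)"
      by metis
    define ps qs where "ps = map p [0..<length l]" and "qs = map q [0..<length l]"
    have PQ: "set ps \<subseteq> C" "set qs \<subseteq> C" "length ps = ar f" "length qs = ar f"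
      using pq lk by (auto simp: ps_def qs_def)
    have m: "map psi ps = l" "map psi qs = k"
      using pq len by (auto simp: ps_def qs_def intro!: nth_equalityI)
    have "bops f ps y = bops f qs y" if "U y" for y
    proof -
      have "p i y = q i y" if "i < length l" for i using pq[OF that] \<open>U y\<close> by blast
      then have "map (\<lambda>g. g y) ps = map (\<lambda>g. g y) qs" unfolding ps_def qs_def by simp
      then show ?thesis by (simp only: bpower_ops_def)
    qed
    moreover have "bops f ps \<in> C" "bops f qs \<in> C" using bops_C PQ by (auto simp: is_algebra_def)
    moreover have "psi (bops f ps) = ops f l" "psi (bops f qs) = ops f k"
      using psi PQ m by (auto simp: is_hom_def)
    ultimately show "(ops f l, ops f k) \<in> T" using TI[of "bops f ps" "bops f qs"] by simp
  qed
  have "(psi f0, psi g0) \<in> T" using nd by (auto simp: T_def)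
  then have "T \<noteq> Id_on A" using nd(4) by auto
  then have "T = A \<times> A" using cong simp_A by (auto simp: simple_alg_def)
  then have "(psi f, a) \<in> T" using f psiA by simp
  then obtain f1 g1 where 1: "f1 \<in> C" "g1 \<in> C" "\<forall>y. U y \<longrightarrow> f1 y = g1 y" "psi f1 = psi f" "psi g1 = a"
    by (auto simp: T_def)
  \<comment> \<open>The witness m(g1, f1, f) transports the pair (f1, g1) to f: on U it is m(f1, f1,
    f) = f, and psi sends it to m(a, psi f, psi f) = a.\<close>
  show ?thesis
  proof (intro bexI conjI)
    show "psi (malcev_op g1 f1 f) = a" using malcev_op(2)[OF 1(2,1) f(1) psi(1)] 1 psiA f by (simp add: malcev_term)
    show "\<forall>y. U y \<longrightarrow> malcev_op g1 f1 f y = f y" using 1 f C_A by (simp add: malcev_op_def malcev_term)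
    show "malcev_op g1 f1 f \<in> C" using malcev_op 1 f by blast
  qed
qed

text \<open>psi factors through restriction to U. The clopen sets with this property behave like an
  ultrafilter, whose limit is the point at which psi evaluates.\<close>

definition determined_on :: "('a cantor_fun \<Rightarrow> 'a) \<Rightarrow> ((nat \<Rightarrow> bool) \<Rightarrow> bool) \<Rightarrow> bool" where
  "determined_on psi U \<longleftrightarrow> (\<forall>f\<in>C. \<forall>g\<in>C. (\<forall>y. U y \<longrightarrow> f y = g y) \<longrightarrow> psi f = psi g)"

text \<open>Otherwise \<open>full_relation\<close> applies to U and to its complement, so the value
  of psi at q can be changed at will by altering q only on U (giving p) or only off U (giving r). At
  each point m(p, q, r) is then p or r, so it commutes with the operations there; applying psi, the
  Mal'cev term commutes with all operations of A, against non-abelianness.\<close>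

lemma determined_on_dichotomy:
  assumes psi: "is_hom C ar bops A ops psi" "psi ` C = A"
  shows "determined_on psi U \<or> determined_on psi (\<lambda>y. \<not> U y)"
proof (rule ccontr)
  assume "\<not> ?thesis"
  then obtain f0 g0 f1 g1 where
    0: "f0 \<in> C" "g0 \<in> C" "\<forall>y. U y \<longrightarrow> f0 y = g0 y" "psi f0 \<noteq> psi g0" and
    1: "f1 \<in> C" "g1 \<in> C" "\<forall>y. \<not> U y \<longrightarrow> f1 y = g1 y" "psi f1 \<noteq> psi g1"
    unfolding determined_on_def by blast
  note r0 = full_relation[OF psi 0] and r1 = full_relation[OF psi 1]
  have "central_malcev A ar ops malcev_term"
  proof
    show "is_algebra A ar ops" by (rule alg)
    fix f as cs bs
    assume len: "length as = ar f" "length cs = ar f" "length bs = ar f"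
      and sub: "set as \<subseteq> A" "set cs \<subseteq> A" "set bs \<subseteq> A"
    have "\<forall>i<ar f. \<exists>p q r. p \<in> C \<and> q \<in> C \<and> r \<in> C \<and> psi q = cs ! i \<and> psi p = as ! i \<and> psi r = bs ! i \<and>
      (\<forall>y. \<not> U y \<longrightarrow> p y = q y) \<and> (\<forall>y. U y \<longrightarrow> r y = q y)"
    proof (intro allI impI)
      fix i assume i: "i < ar f"
      have mem: "as ! i \<in> A" "cs ! i \<in> A" "bs ! i \<in> A" using i len sub by auto
      then obtain q where q: "q \<in> C" "psi q = cs ! i" using psi(2) by (metis imageE)
      show "\<exists>p q r. p \<in> C \<and> q \<in> C \<and> r \<in> C \<and> psi q = cs ! i \<and> psi p = as ! i \<and> psi r = bs ! i \<and>
      (\<forall>y. \<not> U y \<longrightarrow> p y = q y) \<and> (\<forall>y. U y \<longrightarrow> r y = q y)"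
        using r0[OF q(1) mem(3)] r1[OF q(1) mem(1)] q by blast
    qed
    then obtain p q r where pqr: "\<And>i. i < ar f \<Longrightarrow> p i \<in> C \<and> q i \<in> C \<and> r i \<in> C \<and> psi (q i) = cs ! i \<and> psi (p i) = as ! i \<and> psi (r i) = bs ! i \<and>
      (\<forall>y. \<not> U y \<longrightarrow> p i y = q i y) \<and> (\<forall>y. U y \<longrightarrow> r i y = q i y)"
      by metis
    define L where "L = [0..<ar f]"
    have PC: "set (map p L) \<subseteq> C" "set (map q L) \<subseteq> C" "set (map r L) \<subseteq> C"
      "set (map (\<lambda>i. malcev_op (p i) (q i) (r i)) L) \<subseteq> C"
      using pqr malcev_op(1) by (auto simp: L_def)
    have op: "bops f (map k L) \<in> C" "psi (bops f (map k L)) = ops f (map psi (map k L))"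
      if "set (map k L) \<subseteq> C" for k
      using that bops_C psi(1) by (auto simp: is_algebra_def is_hom_def L_def)
    have mp: "map psi (map p L) = as" "map psi (map q L) = cs" "map psi (map r L) = bs"
      using pqr len by (auto simp: L_def intro!: nth_equalityI)
    have mm: "map psi (map (\<lambda>i. malcev_op (p i) (q i) (r i)) L) = map (\<lambda>i. malcev_term [as ! i, cs ! i, bs ! i]) L"
      using pqr by (simp add: L_def malcev_op(2)[OF _ _ _ psi(1)])
    \<comment> \<open>On U the families q and r coincide and m(p, q, r) is p; off U p and q coincide
      and it is r.\<close>
    have "bops f (map (\<lambda>i. malcev_op (p i) (q i) (r i)) L) y
        = malcev_op (bops f (map p L)) (bops f (map q L)) (bops f (map r L)) y" for y
    proof (cases "U y")
      case True
      have e: "map (\<lambda>k. k y) (map q L) = map (\<lambda>k. k y) (map r L)" using pqr True by (auto simp: L_def)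
      have "map (\<lambda>k. k y) (map (\<lambda>i. malcev_op (p i) (q i) (r i)) L) = map (\<lambda>k. k y) (map p L)"
        using pqr True C_A by (auto simp: L_def malcev_op_def malcev_term)
      then have "bops f (map (\<lambda>i. malcev_op (p i) (q i) (r i)) L) y = bops f (map p L) y"
        by (simp only: bpower_ops_def)
      moreover have "bops f (map q L) y = bops f (map r L) y" using e by (simp only: bpower_ops_def)
      ultimately show ?thesis
        using op(1)[OF PC(1)] op(1)[OF PC(3)] C_A by (simp add: malcev_op_def malcev_term)
    next
      case False
      have e: "map (\<lambda>k. k y) (map q L) = map (\<lambda>k. k y) (map p L)" using pqr False by (auto simp: L_def)
      have "map (\<lambda>k. k y) (map (\<lambda>i. malcev_op (p i) (q i) (r i)) L) = map (\<lambda>k. k y) (map r L)"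
        using pqr False C_A by (auto simp: L_def malcev_op_def malcev_term)
      then have "bops f (map (\<lambda>i. malcev_op (p i) (q i) (r i)) L) y = bops f (map r L) y"
        by (simp only: bpower_ops_def)
      moreover have "bops f (map q L) y = bops f (map p L) y" using e by (simp only: bpower_ops_def)
      ultimately show ?thesis
        using op(1)[OF PC(1)] op(1)[OF PC(3)] C_A by (simp add: malcev_op_def malcev_term)
    qed
    then have "bops f (map (\<lambda>i. malcev_op (p i) (q i) (r i)) L)
        = malcev_op (bops f (map p L)) (bops f (map q L)) (bops f (map r L))" by auto
    then have "psi (bops f (map (\<lambda>i. malcev_op (p i) (q i) (r i)) L))
        = malcev_term [ops f as, ops f cs, ops f bs]"
      using malcev_op(2)[OF op(1)[OF PC(1)] op(1)[OF PC(2)] op(1)[OF PC(3)] psi(1)]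
        op(2)[OF PC(1)] op(2)[OF PC(2)] op(2)[OF PC(3)] mp by simp
    then show "ops f (map (\<lambda>i. malcev_term [as ! i, cs ! i, bs ! i]) [0..<ar f]) = malcev_term [ops f as, ops f cs, ops f bs]"
      using op(2)[OF PC(4)] unfolding mm by (simp add: L_def)
  qed (use malcev_term in auto)
  then have "abelian_alg A ar ops" using A2 by (intro central_malcev.abelian) auto
  then show False using nab_A by simp
qed

lemma determined_on_inter:
  assumes "determined_on psi U" "determined_on psi V" "unif N U"
  shows "determined_on psi (\<lambda>y. U y \<and> V y)"
  unfolding determined_on_def
proof (intro ballI impI)
  fix f g assume fg: "f \<in> C" "g \<in> C" "\<forall>y. U y \<and> V y \<longrightarrow> f y = g y"
  define k where "k = (\<lambda>y. if U y then f y else g y)"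
  have k: "k \<in> C" unfolding k_def by (rule C_glue[OF fg(1,2) assms(3)])
  have "psi f = psi k" using assms(1)[unfolded determined_on_def, rule_format, OF fg(1) k] by (simp add: k_def)
  also have "\<dots> = psi g"
    using assms(2)[unfolded determined_on_def, rule_format, OF k fg(2)] fg(3) by (simp add: k_def)
  finally show "psi f = psi g" .
qed

text \<open>The dichotomy for the clopen set of all x with \<open>x n\<close> true gives the n-th
  bit of y. Intersections show that psi is determined on every cylinder around y, hence by the value
  at y. The induced map on A is onto, hence bijective by finiteness.\<close>

lemma surj_hom_point:
  assumes psi: "is_hom C ar bops A ops psi" "psi ` C = A"
  shows "\<exists>y g. g \<in> auts \<and> (\<forall>f\<in>C. psi f = g (f y))"
proof -
  define y where "y = (\<lambda>n. determined_on psi (\<lambda>x. x n))"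
  have bit: "determined_on psi (\<lambda>x. x n = y n)" for n
  proof (cases "determined_on psi (\<lambda>x. x n)")
    case True
    then have "(\<lambda>x. x n = y n) = (\<lambda>x. x n)" by (simp add: y_def)
    with True show ?thesis by simp
  next
    case False
    then have "(\<lambda>x. x n = y n) = (\<lambda>x. \<not> x n)" by (simp add: y_def)
    with False show ?thesis using determined_on_dichotomy[OF psi, of "\<lambda>x. x n"] by simp
  qed
  have cyl: "determined_on psi (\<lambda>x. agree N x y)" for N
  proof (induction N)
    case 0
    show ?case unfolding determined_on_def agree_def by (auto intro!: arg_cong[of _ _ psi])
  next
    case (Suc N)
    have u: "unif N (\<lambda>x. agree N x y)" by (auto simp: unif_def agree_def)
    have "(\<lambda>x. agree N x y \<and> x N = y N) = (\<lambda>x. agree (Suc N) x y)"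
      by (auto simp: agree_def less_Suc_eq fun_eq_iff)
    then show ?case using determined_on_inter[OF Suc bit[of N] u] by simp
  qed
  have pt: "psi f = psi g" if fg: "f \<in> C" "g \<in> C" "f y = g y" for f g
  proof -
    obtain N where N: "unif N f" "unif N g" using unif_list[of "[f,g]"] fg by auto
    have "f x = g x" if "agree N x y" for x
      using unifD[OF N(1) that] unifD[OF N(2) that] \<open>f y = g y\<close> by simp
    then show ?thesis using cyl[of N] fg unfolding determined_on_def by blast
  qed
  \<comment> \<open>At a filter point all elements of C agree, so psi would be constant although A
    has two elements.\<close>
  have y: "y \<notin> set xs"
  proof
    assume "y \<in> set xs"
    have eq: "psi f = psi g" if "f \<in> C" "g \<in> C" for f g by (rule pt[OF that C_pt[OF that(1) \<open>y \<in> set xs\<close> that(2)]])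
    obtain a b where ab: "a \<in> A" "b \<in> A" "a \<noteq> b" using A2 by blast
    then have "a \<in> psi ` C" "b \<in> psi ` C" using psi(2) by simp_all
    then show False using eq ab(3) by blast
  qed
  have ex: "\<exists>f\<in>C. f y = a" if "a \<in> A" for a
    using C_interpolate[of "{y}" "\<lambda>_. a"] y that by auto
  then obtain k where k: "\<And>a. a \<in> A \<Longrightarrow> k a \<in> C \<and> k a y = a" by metis
  define g where "g = (\<lambda>a. psi (k a))"
  have gf: "psi f = g (f y)" if "f \<in> C" for f
    unfolding g_def using that k C_A pt by metis
  have "g ` A = A"
  proof
    show "g ` A \<subseteq> A" using k psi(2) by (auto simp: g_def)
    show "A \<subseteq> g ` A"
    proof
      fix a assume "a \<in> A"
      then obtain f where "f \<in> C" "psi f = a" using psi(2) by (metis imageE)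
      then show "a \<in> g ` A" using gf C_A by blast
    qed
  qed
  then have "bij_betw g A A"
    using finA by (simp add: bij_betw_def eq_card_imp_inj_on)
  moreover have "g (ops f l) = ops f (map g l)" if l: "length l = ar f" "set l \<subseteq> A" for f l
  proof -
    have K: "set (map k l) \<subseteq> C" "length (map k l) = ar f" using l k by auto
    have B: "bops f (map k l) \<in> C" using bops_C K unfolding is_algebra_def by blast
    have "map (\<lambda>h. h y) (map k l) = l" using l k by (auto intro!: map_idI)
    then have e: "bops f (map k l) y = ops f l" by (simp only: bpower_ops_def)
    have "g (ops f l) = psi (bops f (map k l))" using gf[OF B] e by simp
    also have "\<dots> = ops f (map psi (map k l))" using psi(1) K unfolding is_hom_def by blast
    finally show ?thesis by (simp add: g_def comp_def)
  qed
  ultimately have "g \<in> auts" by (auto simp: auts_def is_hom_def bij_betw_def)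
  then show ?thesis using gf by blast
qed

text \<open>Off the filter points \<open>\<lambda>f. h f y\<close> is a surjective homomorphism onto
  A; at a filter point y' = y and the identity will do. The point y' and the automorphism g depend
  on y alone, not on f.\<close>

theorem automorphism_point:
  assumes h: "h \<in> G"
  shows "\<exists>y' g. g \<in> auts \<and> (\<forall>f\<in>C. h f y = g (f y'))"
proof (cases "y \<in> set xs")
  case True
  have "h f \<in> C" if "f \<in> C" for f using h that by (auto simp: automorphisms_def)
  then have "\<forall>f\<in>C. h f y = f y" using C_pt True by blast
  then show ?thesis using auts_id by blast
next
  case False
  have hC: "h f \<in> C" if "f \<in> C" for f using h that by (auto simp: automorphisms_def)
  have "is_hom C ar bops A ops (\<lambda>f. h f y)"
    unfolding is_hom_def
  proof (intro conjI allI impI)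
    show "(\<lambda>f. h f y) ` C \<subseteq> A" using hC C_A by auto
    fix f fs assume "length fs = ar f \<and> set fs \<subseteq> C"
    then have "h (bops f fs) = bops f (map h fs)" using h by (auto simp: automorphisms_def)
    then show "h (bops f fs) y = ops f (map (\<lambda>f. h f y) fs)"
      by (simp add: bpower_ops_def comp_def)
  qed
  moreover have "(\<lambda>f. h f y) ` C = A"
  proof -
    have "\<exists>f\<in>C. h f y = a" if a: "a \<in> A" for a
    proof -
      obtain k where k: "k \<in> C" "k y = a" using C_interpolate[of "{y}" "\<lambda>_. a"] False a by auto
      have "h ` C = C" using h by (auto simp: automorphisms_def bij_betw_def)
      then obtain f where "f \<in> C" "h f = k" using k by (metis imageE)
      then show ?thesis using k by auto
    qed
    then show ?thesis using hC C_A by auto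
  qed
  ultimately show ?thesis using surj_hom_point by blast
qed

end

section \<open>Extension of tuples and homogeneity\<close>

lemma length_map_nth_subset:
  assumes "set l \<subseteq> set as"
  shows "\<exists>is. l = map (nth as) is \<and> set is \<subseteq> {..<length as}"
proof -
  have "\<forall>x\<in>set l. \<exists>i<length as. as ! i = x" using assms by (auto simp: in_set_conv_nth)
  then obtain k where k: "\<forall>x\<in>set l. k x < length as \<and> as ! k x = x" by metis
  then show ?thesis by (intro exI[of _ "map k l"]) (auto intro!: map_idI[symmetric])
qed

context filtered_power
begin

definition vals :: "(nat \<Rightarrow> bool) \<Rightarrow> 'a cantor_fun list \<Rightarrow> 'a list" where
  "vals y fs = map (\<lambda>f. f y) fs"

text \<open>Only the values of a tuple up to automorphisms of the factor matter: \<open>V fs\<close> determines which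
  equations hold between the entries of \<open>fs\<close>, and \<open>E h fs\<close> records how \<open>h\<close> moves the pieces of the
  partition of the Cantor space on which \<open>fs\<close> is constant.\<close>

definition V :: "'a cantor_fun list \<Rightarrow> 'a list set" where
  "V fs = {map g (vals y fs) | g y. g \<in> auts}"

definition E :: "('a cantor_fun \<Rightarrow> 'a cantor_fun) \<Rightarrow> 'a cantor_fun list \<Rightarrow> ('a list \<times> 'a list) set" where
  "E h fs = {(map g (vals y fs), map g (vals y (map h fs))) | g y. g \<in> auts}"

definition tuples :: "nat \<Rightarrow> 'a list set" where
  "tuples n = {l. set l \<subseteq> A \<and> length l = n}"

lemma finite_tuples: "finite (tuples n)"
  unfolding tuples_def by (rule finite_lists_length_eq[OF finA])

lemma length_vals [simp]: "length (vals y fs) = length fs" by (simp add: vals_def)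

lemma vals_append: "vals y (fs @ gs) = vals y fs @ vals y gs" by (simp add: vals_def)

lemma vals_nth: "i < length fs \<Longrightarrow> vals y fs ! i = (fs ! i) y" by (simp add: vals_def)

lemma vals_A: "set fs \<subseteq> C \<Longrightarrow> set (vals y fs) \<subseteq> A" using C_A by (auto simp: vals_def)

lemma vals_pt: "set fs \<subseteq> C \<Longrightarrow> i < length xs \<Longrightarrow> vals (xs ! i) fs = replicate (length fs) (es ! i)"
  by (rule nth_equalityI) (auto simp: vals_nth C_iff subset_iff)

lemma V_I: "g \<in> auts \<Longrightarrow> map g (vals y fs) \<in> V fs" by (auto simp: V_def)

lemma V_I': "vals y fs \<in> V fs" using V_I[OF auts_id] by simp

lemma auts_map_tuples: "g \<in> auts \<Longrightarrow> l \<in> tuples n \<Longrightarrow> map g l \<in> tuples n"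
  using auts_closed by (auto simp: tuples_def)

lemma V_tuples: "set fs \<subseteq> C \<Longrightarrow> V fs \<subseteq> tuples (length fs)"
  using vals_A auts_closed unfolding V_def tuples_def by fastforce

lemma V_inv: "l \<in> V fs \<Longrightarrow> g \<in> auts \<Longrightarrow> map g l \<in> V fs"
proof -
  assume "l \<in> V fs" and g: "g \<in> auts"
  then obtain k y where k: "k \<in> auts" "l = map k (vals y fs)" by (auto simp: V_def)
  have "map g l = map (\<lambda>x. g (k x)) (vals y fs)" using k by simp
  then show ?thesis using V_I[OF auts_comp[OF g k(1)]] by simp
qed

lemma V_rep: "set fs \<subseteq> C \<Longrightarrow> e \<in> set es \<Longrightarrow> replicate (length fs) e \<in> V fs"
  using vals_pt V_I' len_es by (metis in_set_conv_nth)

lemma V_take: "take (length fs) ` V (fs @ gs) = V fs"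
proof -
  have "take (length fs) (map g (vals y (fs @ gs))) = map g (vals y fs)" for g y
    by (simp add: vals_append take_map)
  then show ?thesis unfolding V_def by (auto simp: image_iff) metis+
qed

lemma V_swap: "V (gs @ fs) = (\<lambda>l. drop (length fs) l @ take (length fs) l) ` V (fs @ gs)"
proof -
  have "map g (vals y (gs @ fs)) = drop (length fs) (map g (vals y (fs @ gs))) @ take (length fs) (map g (vals y (fs @ gs)))" for g y
    by (simp add: vals_append take_map drop_map)
  then show ?thesis unfolding V_def by (auto simp: image_iff) metis+
qed

lemma V_nth_eq:
  assumes "set fs \<subseteq> C" "i < length fs" "j < length fs"
  shows "fs ! i = fs ! j \<longleftrightarrow> (\<forall>v\<in>V fs. v ! i = v ! j)"
proof
  assume "fs ! i = fs ! j"
  then show "\<forall>v\<in>V fs. v ! i = v ! j" using assms by (auto simp: V_def vals_nth)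
next
  assume "\<forall>v\<in>V fs. v ! i = v ! j"
  then have "vals y fs ! i = vals y fs ! j" for y using V_I' by blast
  then show "fs ! i = fs ! j" using assms by (auto simp: vals_nth)
qed

lemma V_ops_eq:
  assumes "set fs \<subseteq> C" "set is \<subseteq> {..<length fs}" "j < length fs" "length is = ar f"
  shows "bops f (map (nth fs) is) = fs ! j \<longleftrightarrow> (\<forall>v\<in>V fs. ops f (map (nth v) is) = v ! j)"
proof -
  have e: "bops f (map (nth fs) is) y = ops f (map (nth (vals y fs)) is)" for y
  proof -
    have "map (\<lambda>g. g y) (map (nth fs) is) = map (nth (vals y fs)) is"
      using assms(2) by (auto simp: vals_nth)
    then show ?thesis by (simp only: bpower_ops_def)
  qed
  show ?thesis
  proof
    assume eq: "bops f (map (nth fs) is) = fs ! j"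
    show "\<forall>v\<in>V fs. ops f (map (nth v) is) = v ! j"
    proof
      fix v assume "v \<in> V fs"
      then obtain g y where v: "g \<in> auts" "v = map g (vals y fs)" by (auto simp: V_def)
      have s: "set (map (nth (vals y fs)) is) \<subseteq> A"
      proof
        fix x assume "x \<in> set (map (nth (vals y fs)) is)"
        then obtain i where "i < length fs" "x = vals y fs ! i" using assms(2) by auto
        then show "x \<in> A" using vals_A[OF assms(1), of y] by (metis length_vals nth_mem subsetD)
      qed
      have "map (nth v) is = map g (map (nth (vals y fs)) is)"
        using v assms(2) by auto
      then have "ops f (map (nth v) is) = g (ops f (map (nth (vals y fs)) is))"
        using auts_ops[OF v(1) _ s, of f] assms(4) by (simp only: length_map)
      also have "\<dots> = g ((fs ! j) y)" using e eq by metis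
      finally show "ops f (map (nth v) is) = v ! j" using v assms by (simp add: vals_nth)
    qed
  next
    assume "\<forall>v\<in>V fs. ops f (map (nth v) is) = v ! j"
    then have "ops f (map (nth (vals y fs)) is) = vals y fs ! j" for y using V_I' by blast
    then show "bops f (map (nth fs) is) = fs ! j" using e assms by (auto simp: vals_nth fun_eq_iff)
  qed
qed

lemma infinite_vals_fibre:
  assumes "set fs \<subseteq> C" "finite F"
  shows "infinite ({y. vals y fs = vals x fs} - F)"
proof -
  obtain N where N: "\<forall>f\<in>set fs. unif N f" using unif_list[OF assms(1)] by blast
  have "{y. agree N x y} \<subseteq> {y. vals y fs = vals x fs}"
    using N unfolding vals_def unif_def by auto
  then have "infinite {y. vals y fs = vals x fs}" using infinite_cylinder finite_subset by blast
  then show ?thesis using assms(2) by simp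
qed

text \<open>Each cylinder is infinite, so every tuple of D lying over an attained value of fs can be
  given a point of its own off the filter points. At the filter points the new entries are forced,
  which is why D must contain the constant tuples.\<close>

lemma extend_tuple:
  assumes fs: "set fs \<subseteq> C" and D: "D \<subseteq> tuples (length fs + M)"
    and Dinv: "\<And>l g. l \<in> D \<Longrightarrow> g \<in> auts \<Longrightarrow> map g l \<in> D"
    and Dtake: "take (length fs) ` D = V fs"
    and Drep: "\<And>e. e \<in> set es \<Longrightarrow> replicate (length fs + M) e \<in> D"
  shows "\<exists>gs. set gs \<subseteq> C \<and> length gs = M \<and> V (fs @ gs) = D"
proof -
  let ?n = "length fs"
  obtain N where N: "\<forall>f\<in>set fs. unif N f" using unif_list[OF fs] by blast
  have evN: "vals x fs = vals y fs" if "agree N x y" for x y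
    using N that unfolding vals_def by (auto intro: unifD)
  \<comment> \<open>The tuples of D lying over a value that is literally attained. The others lie
    over such a value only up to an automorphism and are recovered at the end through
    \<open>Dinv\<close>.\<close>
  define D' where "D' = {d \<in> D. \<exists>y. vals y fs = take ?n d}"
  have finD': "finite D'" using D finite_tuples finite_subset unfolding D'_def by fastforce
  define B where "B = (\<lambda>d. {y. vals y fs = take ?n d} - set xs)"
  have infB: "infinite (B d)" if "d \<in> D'" for d
  proof -
    have "\<exists>x. vals x fs = take ?n d" using that unfolding D'_def by blast
    then obtain x where "vals x fs = take ?n d" by blast
    then show ?thesis using infinite_vals_fibre[OF fs, of "set xs" x] unfolding B_def by simp
  qed
  obtain p where p: "inj_on p D'" "\<forall>d\<in>D'. p d \<in> B d"
    using inj_choice_infinite[of D' B, OF finD' infB] by blast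
  define v where "v = (\<lambda>s. if s \<in> set xs then replicate (?n + M) (es ! (SOME i. i < length xs \<and> s = xs ! i)) else inv_into D' p s)"
  have vp: "v (p d) = d" if "d \<in> D'" for d
    using p that by (auto simp: v_def B_def)
  have some: "(SOME j. j < length xs \<and> xs ! i = xs ! j) = i" if "i < length xs" for i
    using that dist_xs by (intro some_equality) (auto simp: nth_eq_iff_index_eq)
  have vx: "v (xs ! i) = replicate (?n + M) (es ! i)" if "i < length xs" for i
    using that some by (simp add: v_def)
  define S where "S = p ` D' \<union> set xs"
  have vS: "v s \<in> D \<and> take ?n (v s) = vals s fs" if sS: "s \<in> S" for s
  proof (cases "s \<in> set xs")
    case True
    then obtain i where i: "i < length xs" "s = xs ! i" by (auto simp: in_set_conv_nth)
    then show ?thesis using vx[OF i(1)] Drep len_es vals_pt[OF fs i(1)] by simp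
  next
    case False
    then obtain d where d: "d \<in> D'" "s = p d" using sS by (auto simp: S_def)
    then have "vals s fs = take ?n d" using p(2) by (auto simp: B_def)
    then show ?thesis using vp[OF d(1)] d by (auto simp: D'_def)
  qed
  \<comment> \<open>The choice depends on y only through \<open>vals y fs\<close>, so it is constant
    on cylinders of depth N.\<close>
  define dflt where "dflt = (\<lambda>y. SOME d. d \<in> D \<and> take ?n d = vals y fs)"
  have dflt: "dflt y \<in> D \<and> take ?n (dflt y) = vals y fs" for y
  proof -
    have "\<exists>d. d \<in> D \<and> take ?n d = vals y fs" using Dtake V_I'[of y fs] by (metis imageE)
    then show ?thesis unfolding dflt_def by (rule someI_ex)
  qed
  have "unif N dflt"
    unfolding unif_def
  proof (intro allI impI)
    fix x y assume "agree N x y"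
    from evN[OF this] show "dflt x = dflt y" by (simp add: dflt_def)
  qed
  then obtain f where f: "\<exists>L. unif L f" "\<forall>s\<in>S. f s = v s"
     "\<forall>y. f y = dflt y \<or> (\<exists>s\<in>S. f y = v s \<and> agree N y s)"
    using unif_interpolate[of S N dflt v N] finD' by (auto simp: S_def)
  \<comment> \<open>A special value v s is used only within depth N of s, where fs takes the same
    values as at s; so f y always lies over \<open>vals y fs\<close>.\<close>
  have fD: "f y \<in> D \<and> take ?n (f y) = vals y fs" for y
    using f(3)[rule_format, of y] dflt[of y] vS evN by metis
  have flen: "length (f y) = ?n + M" "set (f y) \<subseteq> A" for y using fD[of y] D by (auto simp: tuples_def)
  define gs where "gs = map (\<lambda>j y. f y ! (?n + j)) [0..<M]"
  have evg: "vals y (fs @ gs) = f y" for y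
  proof -
    have "vals y gs = drop ?n (f y)"
      using flen by (intro nth_equalityI) (auto simp: gs_def vals_def)
    then show ?thesis using fD[of y] by (metis append_take_drop_id vals_append)
  qed
  have "set gs \<subseteq> C"
  proof
    fix k assume "k \<in> set gs"
    then obtain j where j: "j < M" "k = (\<lambda>y. f y ! (?n + j))" by (auto simp: gs_def)
    have "range k \<subseteq> A" using j flen by (metis (no_types, lifting) add_less_cancel_left image_subsetI nth_mem subsetD)
    moreover have "\<exists>N. unif N k"
    proof -
      obtain L where L: "unif L f" using f(1) by blast
      have "unif L k"
        unfolding unif_def
      proof (intro allI impI)
        fix x y assume "agree L x y"
        from unifD[OF L this] show "k x = k y" by (simp add: j(2))
      qed
      then show ?thesis by blast
    qed
    moreover have "k (xs ! i) = es ! i" if "i < length xs" for i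
      using f(2) vx[OF that] that j by (simp add: S_def)
    ultimately show "k \<in> C" by (simp add: C_iff)
  qed
  moreover have "V (fs @ gs) = D"
  proof
    show "V (fs @ gs) \<subseteq> D" using evg fD Dinv by (auto simp: V_def)
    show "D \<subseteq> V (fs @ gs)"
    proof
      fix d assume d: "d \<in> D"
      then have "take ?n d \<in> V fs" using Dtake by blast
      then obtain g y where gy: "g \<in> auts" "take ?n d = map g (vals y fs)" by (auto simp: V_def)
      obtain h where h: "h \<in> auts" "\<forall>a\<in>A. h (g a) = a \<and> g (h a) = a" using auts_inv[OF gy(1)] by blast
      have "take ?n (map h d) = map h (map g (vals y fs))" using gy(2) by (simp add: take_map)
      also have "\<dots> = vals y fs" using h vals_A[OF fs, of y] by (auto intro!: map_idI)
      finally have "map h d \<in> D'" using Dinv[OF d h(1)] unfolding D'_def by auto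
      then have "f (p (map h d)) = map h d" using f(2) vp by (simp add: S_def)
      moreover have "map g (map h d) = d" using h d D by (auto intro!: map_idI simp: tuples_def subset_iff)
      ultimately have "map g (vals (p (map h d)) (fs @ gs)) = d" using evg by simp
      then show "d \<in> V (fs @ gs)" using V_I[OF gy(1)] by metis
    qed
  qed
  moreover have "length gs = M" by (simp add: gs_def)
  ultimately show ?thesis by blast
qed

text \<open>The last clause of the conclusion hands back the finite stages, so that anything further
  recorded by P, such as the edges in the conjugacy proof, can be transferred along g.\<close>

theorem back_and_forth:
  fixes P :: "'a cantor_fun list \<Rightarrow> 'a cantor_fun list \<Rightarrow> bool"
  assumes P0: "P as0 bs0"
    and inv: "\<And>as bs. P as bs \<Longrightarrow> set as \<subseteq> C \<and> set bs \<subseteq> C \<and> length as = length bs \<and> V as = V bs"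
    and forth: "\<And>as bs c. P as bs \<Longrightarrow> c \<in> C \<Longrightarrow> \<exists>as' bs'. P (as @ as') (bs @ bs') \<and> c \<in> set as'"
    and bck: "\<And>as bs c. P as bs \<Longrightarrow> c \<in> C \<Longrightarrow> \<exists>as' bs'. P (as @ as') (bs @ bs') \<and> c \<in> set bs'"
  shows "\<exists>g\<in>G. map g as0 = bs0 \<and>
    (\<forall>S. finite S \<and> S \<subseteq> C \<longrightarrow> (\<exists>as bs. P as bs \<and> S \<subseteq> set as \<and> map g as = bs))"
proof -
  define c where "c = from_nat_into C"
  have "C \<noteq> {}" using C_interpolate[of "{}"] by auto
  then have c: "range c = C" unfolding c_def by (rule range_from_nat_into[OF _ C_countable])
  have cC: "c k \<in> C" for k using c by auto
  have "\<exists>s. \<forall>k. (P (fst (s k)) (snd (s k)) \<and> (k = 0 \<longrightarrow> s k = (as0, bs0))) \<and>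
      ((\<exists>as' bs'. s (Suc k) = (fst (s k) @ as', snd (s k) @ bs')) \<and>
       c k \<in> set (fst (s (Suc k))) \<and> c k \<in> set (snd (s (Suc k))))"
  proof (rule dependent_nat_choice)
    show "\<exists>x. P (fst x) (snd x) \<and> (0 = (0::nat) \<longrightarrow> x = (as0, bs0))" using P0 by auto
    fix x and k :: nat assume "P (fst x) (snd x) \<and> (k = 0 \<longrightarrow> x = (as0, bs0))"
    then obtain as1 bs1 where 1: "P (fst x @ as1) (snd x @ bs1)" "c k \<in> set as1" using forth cC by blast
    then obtain as2 bs2 where 2: "P ((fst x @ as1) @ as2) ((snd x @ bs1) @ bs2)" "c k \<in> set bs2" using bck cC by blast
    show "\<exists>y. (P (fst y) (snd y) \<and> (Suc k = 0 \<longrightarrow> y = (as0, bs0))) \<and>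
      ((\<exists>as' bs'. y = (fst x @ as', snd x @ bs')) \<and> c k \<in> set (fst y) \<and> c k \<in> set (snd y))"
      by (rule exI[of _ "((fst x @ as1) @ as2, (snd x @ bs1) @ bs2)"]) (use 1 2 in auto)
  qed
  then obtain s where s0: "s 0 = (as0, bs0)" and sP: "\<And>k. P (fst (s k)) (snd (s k))"
    and sS: "\<And>k. \<exists>as' bs'. s (Suc k) = (fst (s k) @ as', snd (s k) @ bs')"
    and sc: "\<And>k. c k \<in> set (fst (s (Suc k)))" "\<And>k. c k \<in> set (snd (s (Suc k)))"
    by metis
  define as where "as = (\<lambda>k. fst (s k))"
  define bs where "bs = (\<lambda>k. snd (s k))"
  have AB: "set (as k) \<subseteq> C" "set (bs k) \<subseteq> C" "length (bs k) = length (as k)" "V (as k) = V (bs k)" for k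
    using inv[OF sP[of k]] by (auto simp: as_def bs_def)
  have mono: "k \<le> l \<Longrightarrow> \<exists>as' bs'. as l = as k @ as' \<and> bs l = bs k @ bs'" for k l
  proof (induction l rule: dec_induct)
    case (step n)
    then show ?case using sS[of n] by (force simp: as_def bs_def)
  qed auto
  have nthm: "as l ! i = as k ! i" "bs l ! i = bs k ! i" "i < length (as l)" if "k \<le> l" "i < length (as k)" for k l i
    using mono[OF that(1)] that AB(3)[of k] by (auto simp: nth_append)
  \<comment> \<open>Both indices are moved to a common stage, where equal \<open>V\<close> means
    equal equations between entries. One direction makes g well defined, the other makes it
    injective.\<close>
  have eqi: "as k ! i = as l ! j \<longleftrightarrow> bs k ! i = bs l ! j" if "i < length (as k)" "j < length (as l)" for k l i j
  proof -
    let ?m = "max k l"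
    have i: "as ?m ! i = as k ! i" "bs ?m ! i = bs k ! i" "i < length (as ?m)" using nthm[OF _ that(1), of ?m] by auto
    have j: "as ?m ! j = as l ! j" "bs ?m ! j = bs l ! j" "j < length (as ?m)" using nthm[OF _ that(2), of ?m] by auto
    have "as ?m ! i = as ?m ! j \<longleftrightarrow> bs ?m ! i = bs ?m ! j"
      using V_nth_eq[OF AB(1) i(3) j(3)] V_nth_eq[OF AB(2), of i ?m j] i(3) j(3) AB(3,4) by simp
    then show ?thesis using i j by simp
  qed
  define g where "g = (\<lambda>x\<in>C. SOME b. \<exists>k i. i < length (as k) \<and> as k ! i = x \<and> bs k ! i = b)"
  have g_nth: "g (as k ! i) = bs k ! i" if i: "i < length (as k)" for k i
  proof -
    have "as k ! i \<in> C" using AB(1) i by (meson nth_mem subsetD)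
    moreover have "(SOME b. \<exists>k' i'. i' < length (as k') \<and> as k' ! i' = as k ! i \<and> bs k' ! i' = b) = bs k ! i"
      using i eqi by (intro some_equality) blast+
    ultimately show ?thesis by (simp add: g_def)
  qed
  have g_map: "map g (as k) = bs k" for k
    by (rule nth_equalityI) (auto simp: g_nth AB)
  have cov: "\<exists>k. S \<subseteq> set (as k)" if "finite S" "S \<subseteq> C" for S
    using that
  proof (induction S)
    case (insert x S)
    then obtain k where k: "S \<subseteq> set (as k)" by auto
    have "x \<in> range c" using insert.prems unfolding c by simp
    then obtain l where "x = c l" by blast
    then have l: "x \<in> set (as (Suc l))" using sc(1) by (simp add: as_def)
    let ?m = "max k (Suc l)"
    have "set (as i) \<subseteq> set (as ?m)" if "i \<le> ?m" for i using mono[OF that] by auto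
    then have "set (as k) \<subseteq> set (as ?m)" "set (as (Suc l)) \<subseteq> set (as ?m)" by simp_all
    then show ?case using k l by blast
  qed auto
  have g_ext: "g \<in> C \<rightarrow>\<^sub>E C"
  proof (rule PiE_I)
    fix x assume "x \<in> C"
    then obtain k where "x \<in> set (as k)" using cov[of "{x}"] by auto
    then obtain i where i: "i < length (as k)" "x = as k ! i" by (auto simp: in_set_conv_nth)
    then have "g x = bs k ! i" using g_nth by simp
    then show "g x \<in> C" using AB i by (metis nth_mem subsetD)
  qed (simp add: g_def)
  have g_inj: "inj_on g C"
  proof (rule inj_onI)
    fix x y assume xy: "x \<in> C" "y \<in> C" "g x = g y"
    then obtain k where "{x, y} \<subseteq> set (as k)" using cov[of "{x, y}"] by auto
    then obtain i j where i: "i < length (as k)" "x = as k ! i" and j: "j < length (as k)" "y = as k ! j"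
      by (auto simp: in_set_conv_nth)
    then show "x = y" using g_nth xy(3) eqi by simp
  qed
  have g_surj: "g ` C = C"
  proof
    show "g ` C \<subseteq> C" using g_ext by auto
    show "C \<subseteq> g ` C"
    proof
      fix x assume "x \<in> C"
      then obtain l where "x = c l" using c by auto
      then have "x \<in> set (bs (Suc l))" using sc(2) by (simp add: bs_def)
      then have "x \<in> g ` set (as (Suc l))" by (metis g_map list.set_map)
      then show "x \<in> g ` C" using AB(1) by blast
    qed
  qed
  have g_hom: "g (bops f l) = bops f (map g l)" if l: "length l = ar f" "set l \<subseteq> C" for f l
  proof -
    have "bops f l \<in> C" using bops_C l by (auto simp: is_algebra_def)
    then obtain k where k: "set l \<subseteq> set (as k)" "bops f l \<in> set (as k)"
      using cov[of "insert (bops f l) (set l)"] l by auto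
    obtain "is" where is': "l = map (nth (as k)) is" "set is \<subseteq> {..<length (as k)}"
      using length_map_nth_subset[OF k(1)] by blast
    obtain j where j: "j < length (as k)" "bops f l = as k ! j" using k(2) by (auto simp: in_set_conv_nth)
    have len: "length is = ar f" using is'(1) l(1) by simp
    have "bops f (map (nth (bs k)) is) = bs k ! j"
      using V_ops_eq[OF AB(1)[of k] is'(2) j(1) len] V_ops_eq[OF AB(2)[of k] _ _ len, of j] is' j AB by simp
    moreover have "map g l = map (nth (bs k)) is" using is' g_nth by auto
    ultimately show ?thesis using j g_nth by simp
  qed
  have "g \<in> G" unfolding automorphisms_def
    using g_ext g_inj g_surj g_hom by (simp add: bij_betw_def)
  moreover have "map g as0 = bs0" using g_map[of 0] s0 by (simp add: as_def bs_def)
  moreover have "\<exists>as bs. P as bs \<and> S \<subseteq> set as \<and> map g as = bs" if "finite S" "S \<subseteq> C" for S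
    using cov[OF that] g_map sP unfolding as_def bs_def by blast
  ultimately show ?thesis by blast
qed

text \<open>An element c added to as is answered over bs by \<open>extend_tuple\<close> with D =
  \<open>V (as @ [c])\<close>, which is a legitimate D because its restriction is
  \<open>V as = V bs\<close>.\<close>

theorem homogeneous:
  assumes "set as0 \<subseteq> C" "set bs0 \<subseteq> C" "length as0 = length bs0" "V as0 = V bs0"
  shows "\<exists>g\<in>G. map g as0 = bs0"
proof -
  define P where "P = (\<lambda>as bs. set as \<subseteq> C \<and> set bs \<subseteq> C \<and> length as = length bs \<and> V as = V bs)"
  have sym: "P as bs \<Longrightarrow> P bs as" for as bs by (auto simp: P_def)
  have forth: "\<exists>as' bs'. P (as @ as') (bs @ bs') \<and> c \<in> set as'" if P: "P as bs" and c: "c \<in> C" for as bs c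
  proof -
    have ac: "set (as @ [c]) \<subseteq> C" using P c by (simp add: P_def)
    have "\<exists>gs. set gs \<subseteq> C \<and> length gs = 1 \<and> V (bs @ gs) = V (as @ [c])"
    proof (rule extend_tuple)
      show "V (as @ [c]) \<subseteq> tuples (length bs + 1)" using V_tuples[OF ac] P by (simp add: P_def)
      show "take (length bs) ` V (as @ [c]) = V bs" using V_take[of as "[c]"] P unfolding P_def by simp
      show "replicate (length bs + 1) e \<in> V (as @ [c])" if "e \<in> set es" for e
        using V_rep[OF ac that] P by (simp add: P_def)
    qed (use P V_inv in \<open>auto simp: P_def\<close>)
    then obtain gs where "set gs \<subseteq> C" "length gs = 1" "V (bs @ gs) = V (as @ [c])" by blast
    then have "P (as @ [c]) (bs @ gs)" using P c by (simp add: P_def)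
    then show ?thesis by (meson list.set_intros(1))
  qed
  have "\<exists>g\<in>G. map g as0 = bs0 \<and>
    (\<forall>S. finite S \<and> S \<subseteq> C \<longrightarrow> (\<exists>as bs. P as bs \<and> S \<subseteq> set as \<and> map g as = bs))"
  proof (rule back_and_forth)
    show "P as0 bs0" using assms by (simp add: P_def)
    show "\<exists>as' bs'. P (as @ as') (bs @ bs') \<and> c \<in> set bs'" if "P as bs" "c \<in> C" for as bs c
      using forth[OF sym[OF that(1)] that(2)] sym by blast
  qed (use forth in \<open>auto simp: P_def\<close>)
  then show ?thesis by blast
qed

text \<open>Splitting every piece by its outgoing and by its incoming edges gives two tuples of the same
  type; homogeneity matches them.\<close>

lemma realize_edges:
  assumes fs: "set fs \<subseteq> C" and RV: "Domain R = V fs" "Range R = V fs"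
    and Rinv: "\<And>u v g. (u, v) \<in> R \<Longrightarrow> g \<in> auts \<Longrightarrow> (map g u, map g v) \<in> R"
    and Rrep: "\<And>e. e \<in> set es \<Longrightarrow> (replicate (length fs) e, replicate (length fs) e) \<in> R"
  shows "\<exists>h\<in>G. E h fs = R"
proof -
  let ?n = "length fs"
  have ext: "\<exists>gs. set gs \<subseteq> C \<and> length gs = ?n \<and> V (fs @ gs) = (\<lambda>(u, v). u @ v) ` T"
    if T: "Domain T = V fs" "Range T = V fs" "\<And>u v g. (u, v) \<in> T \<Longrightarrow> g \<in> auts \<Longrightarrow> (map g u, map g v) \<in> T"
      "\<And>e. e \<in> set es \<Longrightarrow> (replicate (length fs) e, replicate (length fs) e) \<in> T" for T
  proof (rule extend_tuple[OF fs])
    have tup: "u \<in> tuples ?n" "v \<in> tuples ?n" if "(u, v) \<in> T" for u v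
      using that T V_tuples[OF fs] by blast+
    then show "(\<lambda>(u, v). u @ v) ` T \<subseteq> tuples (?n + ?n)" by (fastforce simp: tuples_def)
    show "map g l \<in> (\<lambda>(u, v). u @ v) ` T" if "l \<in> (\<lambda>(u, v). u @ v) ` T" "g \<in> auts" for l g
    proof -
      obtain u v where "(u, v) \<in> T" "l = u @ v" using \<open>l \<in> _\<close> by auto
      then have "(map g u, map g v) \<in> T" "map g l = map g u @ map g v" using T(3) \<open>g \<in> auts\<close> by auto
      then show ?thesis by force
    qed
    have "take ?n (u @ v) = u" if "(u, v) \<in> T" for u v using tup[OF that] by (simp add: tuples_def)
    then have "take ?n ` (\<lambda>(u, v). u @ v) ` T = fst ` T" by (force simp: image_image image_iff)
    then show "take ?n ` (\<lambda>(u, v). u @ v) ` T = V fs" using T(1) by (simp add: Domain_fst)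
    show "replicate (?n + ?n) e \<in> (\<lambda>(u, v). u @ v) ` T" if "e \<in> set es" for e
      using T(4)[OF that] by (force simp: replicate_add image_iff)
  qed
  obtain gs where gs: "set gs \<subseteq> C" "length gs = ?n" "V (fs @ gs) = (\<lambda>(u, v). u @ v) ` R"
    using ext[OF RV Rinv Rrep] by blast
  have "\<exists>ks. set ks \<subseteq> C \<and> length ks = ?n \<and> V (fs @ ks) = (\<lambda>(u, v). u @ v) ` (R\<inverse>)"
    by (rule ext) (use RV Rinv Rrep in auto)
  then obtain ks where ks: "set ks \<subseteq> C" "length ks = ?n" "V (fs @ ks) = (\<lambda>(u, v). u @ v) ` (R\<inverse>)" by blast
  have tup: "length u = ?n" "length v = ?n" if "(u, v) \<in> R" for u v
    using that RV V_tuples[OF fs] by (auto simp: tuples_def)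
  \<comment> \<open>ks holds the predecessors and gs the successors of fs, so both concatenations
    have the edges of R as their values. The h found next sends ks to fs and fs to gs.\<close>
  have "V (ks @ fs) = V (fs @ gs)"
    unfolding V_swap[of ks fs] ks(3) gs(3) using tup by (force simp: image_iff)
  then obtain h where h: "h \<in> G" "map h (ks @ fs) = fs @ gs"
    using homogeneous[of "ks @ fs" "fs @ gs"] fs gs ks by auto
  then have hfs: "map h fs = gs" using ks(2) by simp
  have "E h fs = (\<lambda>l. (take ?n l, drop ?n l)) ` V (fs @ gs)"
    unfolding E_def V_def hfs by (force simp: vals_append image_iff)
  also have "\<dots> = R" unfolding gs(3) using tup by (force simp: image_iff)
  finally show ?thesis using h by blast
qed

end

section \<open>Amalgamation of graphs without branching conflicts\<close>

text \<open>A direction is a colour with an orientation: \<open>True\<close> follows the edges of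
  that colour, \<open>False\<close> runs against them.\<close>

definition opp :: "nat \<times> bool \<Rightarrow> nat \<times> bool" where
  "opp d = (fst d, \<not> snd d)"

definition nbr :: "(nat \<Rightarrow> ('v \<times> 'v) set) \<Rightarrow> nat \<times> bool \<Rightarrow> ('v \<times> 'v) set" where
  "nbr R d = (if snd d then R (fst d) else (R (fst d))\<inverse>)"

lemma opp_opp [simp]: "opp (opp d) = d" and fst_opp [simp]: "fst (opp d) = fst d"
  by (auto simp: opp_def prod_eq_iff)

lemma nbr_opp: "(u, v) \<in> nbr R (opp d) \<longleftrightarrow> (v, u) \<in> nbr R d"
  by (auto simp: nbr_def opp_def)

lemma nbr_True: "nbr R (s, True) = R s"
  by (simp add: nbr_def)

text \<open>One round of cutting down the fibre product. Only the label direction is tested; in all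
  others a continuation exists by determinism, see \<open>S_forward\<close>.\<close>

definition amalgam_step :: "('v \<Rightarrow> (nat \<times> bool) option) \<Rightarrow> ('b \<Rightarrow> 'v) \<Rightarrow> ('c \<Rightarrow> 'v) \<Rightarrow> 'b set \<Rightarrow> (nat \<Rightarrow> ('b \<times> 'b) set) \<Rightarrow>
    'c set \<Rightarrow> (nat \<Rightarrow> ('c \<times> 'c) set) \<Rightarrow> ('b \<times> 'c) set \<Rightarrow> ('b \<times> 'c) set" where
  "amalgam_step \<beta> pB pC WB RB WC RC S = {(b, c). b \<in> WB \<and> c \<in> WC \<and> pB b = pC c \<and>
     (\<forall>d. \<beta> (pB b) = Some d \<longrightarrow> (\<exists>b' c'. (b', c') \<in> S \<and> (b, b') \<in> nbr RB d \<and> (c, c') \<in> nbr RC d))}"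

lemma amalgam_step_mono: "S \<subseteq> T \<Longrightarrow> amalgam_step \<beta> pB pC WB RB WC RC S \<subseteq> amalgam_step \<beta> pB pC WB RB WC RC T"
  unfolding amalgam_step_def by blast

definition surj_graph :: "nat \<Rightarrow> 'v set \<Rightarrow> (nat \<Rightarrow> ('v \<times> 'v) set) \<Rightarrow> bool" where
  "surj_graph m W R \<longleftrightarrow> (\<forall>s<m. Domain (R s) = W \<and> Range (R s) = W)"

definition graph_map :: "nat \<Rightarrow> ('b \<Rightarrow> 'v) \<Rightarrow> 'b set \<Rightarrow> (nat \<Rightarrow> ('b \<times> 'b) set) \<Rightarrow> 'v set \<Rightarrow> (nat \<Rightarrow> ('v \<times> 'v) set) \<Rightarrow> bool" where
  "graph_map m p WB RB W R \<longleftrightarrow> p ` WB = W \<and> (\<forall>s<m. map_prod p p ` RB s = R s)"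

text \<open>The label \<open>\<beta> v\<close> is the only direction in which \<open>v\<close> may branch; walks that leave \<open>v\<close> in any
  other direction are deterministic forever. Such graphs are the amalgamation bases.\<close>

definition branching :: "nat \<Rightarrow> 'v set \<Rightarrow> (nat \<Rightarrow> ('v \<times> 'v) set) \<Rightarrow> ('v \<Rightarrow> (nat \<times> bool) option) \<Rightarrow> bool" where
  "branching m W R \<beta> \<longleftrightarrow>
     (\<forall>v\<in>W. \<forall>d. \<beta> v = Some d \<longrightarrow> fst d < m) \<and>
     (\<forall>v\<in>W. \<forall>d u u'. fst d < m \<and> \<beta> v \<noteq> Some d \<and> (v, u) \<in> nbr R d \<and> (v, u') \<in> nbr R d \<longrightarrow> u = u') \<and>
     (\<forall>v\<in>W. \<forall>d u. fst d < m \<and> \<beta> v \<noteq> Some d \<and> (v, u) \<in> nbr R d \<longrightarrow> \<beta> u = None \<or> \<beta> u = Some (opp d)) \<and>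
     (\<forall>v\<in>W. \<forall>d u. \<beta> v = Some d \<and> (v, u) \<in> nbr R d \<longrightarrow> \<beta> u \<noteq> Some (opp d))"

lemma surj_graph_nbr: "surj_graph m W R \<Longrightarrow> fst d < m \<Longrightarrow> v \<in> W \<Longrightarrow> \<exists>u. (v, u) \<in> nbr R d"
  unfolding surj_graph_def nbr_def by (cases "snd d") (simp_all, blast+)

lemma surj_graph_in:
  assumes "surj_graph m W R" "fst d < m" "(v, u) \<in> nbr R d" shows "v \<in> W" "u \<in> W"
  using assms unfolding surj_graph_def nbr_def by (cases "snd d"; auto)+

lemma map_prod_converse: "map_prod p p ` (X\<inverse>) = (map_prod p p ` X)\<inverse>"
  by force

lemma graph_map_image:
  assumes "graph_map m p WB RB W R" "fst d < m"
  shows "map_prod p p ` nbr RB d = nbr R d"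
proof -
  have "map_prod p p ` RB (fst d) = R (fst d)" using assms unfolding graph_map_def by blast
  then show ?thesis by (simp add: nbr_def map_prod_converse)
qed

lemma graph_map_nbr: "graph_map m p WB RB W R \<Longrightarrow> fst d < m \<Longrightarrow> (b, b') \<in> nbr RB d \<Longrightarrow> (p b, p b') \<in> nbr R d"
  using graph_map_image[of m p WB RB W R d] by force

lemma graph_map_in: "graph_map m p WB RB W R \<Longrightarrow> b \<in> WB \<Longrightarrow> p b \<in> W"
  by (auto simp: graph_map_def)

lemma decreasing_stabilises:
  fixes S :: "nat \<Rightarrow> 'x set"
  assumes "finite (S 0)" "\<And>k. S (Suc k) \<subseteq> S k"
  shows "\<exists>k. S (Suc k) = S k"
proof (rule ccontr)
  assume "\<not> ?thesis"
  then have psub: "S (Suc k) \<subset> S k" for k using assms(2)[of k] by (simp add: psubset_eq)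
  have fin: "finite (S k)" for k
  proof (induction k)
    case (Suc k)
    then show ?case using assms(2) finite_subset by blast
  qed (rule assms(1))
  have "card (S k) + k \<le> card (S 0)" for k
  proof (induction k)
    case (Suc k)
    then show ?case using psubset_card_mono[OF fin psub[of k]] by simp
  qed simp
  from this[of "Suc (card (S 0))"] show False by simp
qed

locale amalgamation =
  fixes m :: nat and W :: "'v set" and R and WB :: "'b set" and RB and WC :: "'c set" and RC
    and pB pC and \<beta>
  assumes sB: "surj_graph m WB RB" and sC: "surj_graph m WC RC"
    and pB: "graph_map m pB WB RB W R" and pC: "graph_map m pC WC RC W R"
    and br: "branching m W R \<beta>"
begin

abbreviation "step \<equiv> amalgam_step \<beta> pB pC WB RB WC RC"
text \<open>Approximations from above to the largest part of the fibre product in which every pair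
  can be continued; for finite graphs the sequence becomes stationary.\<close>

definition "S k = (step ^^ k) {(b, c). b \<in> WB \<and> c \<in> WC \<and> pB b = pC c}"

lemma S_Suc: "S (Suc k) = step (S k)" by (simp add: S_def)

lemma S_fibre: "(b, c) \<in> S k \<Longrightarrow> b \<in> WB \<and> c \<in> WC \<and> pB b = pC c"
  by (cases k) (auto simp: S_def amalgam_step_def)

lemma S_decreasing: "S (Suc k) \<subseteq> S k"
proof (induction k)
  case 0
  show ?case by (auto simp: S_def amalgam_step_def)
next
  case (Suc k)
  then have "step (S (Suc k)) \<subseteq> step (S k)" by (rule amalgam_step_mono)
  then show ?case by (simp only: S_Suc)
qed

lemma base_m: "v \<in> W \<Longrightarrow> \<beta> v = Some d \<Longrightarrow> fst d < m"
  using br[unfolded branching_def, THEN conjunct1] by blast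

lemma base_det: "v \<in> W \<Longrightarrow> fst d < m \<Longrightarrow> \<beta> v \<noteq> Some d \<Longrightarrow> (v, u) \<in> nbr R d \<Longrightarrow> (v, u') \<in> nbr R d \<Longrightarrow> u = u'"
  by (rule br[unfolded branching_def, THEN conjunct2, THEN conjunct1, rule_format]) auto

lemma base_label: "v \<in> W \<Longrightarrow> fst d < m \<Longrightarrow> \<beta> v \<noteq> Some d \<Longrightarrow> (v, u) \<in> nbr R d \<Longrightarrow> \<beta> u = None \<or> \<beta> u = Some (opp d)"
  by (rule br[unfolded branching_def, THEN conjunct2, THEN conjunct2, THEN conjunct1, rule_format]) auto

lemma base_back: "v \<in> W \<Longrightarrow> \<beta> v = Some d \<Longrightarrow> (v, u) \<in> nbr R d \<Longrightarrow> \<beta> u \<noteq> Some (opp d)"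
  by (rule br[unfolded branching_def, THEN conjunct2, THEN conjunct2, THEN conjunct2, rule_format]) auto

text \<open>Determinism in the base puts b' and c' over the same vertex. Its label can only be
  \<open>opp d\<close>, and the continuation demanded in that direction is the pair (b, c) just
  left. Hence no level is lost.\<close>

lemma S_forward:
  assumes bc: "(b, c) \<in> S k" and d: "fst d < m" "\<beta> (pB b) \<noteq> Some d"
    and n: "(b, b') \<in> nbr RB d" "(c, c') \<in> nbr RC d"
  shows "(b', c') \<in> S k"
proof -
  have fib: "b \<in> WB" "c \<in> WC" "pB b = pC c" using S_fibre[OF bc] by auto
  have W: "pB b \<in> W" using graph_map_in[OF pB fib(1)] .
  have e: "(pB b, pB b') \<in> nbr R d" "(pB b, pC c') \<in> nbr R d"
    using graph_map_nbr[OF pB d(1) n(1)] graph_map_nbr[OF pC d(1) n(2)] fib(3) by auto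
  have fib': "b' \<in> WB" "c' \<in> WC" "pB b' = pC c'"
    using surj_graph_in[OF sB d(1) n(1)] surj_graph_in[OF sC d(1) n(2)] base_det[OF W d e] by auto
  have "(b', c') \<in> S j" if "j \<le> k" for j
  proof (cases j)
    case 0
    then show ?thesis using fib' by (simp add: S_def)
  next
    case (Suc i)
    have "(b, c) \<in> S i" using bc that Suc lift_Suc_antimono_le[of S i k] S_decreasing by auto
    then have "\<exists>b'' c''. (b'', c'') \<in> S i \<and> (b', b'') \<in> nbr RB d' \<and> (c', c'') \<in> nbr RC d'"
      if "\<beta> (pB b') = Some d'" for d'
      using base_label[OF W d e(1)] that n nbr_opp by (metis option.distinct(1) option.inject)
    then show ?thesis unfolding Suc S_Suc amalgam_step_def using fib' by blast
  qed
  then show ?thesis by simp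
qed

text \<open>If b may branch in direction d, step to some b1 in that direction, take a partner c1 of
  b1 by induction, and walk back from c1. By \<open>base_back\<close> the way back is deterministic
  in the base, so it ends over the image of b, and (b1, c1) is the continuation that level k + 1
  requires.\<close>

lemma S_lift_left: "b \<in> WB \<Longrightarrow> \<exists>c. (b, c) \<in> S k"
proof (induction k arbitrary: b)
  case 0
  then obtain c where "c \<in> WC" "pC c = pB b"
    using graph_map_in[OF pB] pC unfolding graph_map_def by (metis imageE)
  then show ?case using 0 by (auto simp: S_def)
next
  case (Suc k)
  have W: "pB b \<in> W" using graph_map_in[OF pB Suc.prems] .
  show ?case
  proof (cases "\<beta> (pB b)")
    case None
    obtain c where "(b, c) \<in> S k" using Suc by blast
    then show ?thesis using S_fibre None unfolding S_Suc amalgam_step_def by fastforce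
  next
    case (Some d)
    then have d: "fst d < m" using base_m W by blast
    obtain b1 where b1: "(b, b1) \<in> nbr RB d" using surj_graph_nbr[OF sB d Suc.prems] by blast
    then have "b1 \<in> WB" using surj_graph_in[OF sB d] by blast
    then obtain c1 where c1: "(b1, c1) \<in> S k" using Suc.IH by blast
    have fib: "c1 \<in> WC" "pB b1 = pC c1" using S_fibre[OF c1] by auto
    have e: "(pB b, pB b1) \<in> nbr R d" by (rule graph_map_nbr[OF pB d b1])
    have W1: "pB b1 \<in> W" by (rule graph_map_in[OF pB \<open>b1 \<in> WB\<close>])
    have nb: "\<beta> (pB b1) \<noteq> Some (opp d)" by (rule base_back[OF W Some e])
    obtain c where c: "(c1, c) \<in> nbr RC (opp d)" using surj_graph_nbr[OF sC _ fib(1), of "opp d"] d by auto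
    have "(pB b1, pC c) \<in> nbr R (opp d)" using graph_map_nbr[OF pC _ c] d fib by simp
    moreover have "(pB b1, pB b) \<in> nbr R (opp d)" using e by (simp add: nbr_opp)
    ultimately have "pC c = pB b" using base_det[OF W1 _ nb] d by simp
    moreover have "c \<in> WC" using surj_graph_in[OF sC _ c] d by simp
    moreover have "(c, c1) \<in> nbr RC d" using c by (simp add: nbr_opp)
    ultimately show ?thesis
      unfolding S_Suc amalgam_step_def using Suc.prems Some c1 b1 by force
  qed
qed

text \<open>By \<open>base_back\<close> at least one end of an edge does not branch along it. Lift
  that end and follow the edge with \<open>S_forward\<close>.\<close>

lemma S_edge_lift_left:
  assumes "s < m" "(b, b') \<in> RB s"
  shows "\<exists>c c'. (b, c) \<in> S k \<and> (b', c') \<in> S k \<and> (c, c') \<in> RC s"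
proof -
  let ?d = "(s, True)"
  have d: "fst ?d < m" "fst (opp ?d) < m" using assms by (auto simp: opp_def)
  have bb: "(b, b') \<in> nbr RB ?d" "(b', b) \<in> nbr RB (opp ?d)"
    using assms by (auto simp: nbr_True nbr_opp)
  have WB: "b \<in> WB" "b' \<in> WB" using surj_graph_in[OF sB d(1) bb(1)] by auto
  show ?thesis
  proof (cases "\<beta> (pB b) = Some ?d")
    case False
    obtain c where c: "(b, c) \<in> S k" using S_lift_left[OF WB(1)] by blast
    then obtain c' where c': "(c, c') \<in> nbr RC ?d" using surj_graph_nbr[OF sC d(1)] S_fibre by blast
    have "(b', c') \<in> S k" by (rule S_forward[OF c d(1) False bb(1) c'])
    then show ?thesis using c c' by (auto simp: nbr_True)
  next
    case True
    have "(pB b, pB b') \<in> nbr R ?d" by (rule graph_map_nbr[OF pB d(1) bb(1)])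
    then have nb: "\<beta> (pB b') \<noteq> Some (opp ?d)" using base_back[OF graph_map_in[OF pB WB(1)] True] by blast
    obtain c' where c': "(b', c') \<in> S k" using S_lift_left[OF WB(2)] by blast
    then obtain c where c: "(c', c) \<in> nbr RC (opp ?d)" using surj_graph_nbr[OF sC d(2)] S_fibre by blast
    have "(b, c) \<in> S k" by (rule S_forward[OF c' d(2) nb bb(2) c])
    then show ?thesis using c c' by (auto simp: nbr_True nbr_opp)
  qed
qed

text \<open>Intended for automorphisms of A acting on both factors: the label and the edges are
  invariant, so each round of cutting down is.\<close>

lemma S_invariant:
  assumes "\<And>b. b \<in> WB \<Longrightarrow> gB b \<in> WB \<and> pB (gB b) = g (pB b)"
    and "\<And>c. c \<in> WC \<Longrightarrow> gC c \<in> WC \<and> pC (gC c) = g (pC c)"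
    and "\<And>v. v \<in> W \<Longrightarrow> \<beta> (g v) = \<beta> v"
    and "\<And>b b' d. fst d < m \<Longrightarrow> (b, b') \<in> nbr RB d \<Longrightarrow> (gB b, gB b') \<in> nbr RB d"
    and "\<And>c c' d. fst d < m \<Longrightarrow> (c, c') \<in> nbr RC d \<Longrightarrow> (gC c, gC c') \<in> nbr RC d"
  shows "(b, c) \<in> S k \<Longrightarrow> (gB b, gC c) \<in> S k"
proof (induction k arbitrary: b c)
  case 0
  then show ?case using assms(1,2) by (auto simp: S_def)
next
  case (Suc k)
  have fib: "b \<in> WB" "c \<in> WC" "pB b = pC c" using S_fibre[OF Suc.prems] by auto
  have W: "pB b \<in> W" by (rule graph_map_in[OF pB fib(1)])
  have "\<exists>b' c'. (b', c') \<in> S k \<and> (gB b, b') \<in> nbr RB d \<and> (gC c, c') \<in> nbr RC d"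
    if d: "\<beta> (pB (gB b)) = Some d" for d
  proof -
    have bd: "\<beta> (pB b) = Some d" using d assms(1)[OF fib(1)] assms(3)[OF W] by simp
    then obtain b' c' where 1: "(b', c') \<in> S k" "(b, b') \<in> nbr RB d" "(c, c') \<in> nbr RC d"
      using Suc.prems unfolding S_Suc amalgam_step_def by blast
    then show ?thesis using Suc.IH[OF 1(1)] assms(4,5) base_m[OF W bd] by blast
  qed
  moreover have "gB b \<in> WB" "gC c \<in> WC" "pB (gB b) = pC (gC c)"
    using assms(1)[OF fib(1)] assms(2)[OF fib(2)] fib(3) by auto
  ultimately show ?case unfolding S_Suc amalgam_step_def by blast
qed

text \<open>A pair with loops of every colour continues to itself, so it is never removed. This
  keeps the constant tuples of the filter points.\<close>

lemma S_loops:
  assumes "b \<in> WB" "c \<in> WC" "pB b = pC c" "\<And>s. s < m \<Longrightarrow> (b, b) \<in> RB s \<and> (c, c) \<in> RC s"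
  shows "(b, c) \<in> S k"
proof (induction k)
  case 0
  then show ?case using assms by (simp add: S_def)
next
  case (Suc k)
  have "(b, b) \<in> nbr RB d \<and> (c, c) \<in> nbr RC d" if "fst d < m" for d
    using assms(4)[OF that] by (auto simp: nbr_def)
  then show ?case
    unfolding S_Suc amalgam_step_def using Suc assms base_m[OF graph_map_in[OF pB assms(1)]] by blast
qed

text \<open>At a stationary level the label direction is continued by the cutting condition, every
  other direction by \<open>S_forward\<close>.\<close>

lemma S_nbr:
  assumes "S (Suc k) = S k" "(b, c) \<in> S k" "fst d < m"
  shows "\<exists>b' c'. (b', c') \<in> S k \<and> (b, b') \<in> nbr RB d \<and> (c, c') \<in> nbr RC d"
proof (cases "\<beta> (pB b) = Some d")
  case True
  have "(b, c) \<in> step (S k)" using assms(1,2) S_Suc by simp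
  then show ?thesis using True unfolding amalgam_step_def by blast
next
  case False
  have "b \<in> WB" "c \<in> WC" using S_fibre[OF assms(2)] by auto
  then obtain b' c' where "(b, b') \<in> nbr RB d" "(c, c') \<in> nbr RC d"
    using surj_graph_nbr[OF sB assms(3)] surj_graph_nbr[OF sC assms(3)] by blast
  then show ?thesis using S_forward[OF assms(2,3) False] by blast
qed

end

lemma amalgamation_sym:
  assumes "amalgamation m W R WB RB WC RC pB pC \<beta>"
  shows "amalgamation m W R WC RC WB RB pC pB \<beta>"
  using assms by (auto simp: amalgamation_def)

text \<open>The cutting condition treats the two factors alike, so the lifting lemmas for the left
  factor also serve the right one.\<close>

lemma amalgamation_S_sym:
  assumes "amalgamation m W R WB RB WC RC pB pC \<beta>"
  shows "amalgamation.S WC RC WB RB pC pB \<beta> k = (amalgamation.S WB RB WC RC pB pC \<beta> k)\<inverse>"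
proof (induction k)
  case 0
  show ?case
    unfolding amalgamation.S_def[OF assms] amalgamation.S_def[OF amalgamation_sym[OF assms]] by auto
next
  case (Suc k)
  show ?case
    unfolding amalgamation.S_Suc[OF assms] amalgamation.S_Suc[OF amalgamation_sym[OF assms]] Suc
    by (auto simp: amalgam_step_def; metis)
qed

lemma surj_graph_alt:
  assumes "\<And>s. s < m \<Longrightarrow> R s \<subseteq> W \<times> W"
    and "\<And>d v. fst d < m \<Longrightarrow> v \<in> W \<Longrightarrow> \<exists>u. (v, u) \<in> nbr R d"
  shows "surj_graph m W R"
  unfolding surj_graph_def
proof (intro allI impI conjI)
  fix s assume s: "s < m"
  show "Domain (R s) = W" using assms(1)[OF s] assms(2)[of "(s, True)"] s by (auto simp: nbr_def)
  show "Range (R s) = W" using assms(1)[OF s] assms(2)[of "(s, False)"] s by (auto simp: nbr_def)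
qed

section \<open>Amalgams of graphs whose vertices are tuples over A\<close>

context filtered_power
begin

text \<open>The properties of the graph of an automorphism tuple on n elements, see
  \<open>edge_rels_tuple_graph\<close>; \<open>realize\<close> is the converse. The constant tuples
  and their loops come from the filter points. Emptiness from colour m on is a normalisation that
  lets graphs be compared as functions.\<close>

definition tuple_graph :: "nat \<Rightarrow> nat \<Rightarrow> 'a list set \<Rightarrow> (nat \<Rightarrow> ('a list \<times> 'a list) set) \<Rightarrow> bool" where
  "tuple_graph m n W R \<longleftrightarrow> W \<subseteq> tuples n \<and> (\<forall>l\<in>W. \<forall>g\<in>auts. map g l \<in> W) \<and>
     (\<forall>e\<in>set es. replicate n e \<in> W) \<and> surj_graph m W R \<and>
     (\<forall>s<m. (\<forall>u v. (u, v) \<in> R s \<longrightarrow> (\<forall>g\<in>auts. (map g u, map g v) \<in> R s)) \<and>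
        (\<forall>e\<in>set es. (replicate n e, replicate n e) \<in> R s)) \<and>
     (\<forall>s\<ge>m. R s = {})"

definition amalgamation_base :: "nat \<Rightarrow> 'a list set \<Rightarrow> (nat \<Rightarrow> ('a list \<times> 'a list) set) \<Rightarrow> bool" where
  "amalgamation_base m W R \<longleftrightarrow> (\<exists>\<beta>. branching m W R \<beta> \<and> (\<forall>v\<in>W. \<forall>g\<in>auts. \<beta> (map g v) = \<beta> v))"

lemma tuple_graphD:
  assumes "tuple_graph m n W R"
  shows tuple_graph_tuples: "W \<subseteq> tuples n" and tuple_graph_inv: "\<And>l g. l \<in> W \<Longrightarrow> g \<in> auts \<Longrightarrow> map g l \<in> W"
    and tuple_graph_rep: "\<And>e. e \<in> set es \<Longrightarrow> replicate n e \<in> W" and tuple_graph_surj: "surj_graph m W R"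
    and tuple_graph_edge_inv: "\<And>s u v g. s < m \<Longrightarrow> (u, v) \<in> R s \<Longrightarrow> g \<in> auts \<Longrightarrow> (map g u, map g v) \<in> R s"
    and tuple_graph_loop: "\<And>s e. s < m \<Longrightarrow> e \<in> set es \<Longrightarrow> (replicate n e, replicate n e) \<in> R s"
    and tuple_graph_empty: "\<And>s. s \<ge> m \<Longrightarrow> R s = {}"
  using assms unfolding tuple_graph_def by (simp_all)

lemma tuple_graph_nbr_inv:
  "tuple_graph m n W R \<Longrightarrow> fst d < m \<Longrightarrow> (u, v) \<in> nbr R d \<Longrightarrow> g \<in> auts \<Longrightarrow> (map g u, map g v) \<in> nbr R d"
  using tuple_graph_edge_inv[of m n W R "fst d"] by (auto simp: nbr_def split: if_splits)

text \<open>The vertices are the surviving pairs of the fibre product, the edges all product edges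
  between them. The two lifting lemmas make both projections onto on vertices and edges, and
  \<open>S_nbr\<close> keeps the graph surjective in each direction.\<close>

lemma amalgam:
  assumes B: "tuple_graph m nB WB RB" and C: "tuple_graph m nC WC RC" and n: "n \<le> nB" "n \<le> nC"
    and pB: "graph_map m (take n) WB RB W R" and pC: "graph_map m (take n) WC RC W R"
    and amalgamation_base: "amalgamation_base m W R"
  shows "\<exists>WD RD. tuple_graph m (nB + (nC - n)) WD RD \<and> graph_map m (take nB) WD RD WB RB \<and>
    graph_map m (\<lambda>l. take n l @ drop nB l) WD RD WC RC"
proof -
  obtain \<beta> where br: "branching m W R \<beta>" and \<beta>inv: "\<And>v g. v \<in> W \<Longrightarrow> g \<in> auts \<Longrightarrow> \<beta> (map g v) = \<beta> v"
    using amalgamation_base unfolding amalgamation_base_def by blast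
  interpret am: amalgamation m W R WB RB WC RC "take n" "take n" \<beta>
    using br pB pC tuple_graph_surj[OF B] tuple_graph_surj[OF C] by unfold_locales
  interpret ma: amalgamation m W R WC RC WB RB "take n" "take n" \<beta>
    by (rule amalgamation_sym) (rule am.amalgamation_axioms)
  have sym: "ma.S k = (am.S k)\<inverse>" for k by (rule amalgamation_S_sym) (rule am.amalgamation_axioms)
  have "finite (am.S 0)"
  proof (rule finite_subset)
    show "am.S 0 \<subseteq> WB \<times> WC" using am.S_fibre by auto
    show "finite (WB \<times> WC)"
      using tuple_graph_tuples[OF B] tuple_graph_tuples[OF C] finite_tuples finite_subset by blast
  qed
  then obtain k where k: "am.S (Suc k) = am.S k" using decreasing_stabilises[of am.S] am.S_decreasing by blast
  define D where "D = am.S k"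
  have D: "b \<in> WB \<and> c \<in> WC \<and> take n b = take n c" if "(b, c) \<in> D" for b c
    using am.S_fibre that by (simp add: D_def)
  have len: "length b = nB" "set b \<subseteq> A" "length c = nC" "set c \<subseteq> A" if "(b, c) \<in> D" for b c
    using D[OF that] tuple_graph_tuples[OF B] tuple_graph_tuples[OF C] by (auto simp: tuples_def)
  \<comment> \<open>b and c share their first n entries, so b followed by the rest of c records the
    pair; \<open>?q\<close> recovers c by skipping the entries private to b.\<close>
  define enc where "enc = (\<lambda>(b, c). b @ drop n (c :: 'a list))"
  let ?N = "nB + (nC - n)"
  let ?q = "\<lambda>l. take n l @ drop nB l"
  have enc1: "take nB (enc (b, c)) = b" if "(b, c) \<in> D" for b c using len[OF that] by (simp add: enc_def)
  have enc2: "?q (enc (b, c)) = c" if "(b, c) \<in> D" for b c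
    using len[OF that] D[OF that] n by (simp add: enc_def)
  define WD where "WD = enc ` D"
  define RD where "RD = (\<lambda>s. if s < m then {(enc x, enc y) | x y. x \<in> D \<and> y \<in> D \<and> (fst x, fst y) \<in> RB s \<and> (snd x, snd y) \<in> RC s} else {})"
  have RD_I: "(enc (b, c), enc (b', c')) \<in> nbr RD d"
    if "(b, c) \<in> D" "(b', c') \<in> D" "(b, b') \<in> nbr RB d" "(c, c') \<in> nbr RC d" "fst d < m" for b c b' c' d
    using that unfolding nbr_def RD_def by (cases "snd d") force+
  have inv: "(map g b, map g c) \<in> D" if "(b, c) \<in> D" "g \<in> auts" for b c g
    unfolding D_def
  proof (rule am.S_invariant[where g="map g" and gB="map g" and gC="map g" and b=b and c=c])
    show "(b, c) \<in> am.S k" using that by (simp add: D_def)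
  qed (use that(2) tuple_graph_inv[OF B] tuple_graph_inv[OF C] \<beta>inv tuple_graph_nbr_inv[OF B] tuple_graph_nbr_inv[OF C] in \<open>simp_all add: take_map\<close>)
  have encg: "map g (enc (b, c)) = enc (map g b, map g c)" for g b c by (simp add: enc_def drop_map)
  have rep: "(replicate nB e, replicate nC e) \<in> D" if "e \<in> set es" for e
    unfolding D_def
    by (rule am.S_loops) (use that tuple_graph_rep[OF B that] tuple_graph_rep[OF C that] tuple_graph_loop[OF B _ that] tuple_graph_loop[OF C _ that] n in \<open>auto simp: min_def\<close>)
  have erep: "enc (replicate nB e, replicate nC e) = replicate ?N e" for e
    by (simp add: enc_def replicate_add)
  have V: "tuple_graph m ?N WD RD"
    unfolding tuple_graph_def
  proof (intro conjI)
    show "WD \<subseteq> tuples ?N"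
    proof
      fix l assume "l \<in> WD"
      then obtain b c where bc: "(b, c) \<in> D" "l = enc (b, c)" by (auto simp: WD_def)
      then show "l \<in> tuples ?N" using len[OF bc(1)] by (auto simp: tuples_def enc_def dest!: in_set_dropD)
    qed
    show "\<forall>l\<in>WD. \<forall>g\<in>auts. map g l \<in> WD"
      using inv encg by (fastforce simp: WD_def)
    show "\<forall>e\<in>set es. replicate ?N e \<in> WD" using rep erep by (metis WD_def imageI)
    show "surj_graph m WD RD"
    proof (rule surj_graph_alt)
      show "RD s \<subseteq> WD \<times> WD" if "s < m" for s by (auto simp: RD_def WD_def)
      fix d :: "nat \<times> bool" and v assume d: "fst d < m" and "v \<in> WD"
      then obtain b c where bc: "(b, c) \<in> D" "v = enc (b, c)" by (auto simp: WD_def)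
      obtain b' c' where "(b', c') \<in> D" "(b, b') \<in> nbr RB d" "(c, c') \<in> nbr RC d"
        using am.S_nbr[OF k _ d] bc unfolding D_def by blast
      then show "\<exists>u. (v, u) \<in> nbr RD d" using RD_I[OF bc(1) _ _ _ d] bc by blast
    qed
    show "\<forall>s<m. (\<forall>u v. (u, v) \<in> RD s \<longrightarrow> (\<forall>g\<in>auts. (map g u, map g v) \<in> RD s)) \<and>
        (\<forall>e\<in>set es. (replicate ?N e, replicate ?N e) \<in> RD s)"
    proof (intro allI impI conjI ballI)
      fix s u v g assume s: "s < m" and uv: "(u, v) \<in> RD s" and g: "g \<in> auts"
      obtain b c b' c' where 1: "(b, c) \<in> D" "(b', c') \<in> D" "u = enc (b, c)" "v = enc (b', c')"
        "(b, b') \<in> RB s" "(c, c') \<in> RC s"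
        using uv s by (auto simp: RD_def)
      show "(map g u, map g v) \<in> RD s"
        using RD_I[OF inv[OF 1(1) g] inv[OF 1(2) g], of "(s, True)"] s 1 encg
          tuple_graph_edge_inv[OF B s 1(5) g] tuple_graph_edge_inv[OF C s 1(6) g] by (simp add: nbr_True)
    next
      fix s e assume s: "s < m" and e: "e \<in> set es"
      show "(replicate ?N e, replicate ?N e) \<in> RD s"
        using RD_I[OF rep[OF e] rep[OF e], of "(s, True)"] s erep
          tuple_graph_loop[OF B s e] tuple_graph_loop[OF C s e] by (simp add: nbr_True)
    qed
    show "\<forall>s\<ge>m. RD s = {}" by (simp add: RD_def)
  qed
  have gB: "graph_map m (take nB) WD RD WB RB"
    unfolding graph_map_def
  proof (intro conjI allI impI)
    show "take nB ` WD = WB"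
    proof
      show "take nB ` WD \<subseteq> WB" using enc1 D by (fastforce simp: WD_def)
      show "WB \<subseteq> take nB ` WD"
      proof
        fix b assume "b \<in> WB"
        then obtain c where "(b, c) \<in> D" using am.S_lift_left unfolding D_def by blast
        then show "b \<in> take nB ` WD" using enc1 unfolding WD_def by (metis imageI)
      qed
    qed
    fix s assume s: "s < m"
    show "map_prod (take nB) (take nB) ` RD s = RB s"
    proof
      show "map_prod (take nB) (take nB) ` RD s \<subseteq> RB s" using s enc1 by (auto simp: RD_def)
      show "RB s \<subseteq> map_prod (take nB) (take nB) ` RD s"
      proof
        fix x assume x: "x \<in> RB s"
        obtain b b' where bb: "x = (b, b')" by (cases x)
        obtain c c' where c: "(b, c) \<in> D" "(b', c') \<in> D" "(c, c') \<in> RC s"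
          using am.S_edge_lift_left[OF s] x bb unfolding D_def by blast
        have "(enc (b, c), enc (b', c')) \<in> RD s"
          using RD_I[OF c(1,2), of "(s, True)"] s c(3) x bb by (simp add: nbr_True)
        then have "map_prod (take nB) (take nB) (enc (b, c), enc (b', c')) \<in> map_prod (take nB) (take nB) ` RD s"
          by (rule imageI)
        then show "x \<in> map_prod (take nB) (take nB) ` RD s" using enc1 c bb by simp
      qed
    qed
  qed
  have gC: "graph_map m ?q WD RD WC RC"
    unfolding graph_map_def
  proof (intro conjI allI impI)
    show "?q ` WD = WC"
    proof
      show "?q ` WD \<subseteq> WC" using enc2 D by (fastforce simp: WD_def)
      show "WC \<subseteq> ?q ` WD"
      proof
        fix c assume "c \<in> WC"
        then obtain b where "(b, c) \<in> D" using ma.S_lift_left[of c k] unfolding D_def sym by blast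
        then have "?q (enc (b, c)) = c" "enc (b, c) \<in> WD" using enc2 unfolding WD_def by blast+
        then show "c \<in> ?q ` WD" by (metis (no_types, lifting) imageI)
      qed
    qed
    fix s assume s: "s < m"
    show "map_prod ?q ?q ` RD s = RC s"
    proof
      show "map_prod ?q ?q ` RD s \<subseteq> RC s"
      proof
        fix x assume "x \<in> map_prod ?q ?q ` RD s"
        then obtain b c b' c' where 1: "(b, c) \<in> D" "(b', c') \<in> D" "(c, c') \<in> RC s"
           "x = map_prod ?q ?q (enc (b, c), enc (b', c'))"
          using s by (auto simp: RD_def)
        have "x = (c, c')" unfolding 1(4) map_prod_simp enc2[OF 1(1)] enc2[OF 1(2)] ..
        then show "x \<in> RC s" using 1(3) by simp
      qed
      show "RC s \<subseteq> map_prod ?q ?q ` RD s"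
      proof
        fix x assume x: "x \<in> RC s"
        obtain c c' where cc: "x = (c, c')" by (cases x)
        obtain b b' where b: "(b, c) \<in> D" "(b', c') \<in> D" "(b, b') \<in> RB s"
          using ma.S_edge_lift_left[OF s, of c c' k] x cc unfolding D_def sym by blast
        have "(enc (b, c), enc (b', c')) \<in> RD s"
          using RD_I[OF b(1,2), of "(s, True)"] s b(3) x cc by (simp add: nbr_True)
        then have "map_prod ?q ?q (enc (b, c), enc (b', c')) \<in> map_prod ?q ?q ` RD s"
          by (rule imageI)
        moreover have "map_prod ?q ?q (enc (b, c), enc (b', c')) = x"
          unfolding cc map_prod_simp enc2[OF b(1)] enc2[OF b(2)] ..
        ultimately show "x \<in> map_prod ?q ?q ` RD s" by simp
      qed
    qed
  qed
  show ?thesis using V gB gC by blast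
qed

end

section \<open>Unfolding a graph\<close>

type_synonym 'v unfolded = "'v \<times> ((nat \<times> bool) \<times> 'v + nat \<times> bool)"

text \<open>\<open>(u, Inr d)\<close> is a copy of \<open>u\<close> entered by a step in direction \<open>d\<close>, which may branch only backwards;
  \<open>(u, Inl (d, v))\<close> is a copy of \<open>u\<close> that never branches and leaves along the given edge to \<open>v\<close>
  in direction \<open>d\<close>. All other steps follow a fixed choice of neighbours.\<close>

locale unfolded_graph =
  fixes m :: nat and W :: "'v set" and R :: "nat \<Rightarrow> ('v \<times> 'v) set"
  assumes sg: "surj_graph m W R"
begin

definition verts :: "'v unfolded set" where
  "verts = {(u, Inl (d, v)) | u d v. fst d < m \<and> (u, v) \<in> nbr R d} \<union> {(u, Inr d) | u d. u \<in> W \<and> fst d < m}"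

definition label :: "'v unfolded \<Rightarrow> (nat \<times> bool) option" where
  "label x = (case snd x of Inl _ \<Rightarrow> None | Inr d \<Rightarrow> Some (opp d))"

definition target :: "'v unfolded \<Rightarrow> nat \<times> bool \<Rightarrow> 'v" where
  "target x d = (if \<exists>v. snd x = Inl (d, v) then THE v. snd x = Inl (d, v) else SOME v. (fst x, v) \<in> nbr R d)"

definition nxt :: "'v unfolded \<Rightarrow> nat \<times> bool \<Rightarrow> 'v unfolded" where
  "nxt x d = (target x d, Inr d)"

text \<open>Each vertex contributes its deterministic step in every direction except its label. In
  the label direction it receives only the steps of other vertices, of which there may be many; this
  is where branching arises.\<close>

definition edges :: "nat \<Rightarrow> ('v unfolded \<times> 'v unfolded) set" where
  "edges s = (if s < m then {(x, nxt x (s, True)) | x. x \<in> verts \<and> label x \<noteq> Some (s, True)} \<union>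
     {(nxt x (s, False), x) | x. x \<in> verts \<and> label x \<noteq> Some (s, False)} else {})"

lemma nbr_edges: "fst d < m \<Longrightarrow> (x, y) \<in> nbr edges d \<longleftrightarrow>
    (x \<in> verts \<and> label x \<noteq> Some d \<and> y = nxt x d) \<or> (y \<in> verts \<and> label y \<noteq> Some (opp d) \<and> x = nxt y (opp d))"
  by (cases d; cases "snd d"; simp add: nbr_def edges_def opp_def del: split_paired_Ex; blast)

lemma label_nxt [simp]: "label (nxt x d) = Some (opp d)"
  by (simp add: label_def nxt_def)

lemma verts_Inl: "fst d < m \<Longrightarrow> (u, v) \<in> nbr R d \<Longrightarrow> (u, Inl (d, v)) \<in> verts"
  unfolding verts_def by blast

lemma verts_Inr: "u \<in> W \<Longrightarrow> fst d < m \<Longrightarrow> (u, Inr d) \<in> verts"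
  unfolding verts_def by blast

lemma verts_W: "x \<in> verts \<Longrightarrow> fst x \<in> W"
  using surj_graph_in[OF sg] by (auto simp: verts_def)

lemma target:
  assumes "x \<in> verts" "fst d < m" shows "(fst x, target x d) \<in> nbr R d"
proof (cases "\<exists>v. snd x = Inl (d, v)")
  case True
  then obtain v where v: "snd x = Inl (d, v)" by blast
  then have "target x d = v" by (auto simp: target_def)
  then show ?thesis using assms(1) v by (auto simp: verts_def)
next
  case False
  have "\<exists>v. (fst x, v) \<in> nbr R d" using surj_graph_nbr[OF sg assms(2) verts_W[OF assms(1)]] .
  then have "(fst x, SOME v. (fst x, v) \<in> nbr R d) \<in> nbr R d" by (rule someI_ex)
  then show ?thesis using False by (simp add: target_def)
qed

lemma nxt_verts: "x \<in> verts \<Longrightarrow> fst d < m \<Longrightarrow> nxt x d \<in> verts"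
  using surj_graph_in(2)[OF sg _ target] unfolding nxt_def by (intro verts_Inr)

lemma nbr_edges_verts: "fst d < m \<Longrightarrow> (x, y) \<in> nbr edges d \<Longrightarrow> x \<in> verts \<and> y \<in> verts"
  using nxt_verts[of x d] nxt_verts[of y "opp d"] by (auto simp: nbr_edges)

lemma nbr_edges_base: "fst d < m \<Longrightarrow> (x, y) \<in> nbr edges d \<Longrightarrow> (fst x, fst y) \<in> nbr R d"
  using target[of x d] target[of y "opp d"] by (auto simp: nbr_edges nxt_def nbr_opp)

text \<open>The \<open>Inl\<close> copies exist for this: every edge of R, whether or not it is a
  chosen one, lifts to the unfolding, so the projection is onto edges.\<close>

lemma edge_vertex: "fst d < m \<Longrightarrow> (u, v) \<in> nbr R d \<Longrightarrow>
  (u, Inl (d, v)) \<in> verts \<and> ((u, Inl (d, v)), (v, Inr d)) \<in> nbr edges d"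
  by (simp add: nbr_edges verts_Inl label_def nxt_def target_def)

lemma nbr_edges_det: "fst d < m \<Longrightarrow> label x \<noteq> Some d \<Longrightarrow> (x, y) \<in> nbr edges d \<Longrightarrow> y = nxt x d"
  by (auto simp: nbr_edges)

text \<open>An edge in the label direction of x was not contributed by x, hence by y, and y
  contributes nothing in its own label direction.\<close>

lemma nbr_edges_back: "fst d < m \<Longrightarrow> label x = Some d \<Longrightarrow> (x, y) \<in> nbr edges d \<Longrightarrow> label y \<noteq> Some (opp d)"
  by (auto simp: nbr_edges)

lemma edges_surj: "surj_graph m verts edges"
proof (rule surj_graph_alt)
  show "edges s \<subseteq> verts \<times> verts" if "s < m" for s
    using nbr_edges_verts[of "(s, True)"] that by (auto simp: nbr_True)
  fix d :: "nat \<times> bool" and x assume d: "fst d < m" and x: "x \<in> verts"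
  show "\<exists>y. (x, y) \<in> nbr edges d"
  proof (cases "label x = Some d")
    case False
    then have "(x, nxt x d) \<in> nbr edges d" using d x by (simp add: nbr_edges)
    then show ?thesis by blast
  next
    case True
    then have sx: "snd x = Inr (opp d)" by (auto simp: label_def split: sum.splits)
    \<comment> \<open>A vertex labelled d is an \<open>Inr\<close> copy entered in direction
      \<open>opp d\<close>. Any neighbour u of its base vertex in direction d has an
      \<open>Inl\<close> copy aimed at exactly this vertex.\<close>
    obtain u where "(fst x, u) \<in> nbr R d" using surj_graph_nbr[OF sg d verts_W[OF x]] by blast
    then have "(u, fst x) \<in> nbr R (opp d)" by (simp add: nbr_opp)
    then have "((u, Inl (opp d, fst x)), (fst x, Inr (opp d))) \<in> nbr edges (opp d)"
      using edge_vertex[of "opp d"] d by simp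
    then show ?thesis using sx by (metis nbr_opp opp_opp prod.collapse)
  qed
qed

lemma finite_verts:
  assumes "finite W" shows "finite verts"
proof -
  have "verts \<subseteq> W \<times> (Inl ` (({..<m} \<times> UNIV) \<times> W) \<union> Inr ` ({..<m} \<times> UNIV))"
    using surj_graph_in[OF sg] by (auto simp: verts_def image_iff)
  then show ?thesis
    by (rule finite_subset) (use assms in \<open>auto intro!: finite_imageI finite_cartesian_product\<close>)
qed

end

context filtered_power
begin

text \<open>The second component of an unfolded vertex has to be written down as values in A; since
  A has two elements, tuples of length \<open>card L\<close> suffice.\<close>

lemma finite_code:
  assumes "finite L"
  shows "\<exists>w r. inj_on w L \<and> w ` L \<subseteq> tuples r"
proof -
  have "2 \<le> card A" using A2 finA by (metis Suc_1 Suc_leI card_le_Suc0_iff_eq not_less_eq_eq numeral_2_eq_2)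
  then have "2 ^ card L \<le> card A ^ card L" by (rule power_mono) simp
  moreover have "card (tuples (card L)) = card A ^ card L"
    unfolding tuples_def using card_lists_length_eq[OF finA] by simp
  ultimately have "card L \<le> card (tuples (card L))" using less_exp[of "card L"] by linarith
  then show ?thesis using inj_on_iff_card_le[OF assms finite_tuples] by metis
qed

text \<open>Appending the list of all elements of \<open>A\<close> makes the action of \<open>auts\<close> free, so a graph may
  be unfolded on a transversal.\<close>

theorem coinitial:
  assumes m: "0 < m" and G: "tuple_graph m n W R"
  shows "\<exists>M W' R'. tuple_graph m (n + M) W' R' \<and> amalgamation_base m W' R' \<and> graph_map m (take n) W' R' W R"
proof -
  interpret ug: unfolded_graph m W R by unfold_locales (rule tuple_graph_surj[OF G])
  note W_tup = tuple_graph_tuples[OF G]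
  have finW: "finite W" by (rule finite_subset[OF W_tup finite_tuples])
  obtain w r where w: "inj_on w (snd ` ug.verts)" "w ` snd ` ug.verts \<subseteq> tuples r"
    using finite_code[of "snd ` ug.verts"] ug.finite_verts[OF finW] by blast
  obtain al where al: "set al = A" using finite_list[OF finA] by blast
  \<comment> \<open>The base tuple comes first so that \<open>take n\<close> is the projection. The
    list al of all of A makes distinct automorphisms give distinct images, and w codes the second
    component.\<close>
  define enc where "enc = (\<lambda>x. fst x @ al @ w (snd x))"
  define M where "M = length al + r"
  have lenx: "length (fst x) = n" "set (fst x) \<subseteq> A" "length (w (snd x)) = r" "set (w (snd x)) \<subseteq> A" if "x \<in> ug.verts" for x
    using ug.verts_W[OF that] W_tup w(2) that by (auto simp: tuples_def image_subset_iff)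
  have enc_tup: "enc x \<in> tuples (n + M)" if "x \<in> ug.verts" for x
    using lenx[OF that] al by (simp add: enc_def M_def tuples_def)
  have enc_eq: "x = x' \<and> (\<forall>a\<in>A. g a = g' a)"
    if "map g (enc x) = map g' (enc x')" "x \<in> ug.verts" "x' \<in> ug.verts" "g \<in> auts" "g' \<in> auts" for x x' g g'
  proof -
    note l = lenx[OF that(2)] lenx[OF that(3)]
    have e: "map g (fst x) = map g' (fst x')" "map g al = map g' al" "map g (w (snd x)) = map g' (w (snd x'))"
      using that(1) l by (auto simp: enc_def)
    have gg: "\<forall>a\<in>A. g a = g' a" using e(2) al by auto
    have inj: "inj_on g A" using that(4) by (simp add: auts_def bij_betw_def)
    have "map g (fst x) = map g (fst x')" using e(1) gg l by (metis (no_types, lifting) map_cong subsetD)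
    then have 1: "fst x = fst x'" using inj l by (metis inj_on_map_eq_map inj_on_subset Un_least)
    have "map g (w (snd x)) = map g (w (snd x'))" using e(3) gg l by (metis (no_types, lifting) map_cong subsetD)
    then have "w (snd x) = w (snd x')" using inj l by (metis inj_on_map_eq_map inj_on_subset Un_least)
    then have "snd x = snd x'" using w(1) that(2,3) by (simp add: inj_on_eq_iff)
    with 1 gg show ?thesis by (simp add: prod_eq_iff)
  qed
  \<comment> \<open>The filter values closed under automorphisms of A, because the vertex set has to
    be invariant.\<close>
  define F where "F = {g e | g e. g \<in> auts \<and> e \<in> set es}"
  have FI': "g e \<in> F" if "g \<in> auts" "e \<in> set es" for g e using that unfolding F_def by blast
  have FI: "e \<in> F" if "e \<in> set es" for e using FI'[OF auts_id that] .
  have FA: "F \<subseteq> A" using es_A auts_closed by (auto simp: F_def)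
  have Finv: "g e \<in> F" if ge: "g \<in> auts" "e \<in> F" for g e
  proof -
    obtain g' e' where g': "g' \<in> auts" "e' \<in> set es" "e = g' e'" using ge(2) by (auto simp: F_def)
    show ?thesis using FI'[OF auts_comp[OF ge(1) g'(1)] g'(2)] g'(3) by simp
  qed
  let ?rep = "replicate (n + M)"
  \<comment> \<open>An encoded vertex contains all of A and is therefore never constant.\<close>
  have enc_rep: "map g (enc x) \<noteq> ?rep e" if "g \<in> auts" for g x e
  proof
    assume e: "map g (enc x) = ?rep e"
    obtain a b where ab: "a \<in> A" "b \<in> A" "a \<noteq> b" using A2 by blast
    have "\<forall>z\<in>set (map g (enc x)). z = e" unfolding e by simp
    then have "\<forall>z\<in>A. g z = e" using al by (simp add: enc_def)
    then show False using ab auts_inj[OF that] by metis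
  qed
  \<comment> \<open>The constant tuples are added as separate vertices whose only edges are loops.
    They are disjoint from the unfolded part by \<open>enc_rep\<close>, and being deterministic they
    can have label \<open>None\<close>.\<close>
  define W' where "W' = {map g (enc x) | g x. g \<in> auts \<and> x \<in> ug.verts} \<union> ?rep ` F"
  have W'_rep: "?rep e \<in> W'" if "e \<in> F" for e using that unfolding W'_def by blast
  have W'_enc: "map g (enc x) \<in> W'" if "g \<in> auts" "x \<in> ug.verts" for g x using that unfolding W'_def by blast
  define R' where "R' = (\<lambda>s. if s < m then {(map g (enc x), map g (enc y)) | g x y. g \<in> auts \<and> (x, y) \<in> ug.edges s}
       \<union> (\<lambda>e. (?rep e, ?rep e)) ` F else {})"
  have nbrR': "(l, k) \<in> nbr R' d \<longleftrightarrow> (\<exists>g x y. g \<in> auts \<and> (x, y) \<in> nbr ug.edges d \<and> l = map g (enc x) \<and> k = map g (enc y))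
      \<or> (\<exists>e\<in>F. l = ?rep e \<and> k = ?rep e)" if "fst d < m" for l k d
    using that unfolding nbr_def R'_def
    by (cases "snd d"; simp add: image_iff del: split_paired_Ex; blast)
  have W'_inv: "map g l \<in> W'" if l: "l \<in> W'" and g: "g \<in> auts" for l g
  proof -
    from l consider (1) g' x where "g' \<in> auts" "x \<in> ug.verts" "l = map g' (enc x)" | (2) e where "e \<in> F" "l = ?rep e"
      unfolding W'_def by blast
    then show ?thesis
    proof cases
      case 1
      then have "map g l = map (\<lambda>a. g (g' a)) (enc x)" by simp
      then show ?thesis using auts_comp[OF g 1(1)] 1(2) unfolding W'_def by blast
    next
      case 2
      then show ?thesis using W'_rep[OF Finv[OF g 2(1)]] by simp
    qed
  qed
  have R'_inv: "(map g u, map g v) \<in> nbr R' d" if d: "fst d < m" and uv: "(u, v) \<in> nbr R' d" and g: "g \<in> auts" for u v g d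
  proof -
    from uv nbrR'[OF d] consider (1) g' x y where "g' \<in> auts" "(x, y) \<in> nbr ug.edges d" "u = map g' (enc x)" "v = map g' (enc y)"
      | (2) e where "e \<in> F" "u = ?rep e" "v = ?rep e" by blast
    then show ?thesis
    proof cases
      case 1
      have "map g u = map (\<lambda>a. g (g' a)) (enc x)" "map g v = map (\<lambda>a. g (g' a)) (enc y)" using 1 by simp_all
      then show ?thesis using nbrR'[OF d] auts_comp[OF g 1(1)] 1(2) by blast
    next
      case 2
      then have "map g u = ?rep (g e)" "map g v = ?rep (g e)" by simp_all
      then show ?thesis using nbrR'[OF d] Finv[OF g 2(1)] by blast
    qed
  qed
  have V: "tuple_graph m (n + M) W' R'"
    unfolding tuple_graph_def
  proof (intro conjI)
    show "W' \<subseteq> tuples (n + M)"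
    proof
      fix l assume "l \<in> W'"
      then consider (1) g' x where "g' \<in> auts" "x \<in> ug.verts" "l = map g' (enc x)" | (2) e where "e \<in> F" "l = ?rep e"
        unfolding W'_def by blast
      then show "l \<in> tuples (n + M)"
      proof cases
        case 1
        then show ?thesis using auts_map_tuples enc_tup by simp
      next
        case 2
        then show ?thesis using FA by (auto simp: tuples_def)
      qed
    qed
    show "\<forall>l\<in>W'. \<forall>g\<in>auts. map g l \<in> W'" using W'_inv by blast
    show "\<forall>e\<in>set es. ?rep e \<in> W'" using FI by (auto simp: W'_def)
    show "surj_graph m W' R'"
    proof (rule surj_graph_alt)
      show "R' s \<subseteq> W' \<times> W'" if "s < m" for s
      proof (intro subrelI)
        fix u v assume "(u, v) \<in> R' s"
        then have uv: "(u, v) \<in> nbr R' (s, True)" by (simp add: nbr_True)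
        have d: "fst (s, True) < m" using that by simp
        from uv nbrR'[OF d] consider (1) g' x y where "g' \<in> auts" "(x, y) \<in> nbr ug.edges (s, True)" "u = map g' (enc x)" "v = map g' (enc y)"
          | (2) e where "e \<in> F" "u = ?rep e" "v = ?rep e" by blast
        then show "(u, v) \<in> W' \<times> W'"
        proof cases
          case 1
          then show ?thesis using W'_enc ug.nbr_edges_verts[OF d 1(2)] by simp
        next
          case 2
          then show ?thesis using W'_rep by simp
        qed
      qed
      fix d :: "nat \<times> bool" and v assume d: "fst d < m" and "v \<in> W'"
      then consider (1) g' x where "g' \<in> auts" "x \<in> ug.verts" "v = map g' (enc x)" | (2) e where "e \<in> F" "v = ?rep e"
        unfolding W'_def by blast
      then show "\<exists>u. (v, u) \<in> nbr R' d"
      proof cases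
        case 1
        obtain y where "(x, y) \<in> nbr ug.edges d" using surj_graph_nbr[OF ug.edges_surj d 1(2)] by blast
        then show ?thesis using nbrR'[OF d] 1 by blast
      next
        case 2
        then show ?thesis using nbrR'[OF d] by blast
      qed
    qed
    show "\<forall>s<m. (\<forall>u v. (u, v) \<in> R' s \<longrightarrow> (\<forall>g\<in>auts. (map g u, map g v) \<in> R' s)) \<and>
        (\<forall>e\<in>set es. (?rep e, ?rep e) \<in> R' s)"
    proof (intro allI impI conjI ballI)
      show "(map g u, map g v) \<in> R' s" if "s < m" "(u, v) \<in> R' s" "g \<in> auts" for s u v g
        using R'_inv[of "(s, True)"] that by (simp add: nbr_True)
      show "(?rep e, ?rep e) \<in> R' s" if "s < m" "e \<in> set es" for s e
        using nbrR'[of "(s, True)" "?rep e" "?rep e"] FI[OF that(2)] that(1) by (auto simp: nbr_True)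
    qed
    show "\<forall>s\<ge>m. R' s = {}" by (simp add: R'_def)
  qed
  \<comment> \<open>By \<open>enc_eq\<close> a vertex in the orbit of an encoded one determines that
    x uniquely, so the label is well defined and invariant.\<close>
  define \<beta> where "\<beta> = (\<lambda>l. if \<exists>g x. g \<in> auts \<and> x \<in> ug.verts \<and> l = map g (enc x)
      then ug.label (SOME x. x \<in> ug.verts \<and> (\<exists>g\<in>auts. l = map g (enc x))) else None)"
  have \<beta>_enc: "\<beta> (map g (enc x)) = ug.label x" if "g \<in> auts" "x \<in> ug.verts" for g x
  proof -
    have "(SOME x'. x' \<in> ug.verts \<and> (\<exists>g'\<in>auts. map g (enc x) = map g' (enc x'))) = x"
      using that enc_eq by (intro some_equality) blast+
    moreover have "\<exists>g' x'. g' \<in> auts \<and> x' \<in> ug.verts \<and> map g (enc x) = map g' (enc x')"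
      using that by blast
    ultimately show ?thesis unfolding \<beta>_def by (simp only: if_True)
  qed
  have \<beta>_rep: "\<beta> (?rep e) = None" for e
    unfolding \<beta>_def using enc_rep by (metis (no_types, lifting))
  have br: "branching m W' R' \<beta>"
  proof -
    have det: "u = map g (enc (ug.nxt x d))"
      if hyp: "fst d < m" "g \<in> auts" "x \<in> ug.verts" "ug.label x \<noteq> Some d" "(map g (enc x), u) \<in> nbr R' d" for g x d u
    proof -
      obtain g' x' y where 1: "g' \<in> auts" "(x', y) \<in> nbr ug.edges d" "map g (enc x) = map g' (enc x')" "u = map g' (enc y)"
        using hyp(5) nbrR'[OF hyp(1)] enc_rep[OF hyp(2)] by metis
      have xy: "x' \<in> ug.verts" "y \<in> ug.verts" using ug.nbr_edges_verts[OF hyp(1) 1(2)] by auto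
      have e: "x = x'" "\<forall>a\<in>A. g a = g' a" using enc_eq[OF 1(3) hyp(3) xy(1) hyp(2) 1(1)] by auto
      have "y = ug.nxt x d" using ug.nbr_edges_det[OF hyp(1,4)] 1(2) e by blast
      moreover have "map g (enc y) = map g' (enc y)" using e(2) enc_tup[OF xy(2)] by (auto simp: tuples_def)
      ultimately show ?thesis using 1(4) by simp
    qed
    have rep_det: "u = ?rep e" if "fst d < m" "(?rep e, u) \<in> nbr R' d" for e d u
      using that(2) nbrR'[OF that(1)] enc_rep by metis
    have cases: thesis if "v \<in> W'" "\<And>g x. g \<in> auts \<Longrightarrow> x \<in> ug.verts \<Longrightarrow> v = map g (enc x) \<Longrightarrow> thesis"
      "\<And>e. e \<in> F \<Longrightarrow> v = ?rep e \<Longrightarrow> thesis" for v thesis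
      using that unfolding W'_def by blast
    show ?thesis
      unfolding branching_def
    proof (intro conjI ballI allI impI)
      fix v d assume v: "v \<in> W'" and b: "\<beta> v = Some d"
      show "fst d < m"
      proof (rule cases[OF v])
        fix g x assume x: "g \<in> auts" "x \<in> ug.verts" "v = map g (enc x)"
        then have "ug.label x = Some d" using b \<beta>_enc by simp
        then show ?thesis using x(2) by (auto simp: ug.label_def ug.verts_def)
      next
        fix e assume "v = ?rep e"
        then show ?thesis using b \<beta>_rep by simp
      qed
    next
      fix v d u u' assume v: "v \<in> W'" and a: "fst d < m \<and> \<beta> v \<noteq> Some d \<and> (v, u) \<in> nbr R' d \<and> (v, u') \<in> nbr R' d"
      show "u = u'"
      proof (rule cases[OF v])
        fix g x assume "g \<in> auts" "x \<in> ug.verts" "v = map g (enc x)"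
        then show ?thesis using a det \<beta>_enc by metis
      next
        fix e assume "v = ?rep e"
        then show ?thesis using a rep_det by blast
      qed
    next
      fix v d u assume v: "v \<in> W'" and a: "fst d < m \<and> \<beta> v \<noteq> Some d \<and> (v, u) \<in> nbr R' d"
      show "\<beta> u = None \<or> \<beta> u = Some (opp d)"
      proof (rule cases[OF v])
        fix g x assume x: "g \<in> auts" "x \<in> ug.verts" "v = map g (enc x)"
        then have "u = map g (enc (ug.nxt x d))" using a det \<beta>_enc by metis
        then show ?thesis using \<beta>_enc[OF x(1) ug.nxt_verts[OF x(2)]] a by simp
      next
        fix e assume "v = ?rep e"
        then show ?thesis using a rep_det \<beta>_rep by metis
      qed
    next
      fix v d u assume v: "v \<in> W'" and a: "\<beta> v = Some d \<and> (v, u) \<in> nbr R' d"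
      show "\<beta> u \<noteq> Some (opp d)"
      proof (rule cases[OF v])
        fix g x assume x: "g \<in> auts" "x \<in> ug.verts" "v = map g (enc x)"
        then have lx: "ug.label x = Some d" using a \<beta>_enc by metis
        then have d: "fst d < m" using x(2) by (auto simp: ug.label_def ug.verts_def)
        obtain g' x' y where 1: "g' \<in> auts" "(x', y) \<in> nbr ug.edges d" "v = map g' (enc x')" "u = map g' (enc y)"
          using a nbrR'[OF d] enc_rep[OF x(1)] x(3) by metis
        have xy: "x' \<in> ug.verts" "y \<in> ug.verts" using ug.nbr_edges_verts[OF d 1(2)] by auto
        have "x = x'" using enc_eq[of g x g' x'] 1 x xy by simp
        then show ?thesis using ug.nbr_edges_back[OF d _ 1(2)] lx \<beta>_enc[OF 1(1) xy(2)] 1(4) by simp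
      next
        fix e assume "v = ?rep e"
        then show ?thesis using a \<beta>_rep by simp
      qed
    qed
  qed
  have "\<beta> (map g v) = \<beta> v" if v: "v \<in> W'" and g: "g \<in> auts" for v g
  proof -
    from v consider (1) g' x where "g' \<in> auts" "x \<in> ug.verts" "v = map g' (enc x)" | (2) e where "e \<in> F" "v = ?rep e"
      unfolding W'_def by blast
    then show ?thesis
    proof cases
      case 1
      have "map g v = map (\<lambda>a. g (g' a)) (enc x)" using 1 by simp
      then show ?thesis using \<beta>_enc[OF auts_comp[OF g 1(1)] 1(2)] \<beta>_enc[OF 1(1,2)] 1(3)
        by (simp add: comp_def)
    next
      case 2
      then show ?thesis by (simp add: \<beta>_rep)
    qed
  qed
  then have amalgamation_base: "amalgamation_base m W' R'" unfolding amalgamation_base_def using br by blast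
  have tk: "take n (map g (enc x)) = map g (fst x)" if "x \<in> ug.verts" for g x
    using lenx[OF that] by (simp add: enc_def take_map)
  have trep: "take n (?rep e) = replicate n e" for e by (simp add: min_def)
  have rep_edge: "(replicate n e, replicate n e) \<in> nbr R d" if d: "fst d < m" and e: "e \<in> F" for d e
  proof -
    obtain g e' where "g \<in> auts" "e' \<in> set es" "e = g e'" using e by (auto simp: F_def)
    then have "(replicate n e, replicate n e) \<in> R (fst d)"
      using tuple_graph_edge_inv[OF G d tuple_graph_loop[OF G d]] by fastforce
    then show ?thesis by (simp add: nbr_def)
  qed
  have map: "map_prod (take n) (take n) ` R' s = R s" if s: "s < m" for s
  proof
    show "map_prod (take n) (take n) ` R' s \<subseteq> R s"
    proof
      fix z assume "z \<in> map_prod (take n) (take n) ` R' s"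
      then obtain l k where lk: "(l, k) \<in> nbr R' (s, True)" "z = (take n l, take n k)" by (auto simp: nbr_True)
      have d: "fst (s, True) < m" using s by simp
      from lk(1) nbrR'[OF d] consider (1) g x y where "g \<in> auts" "(x, y) \<in> nbr ug.edges (s, True)" "l = map g (enc x)" "k = map g (enc y)"
      | (2) e where "e \<in> F" "l = ?rep e" "k = ?rep e" by blast
      then show "z \<in> R s"
      proof cases
        case 1
        have xy: "x \<in> ug.verts" "y \<in> ug.verts" using ug.nbr_edges_verts[OF d 1(2)] by auto
        have "(map g (fst x), map g (fst y)) \<in> nbr R (s, True)"
          by (rule tuple_graph_nbr_inv[OF G d ug.nbr_edges_base[OF d 1(2)] 1(1)])
        then show ?thesis unfolding lk(2) 1(3) 1(4) tk[OF xy(1)] tk[OF xy(2)] nbr_True .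
      next
        case 2
        then show ?thesis using rep_edge[OF d 2(1)] lk(2) trep by (simp add: nbr_True)
      qed
    qed
    show "R s \<subseteq> map_prod (take n) (take n) ` R' s"
    proof
      fix z assume z: "z \<in> R s"
      obtain u v where uv: "z = (u, v)" by (cases z)
      let ?d = "(s, True)" and ?x = "(u, Inl ((s, True), v))" and ?y = "(v, Inr (s, True))"
      have d: "fst ?d < m" using s by simp
      have e: "(?x, ?y) \<in> nbr ug.edges ?d" using ug.edge_vertex[OF d] z uv by (simp add: nbr_True)
      have xy: "?x \<in> ug.verts" "?y \<in> ug.verts" using ug.nbr_edges_verts[OF d e] by auto
      have "(map (\<lambda>a. a) (enc ?x), map (\<lambda>a. a) (enc ?y)) \<in> nbr R' ?d" using nbrR'[OF d] e auts_id by blast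
      then have "map_prod (take n) (take n) (map (\<lambda>a. a) (enc ?x), map (\<lambda>a. a) (enc ?y)) \<in> map_prod (take n) (take n) ` R' s"
        unfolding nbr_True by (rule imageI)
      then show "z \<in> map_prod (take n) (take n) ` R' s"
        unfolding map_prod_simp tk[OF xy(1)] tk[OF xy(2)] uv by simp
    qed
  qed
  \<comment> \<open>Surjectivity on vertices is read off from the edges of colour 0; this is the use
    of m > 0.\<close>
  have "take n ` W' = W"
  proof -
    have "W' = Domain (R' 0)" "W = Domain (R 0)"
      using tuple_graph_surj[OF V] tuple_graph_surj[OF G] m by (auto simp: surj_graph_def)
    moreover have "Domain (map_prod (take n) (take n) ` R' 0) = take n ` Domain (R' 0)" by force
    ultimately show ?thesis using map[OF m] by simp
  qed
  then have "graph_map m (take n) W' R' W R" using map by (simp add: graph_map_def)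
  then show ?thesis using V amalgamation_base by blast
qed

end

section \<open>Topology of automorphism groups\<close>

lemma topspace_pointwise_top: "G \<subseteq> C \<rightarrow>\<^sub>E C \<Longrightarrow> topspace (pointwise_top C G) = G"
  by (auto simp: pointwise_top_def)

lemma topspace_tuple_top: "G \<subseteq> C \<rightarrow>\<^sub>E C \<Longrightarrow> topspace (tuple_top C G n) = {..<n} \<rightarrow>\<^sub>E G"
  by (simp add: tuple_top_def topspace_pointwise_top)

lemma openin_pointwise_top:
  assumes G: "G \<subseteq> C \<rightarrow>\<^sub>E C"
  shows "openin (pointwise_top C G) U \<longleftrightarrow>
    U \<subseteq> G \<and> (\<forall>g\<in>U. \<exists>S. finite S \<and> S \<subseteq> C \<and> (\<forall>g'\<in>G. (\<forall>c\<in>S. g' c = g c) \<longrightarrow> g' \<in> U))"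
    (is "_ \<longleftrightarrow> ?rhs")
proof
  assume o: "openin (pointwise_top C G) U"
  then obtain T where T: "openin (product_topology (\<lambda>_. discrete_topology C) C) T" "U = T \<inter> G"
    by (auto simp: pointwise_top_def openin_subtopology)
  show ?rhs
  proof (intro conjI ballI)
    show "U \<subseteq> G" using T by auto
    fix g assume g: "g \<in> U"
    then obtain B where B: "finite {i \<in> C. B i \<noteq> C}" "g \<in> Pi\<^sub>E C B" "Pi\<^sub>E C B \<subseteq> T"
      using T unfolding openin_product_topology_alt topspace_discrete_topology by blast
    have "g' \<in> U" if g': "g' \<in> G" "\<forall>c\<in>{i \<in> C. B i \<noteq> C}. g' c = g c" for g'
    proof -
      have "g' \<in> Pi\<^sub>E C B"
      proof (rule PiE_I)
        fix c assume c: "c \<in> C"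
        show "g' c \<in> B c"
        proof (cases "B c = C")
          case True
          have "g' c \<in> C" using PiE_mem[of g' C "\<lambda>_. C" c] g'(1) G c by blast
          then show ?thesis using True by simp
        next
          case False
          then show ?thesis using g'(2) c PiE_mem[OF B(2) c] by simp
        qed
      next
        fix c assume c: "c \<notin> C"
        have "g' \<in> C \<rightarrow>\<^sub>E C" using g'(1) G by blast
        then show "g' c = undefined" using c by (rule PiE_arb)
      qed
      then show ?thesis using B(3) T(2) g'(1) by blast
    qed
    then show "\<exists>S. finite S \<and> S \<subseteq> C \<and> (\<forall>g'\<in>G. (\<forall>c\<in>S. g' c = g c) \<longrightarrow> g' \<in> U)"
      using B(1) by (intro exI[of _ "{i \<in> C. B i \<noteq> C}"]) auto
  qed
next
  assume r: ?rhs
  show "openin (pointwise_top C G) U"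
  proof (subst openin_subopen, intro ballI)
    fix g assume g: "g \<in> U"
    then obtain S where S: "finite S" "S \<subseteq> C" "\<forall>g'\<in>G. (\<forall>c\<in>S. g' c = g c) \<longrightarrow> g' \<in> U"
      using r by blast
    define B where "B = (\<lambda>c. if c \<in> S then {g c} else C)"
    have gG: "g \<in> G" using g r by blast
    then have gC: "g c \<in> C" if "c \<in> C" for c using G that by blast
    have op: "openin (product_topology (\<lambda>_. discrete_topology C) C) (PiE C B)"
      unfolding openin_PiE_gen
    proof (intro disjI2 conjI ballI)
      have "{i \<in> C. B i \<noteq> topspace (discrete_topology C)} \<subseteq> S" by (auto simp: B_def)
      then show "finite {i \<in> C. B i \<noteq> topspace (discrete_topology C)}" using S(1) finite_subset by blast
      show "openin (discrete_topology C) (B i)" if "i \<in> C" for i using gC that by (auto simp: B_def)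
    qed
    have "openin (pointwise_top C G) (PiE C B \<inter> G)"
      unfolding pointwise_top_def openin_subtopology using op by blast
    moreover have "g \<in> PiE C B \<inter> G" using gG G by (fastforce simp: B_def)
    moreover have "PiE C B \<inter> G \<subseteq> U"
    proof
      fix g' assume g': "g' \<in> PiE C B \<inter> G"
      have "g' c = g c" if "c \<in> S" for c
      proof -
        have "g' c \<in> B c" using g' S(2) that by blast
        then show ?thesis using that by (simp add: B_def)
      qed
      then show "g' \<in> U" using S(3) g' by blast
    qed
    ultimately show "\<exists>T. openin (pointwise_top C G) T \<and> g \<in> T \<and> T \<subseteq> U" by blast
  qed
qed

lemma openin_tuple_top:
  assumes G: "G \<subseteq> C \<rightarrow>\<^sub>E C"
  shows "openin (tuple_top C G n) U \<longleftrightarrow> U \<subseteq> ({..<n} \<rightarrow>\<^sub>E G) \<and>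
    (\<forall>h\<in>U. \<exists>S. finite S \<and> S \<subseteq> C \<and> (\<forall>h'\<in>{..<n} \<rightarrow>\<^sub>E G. (\<forall>s<n. \<forall>c\<in>S. h' s c = h s c) \<longrightarrow> h' \<in> U))"
    (is "_ \<longleftrightarrow> ?rhs")
proof
  assume o: "openin (tuple_top C G n) U"
  show ?rhs
  proof (intro conjI ballI)
    show U: "U \<subseteq> {..<n} \<rightarrow>\<^sub>E G" using openin_subset[OF o] by (simp add: topspace_tuple_top[OF G])
    fix h assume h: "h \<in> U"
    then obtain B where B: "\<forall>i\<in>{..<n}. openin (pointwise_top C G) (B i)" "h \<in> Pi\<^sub>E {..<n} B" "Pi\<^sub>E {..<n} B \<subseteq> U"
      using o unfolding tuple_top_def openin_product_topology_alt by blast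
    have "\<forall>i\<in>{..<n}. \<exists>S. finite S \<and> S \<subseteq> C \<and> (\<forall>g'\<in>G. (\<forall>c\<in>S. g' c = h i c) \<longrightarrow> g' \<in> B i)"
    proof
      fix i assume i: "i \<in> {..<n}"
      then have "h i \<in> B i" using B(2) by blast
      then show "\<exists>S. finite S \<and> S \<subseteq> C \<and> (\<forall>g'\<in>G. (\<forall>c\<in>S. g' c = h i c) \<longrightarrow> g' \<in> B i)"
        using openin_pointwise_top[OF G, of "B i", THEN iffD1, OF B(1)[rule_format, OF i]] by simp
    qed
    then obtain S where S: "\<forall>i\<in>{..<n}. finite (S i) \<and> S i \<subseteq> C \<and> (\<forall>g'\<in>G. (\<forall>c\<in>S i. g' c = h i c) \<longrightarrow> g' \<in> B i)"
      by metis
    show "\<exists>S. finite S \<and> S \<subseteq> C \<and> (\<forall>h'\<in>{..<n} \<rightarrow>\<^sub>E G. (\<forall>s<n. \<forall>c\<in>S. h' s c = h s c) \<longrightarrow> h' \<in> U)"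
    proof (intro exI[of _ "\<Union>i<n. S i"] conjI ballI impI)
      show "finite (\<Union>i<n. S i)" "(\<Union>i<n. S i) \<subseteq> C" using S by auto
      fix h' assume h': "h' \<in> {..<n} \<rightarrow>\<^sub>E G" and a: "\<forall>s<n. \<forall>c\<in>\<Union>i<n. S i. h' s c = h s c"
      have "h' \<in> Pi\<^sub>E {..<n} B"
      proof (rule PiE_I)
        fix i assume i: "i \<in> {..<n}"
        have "h' i \<in> G" using h' i by blast
        moreover have "\<forall>c\<in>S i. h' i c = h i c" using a i by blast
        ultimately show "h' i \<in> B i" using S i by blast
      next
        fix i assume "i \<notin> {..<n}"
        then show "h' i = undefined" using h' by (rule PiE_arb[rotated])
      qed
      then show "h' \<in> U" using B(3) by blast
    qed
  qed
next
  assume r: ?rhs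
  show "openin (tuple_top C G n) U"
  proof (subst openin_subopen, intro ballI)
    fix h assume h: "h \<in> U"
    then obtain S where S: "finite S" "S \<subseteq> C"
      "\<forall>h'\<in>{..<n} \<rightarrow>\<^sub>E G. (\<forall>s<n. \<forall>c\<in>S. h' s c = h s c) \<longrightarrow> h' \<in> U"
      using r by blast
    have hG: "h \<in> {..<n} \<rightarrow>\<^sub>E G" using h r by blast
    define B where "B = (\<lambda>s. {g \<in> G. \<forall>c\<in>S. g c = h s c})"
    have "openin (pointwise_top C G) (B s)" for s
      unfolding openin_pointwise_top[OF G]
    proof (intro conjI ballI)
      show "B s \<subseteq> G" by (auto simp: B_def)
      show "\<exists>S. finite S \<and> S \<subseteq> C \<and> (\<forall>g'\<in>G. (\<forall>c\<in>S. g' c = g c) \<longrightarrow> g' \<in> B s)" if "g \<in> B s" for g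
        using that S(1,2) by (intro exI[of _ S]) (auto simp: B_def)
    qed
    then have "openin (tuple_top C G n) (PiE {..<n} B)"
      unfolding tuple_top_def by (simp add: openin_PiE)
    moreover have "h \<in> PiE {..<n} B" using hG by (auto simp: B_def PiE_def)
    moreover have "PiE {..<n} B \<subseteq> U"
    proof
      fix h' assume h': "h' \<in> PiE {..<n} B"
      have "h' s \<in> B s" if "s < n" for s using h' that by blast
      then have "\<forall>s<n. \<forall>c\<in>S. h' s c = h s c" "\<And>s. s < n \<Longrightarrow> h' s \<in> G" by (auto simp: B_def)
      moreover have "h' \<in> {..<n} \<rightarrow>\<^sub>E G" using calculation(2) h' by (auto simp: PiE_def)
      ultimately show "h' \<in> U" using S(3) by blast
    qed
    ultimately show "\<exists>T. openin (tuple_top C G n) T \<and> h \<in> T \<and> T \<subseteq> U" by blast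
  qed
qed

lemma automorphisms_subset: "automorphisms C ar ops \<subseteq> C \<rightarrow>\<^sub>E C"
  by (auto simp: automorphisms_def)

text \<open>Inside the countable product of discrete spaces, being an injective homomorphism is a
  closed condition, and surjectivity is the intersection over the countably many d of the open
  conditions that d is attained. So the automorphisms form a G-delta set.\<close>

lemma completely_metrizable_automorphisms:
  fixes ops :: "'f \<Rightarrow> 'b list \<Rightarrow> 'b"
  assumes cC: "countable C" and ne: "C \<noteq> {}" and alg: "is_algebra C ar ops"
  shows "completely_metrizable_space (pointwise_top C (automorphisms C ar ops))"
proof -
  define P where "P = product_topology (\<lambda>_. discrete_topology C) C"
  have full: "pointwise_top C (C \<rightarrow>\<^sub>E C) = P"
    unfolding P_def pointwise_top_def by (rule subtopology_superset) simp
  note op = openin_pointwise_top[OF subset_refl, of C, unfolded full]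
  have ts: "topspace P = C \<rightarrow>\<^sub>E C" by (simp add: P_def)
  have "countable {i \<in> C. \<not> (\<exists>a. topspace (discrete_topology C) \<subseteq> {a})}"
    using cC by (rule countable_subset[rotated]) auto
  then have cm: "completely_metrizable_space P"
    unfolding P_def completely_metrizable_space_product_topology
    by (simp add: completely_metrizable_space_discrete_topology)
  define H where "H = {g \<in> C \<rightarrow>\<^sub>E C. inj_on g C \<and>
        (\<forall>f xs. length xs = ar f \<and> set xs \<subseteq> C \<longrightarrow> g (ops f xs) = ops f (map g xs))}"
  define T where "T = (\<lambda>d. {g \<in> C \<rightarrow>\<^sub>E C. \<exists>c\<in>C. g c = d})"
  have "openin P (topspace P - H)"
    unfolding op
  proof (intro conjI ballI)
    show "topspace P - H \<subseteq> C \<rightarrow>\<^sub>E C" using ts by auto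
    fix g assume g: "g \<in> topspace P - H"
    then consider c d where "c \<in> C" "d \<in> C" "c \<noteq> d" "g c = g d"
      | f xs where "length xs = ar f" "set xs \<subseteq> C" "g (ops f xs) \<noteq> ops f (map g xs)"
      using ts by (auto simp: H_def inj_on_def)
    then show "\<exists>S. finite S \<and> S \<subseteq> C \<and> (\<forall>g'\<in>C \<rightarrow>\<^sub>E C. (\<forall>c\<in>S. g' c = g c) \<longrightarrow> g' \<in> topspace P - H)"
    proof cases
      case 1
      have "g' \<notin> H" if "\<forall>x\<in>{c, d}. g' x = g x" for g'
        using that 1 unfolding H_def inj_on_def by force
      moreover have "{c, d} \<subseteq> C" using 1 by simp
      ultimately show ?thesis unfolding ts by (intro exI[of _ "{c, d}"]) simp
    next
      case 2
      have opC: "ops f xs \<in> C" using alg 2 by (simp add: is_algebra_def)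
      have "g' \<notin> H" if a: "\<forall>x\<in>insert (ops f xs) (set xs). g' x = g x" for g'
      proof -
        have m: "map g' xs = map g xs" using a by simp
        have "g' (ops f xs) \<noteq> ops f (map g' xs)" unfolding m using a 2(3) by simp
        then show ?thesis using 2(1,2) unfolding H_def by blast
      qed
      moreover have "insert (ops f xs) (set xs) \<subseteq> C" using 2(2) opC by simp
      ultimately show ?thesis unfolding ts by (intro exI[of _ "insert (ops f xs) (set xs)"]) simp
    qed
  qed
  then have "closedin P H" using ts by (auto simp: closedin_def H_def)
  then have gH: "gdelta_in P H" using closed_imp_gdelta_in completely_metrizable_imp_metrizable_space[OF cm] by blast
  have "openin P (T d)" for d
    unfolding op
  proof (intro conjI ballI)
    show "T d \<subseteq> C \<rightarrow>\<^sub>E C" by (auto simp: T_def)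
    fix g assume "g \<in> T d"
    then obtain c where "c \<in> C" "g c = d" by (auto simp: T_def)
    then show "\<exists>S. finite S \<and> S \<subseteq> C \<and> (\<forall>g'\<in>C \<rightarrow>\<^sub>E C. (\<forall>c\<in>S. g' c = g c) \<longrightarrow> g' \<in> T d)"
      by (intro exI[of _ "{c}"]) (auto simp: T_def)
  qed
  then have "gdelta_in P (\<Inter>(T ` C))"
    using cC ne by (intro gdelta_in_Inter) (auto intro: open_imp_gdelta_in)
  then have "gdelta_in P (H \<inter> \<Inter>(T ` C))" using gH by (intro gdelta_in_Int)
  moreover have "H \<inter> \<Inter>(T ` C) = automorphisms C ar ops"
  proof
    show "H \<inter> \<Inter>(T ` C) \<subseteq> automorphisms C ar ops"
    proof
      fix g assume g: "g \<in> H \<inter> \<Inter>(T ` C)"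
      then have gC: "g \<in> C \<rightarrow>\<^sub>E C" "inj_on g C" by (auto simp: H_def)
      have "d \<in> g ` C" if "d \<in> C" for d using g that unfolding T_def by blast
      then have "g ` C = C" using gC(1) by blast
      then show "g \<in> automorphisms C ar ops" using g gC unfolding H_def automorphisms_def bij_betw_def by simp
    qed
    show "automorphisms C ar ops \<subseteq> H \<inter> \<Inter>(T ` C)"
    proof
      fix g assume g: "g \<in> automorphisms C ar ops"
      then have "g ` C = C" by (simp add: automorphisms_def bij_betw_def)
      then have "d \<in> g ` C" if "d \<in> C" for d using that by simp
      then have "\<exists>c\<in>C. g c = d" if "d \<in> C" for d using that unfolding image_iff by metis
      then show "g \<in> H \<inter> \<Inter>(T ` C)"
        using g unfolding H_def T_def automorphisms_def bij_betw_def by simp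
    qed
  qed
  ultimately have "gdelta_in P (automorphisms C ar ops)" by simp
  from completely_metrizable_space_gdelta_in[OF cm this] show ?thesis
    by (simp add: P_def pointwise_top_def)
qed

lemma completely_metrizable_tuple_top:
  "completely_metrizable_space (pointwise_top C G) \<Longrightarrow> completely_metrizable_space (tuple_top C G n)"
  unfolding tuple_top_def completely_metrizable_space_product_topology
  by (auto intro: countable_finite)

lemma perm_inv_automorphism:
  assumes g: "g \<in> automorphisms C ar ops" and alg: "is_algebra C ar ops"
  shows "perm_inv C g \<in> automorphisms C ar ops"
    and "\<And>c. c \<in> C \<Longrightarrow> perm_inv C g (g c) = c" and "\<And>c. c \<in> C \<Longrightarrow> g (perm_inv C g c) = c"
proof -
  have b: "bij_betw g C C" and gC: "g \<in> C \<rightarrow>\<^sub>E C"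
    and hom: "\<And>f xs. length xs = ar f \<Longrightarrow> set xs \<subseteq> C \<Longrightarrow> g (ops f xs) = ops f (map g xs)"
    using g by (auto simp: automorphisms_def)
  have gc: "g c \<in> C" if "c \<in> C" for c using gC that by blast
  show 1: "perm_inv C g (g c) = c" if "c \<in> C" for c
    using b that gc by (simp add: perm_inv_def bij_betw_inv_into_left)
  show 2: "g (perm_inv C g c) = c" if "c \<in> C" for c
    using b that by (simp add: perm_inv_def bij_betw_inv_into_right)
  have bi: "bij_betw (perm_inv C g) C C"
    using bij_betw_inv_into[OF b] bij_betw_cong[of C "perm_inv C g" "inv_into C g"] by (simp add: perm_inv_def)
  then have ic: "perm_inv C g c \<in> C" if "c \<in> C" for c using that by (auto simp: bij_betw_def)
  have "perm_inv C g (ops f xs) = ops f (map (perm_inv C g) xs)" if "length xs = ar f" "set xs \<subseteq> C" for f xs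
  proof -
    have s: "set (map (perm_inv C g) xs) \<subseteq> C" using ic that by auto
    then have o: "ops f (map (perm_inv C g) xs) \<in> C" using alg that by (simp add: is_algebra_def)
    have "g (ops f (map (perm_inv C g) xs)) = ops f (map g (map (perm_inv C g) xs))"
      by (rule hom) (use that s in auto)
    also have "map g (map (perm_inv C g) xs) = xs" using 2 that by (auto intro!: map_idI)
    finally show ?thesis using 1[OF o] by simp
  qed
  then show "perm_inv C g \<in> automorphisms C ar ops"
    using bi ic by (auto simp: automorphisms_def perm_inv_def)
qed

lemma compose_automorphism:
  assumes g: "g \<in> automorphisms C ar ops" and h: "h \<in> automorphisms C ar ops" and alg: "is_algebra C ar ops"
  shows "compose C g h \<in> automorphisms C ar ops"
proof -
  have hc: "h c \<in> C" if "c \<in> C" for c using h that by (auto simp: automorphisms_def)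
  have gc: "g c \<in> C" if "c \<in> C" for c using g that by (auto simp: automorphisms_def)
  have b: "bij_betw (compose C g h) C C"
    using g h by (auto simp: automorphisms_def intro: bij_betw_compose)
  have "compose C g h (ops f xs) = ops f (map (compose C g h) xs)" if l: "length xs = ar f" "set xs \<subseteq> C" for f xs
  proof -
    have o: "ops f xs \<in> C" using alg l by (simp add: is_algebra_def)
    have s: "set (map h xs) \<subseteq> C" using l hc by auto
    have "compose C g h (ops f xs) = g (h (ops f xs))" using o by (simp add: compose_eq)
    also have "h (ops f xs) = ops f (map h xs)" using h l by (simp add: automorphisms_def)
    also have "g \<dots> = ops f (map g (map h xs))" using g s l by (simp add: automorphisms_def)
    also have "map g (map h xs) = map (compose C g h) xs" using l by (auto simp: compose_eq)
    finally show ?thesis .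
  qed
  then show ?thesis using b hc gc by (auto simp: automorphisms_def compose_def)
qed

section \<open>Generic tuples\<close>

lemma image_Collect2: "{q (f x y) | x y. P x} = q ` {f x y | x y. P x}"
  by blast

context filtered_power
begin

abbreviation "Gseq m \<equiv> {..<m} \<rightarrow>\<^sub>E G"

lemma G_ext: "G \<subseteq> C \<rightarrow>\<^sub>E C" by (rule automorphisms_subset)

lemma G_C: "h \<in> G \<Longrightarrow> f \<in> C \<Longrightarrow> h f \<in> C"
  using G_ext by blast

lemma G_map_C: "h \<in> G \<Longrightarrow> set fs \<subseteq> C \<Longrightarrow> set (map h fs) \<subseteq> C"
  using G_C by auto

definition edge_rels :: "nat \<Rightarrow> (nat \<Rightarrow> ('a cantor_fun \<Rightarrow> 'a cantor_fun)) \<Rightarrow> 'a cantor_fun list \<Rightarrow>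
    nat \<Rightarrow> ('a list \<times> 'a list) set" where
  "edge_rels m h fs = (\<lambda>s. if s < m then E (h s) fs else {})"

lemma edge_rels_cong:
  assumes "\<And>s f. s < m \<Longrightarrow> f \<in> set fs \<Longrightarrow> h s f = k s f"
  shows "edge_rels m h fs = edge_rels m k fs"
proof -
  have "map (h s) fs = map (k s) fs" if "s < m" for s using assms[OF that] by simp
  then have "E (h s) fs = E (k s) fs" if "s < m" for s using that by (simp only: E_def)
  then show ?thesis unfolding edge_rels_def by (intro ext) simp
qed

lemma edge_rels_graph_map:
  assumes "\<And>g y. q (map g (vals y as)) = map g (vals y bs)"
    and "\<And>s g y. s < m \<Longrightarrow> q (map g (vals y (map (h s) as))) = map g (vals y (map (h s) bs))"
  shows "graph_map m q (V as) (edge_rels m h as) (V bs) (edge_rels m h bs)"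
  unfolding graph_map_def
proof (intro conjI allI impI)
  have "V bs = {q (map g (vals y as)) | g y. g \<in> auts}" unfolding V_def assms(1) ..
  also have "\<dots> = q ` V as" unfolding V_def by (rule image_Collect2)
  finally show "q ` V as = V bs" ..
  fix s assume s: "s < m"
  have "E (h s) bs = {map_prod q q (map g (vals y as), map g (vals y (map (h s) as))) | g y. g \<in> auts}"
    unfolding E_def map_prod_simp assms(1) assms(2)[OF s] ..
  also have "\<dots> = map_prod q q ` E (h s) as" unfolding E_def by (rule image_Collect2)
  finally have "map_prod q q ` E (h s) as = E (h s) bs" ..
  then show "map_prod q q ` edge_rels m h as s = edge_rels m h bs s" using s by (simp add: edge_rels_def)
qed

lemma edge_rels_graph_map_take: "graph_map m (take (length as)) (V (as @ bs)) (edge_rels m h (as @ bs)) (V as) (edge_rels m h as)"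
  by (rule edge_rels_graph_map) (simp_all add: vals_append take_map)

text \<open>Dropping the middle block of a tuple is the second projection in
  \<open>amalgam\<close>.\<close>

lemma edge_rels_graph_map_skip:
  "graph_map m (\<lambda>l. take (length as) l @ drop (length as + length bs) l)
     (V (as @ bs @ cs)) (edge_rels m h (as @ bs @ cs)) (V (as @ cs)) (edge_rels m h (as @ cs))"
  by (rule edge_rels_graph_map) (simp_all add: vals_append take_map drop_map)

text \<open>The source and the map determine the image graph. In this way a realised graph is seen
  to restrict to the intended one.\<close>

lemma graph_map_unique:
  assumes "graph_map m p W R W1 R1" "graph_map m p W R W2 R2"
    "\<And>s. s \<ge> m \<Longrightarrow> R1 s = {}" "\<And>s. s \<ge> m \<Longrightarrow> R2 s = {}"
  shows "W1 = W2" "R1 = R2"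
proof -
  show "W1 = W2" using assms unfolding graph_map_def by blast
  have "R1 s = R2 s" for s
    using assms unfolding graph_map_def by (cases "s < m") auto
  then show "R1 = R2" by blast
qed

lemma edge_rels_empty: "s \<ge> m \<Longrightarrow> edge_rels m h fs s = {}" by (simp add: edge_rels_def)

text \<open>\<open>g (as ! i) = as ! j\<close> means that along every edge entry i of the end equals
  entry j of the start, a property of the edge set alone.\<close>

lemma E_transfer:
  assumes as: "set as \<subseteq> C" and g: "g \<in> G" and e: "E g as = E k bs"
    and ij: "i < length as" "j < length as" "length bs = length as" "g (as ! i) = as ! j"
  shows "k (bs ! i) = bs ! j"
proof -
  have "v ! i = u ! j" if "(u, v) \<in> E g as" for u v
    using that ij by (auto simp: E_def vals_nth)
  moreover have "(vals y bs, vals y (map k bs)) \<in> E k bs" for y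
    using auts_id unfolding E_def by (force intro: exI[of _ "\<lambda>x. x"])
  ultimately have "vals y (map k bs) ! i = vals y bs ! j" for y using e by blast
  then have "(k (bs ! i)) y = (bs ! j) y" for y using ij by (simp add: vals_nth)
  then show ?thesis by blast
qed

text \<open>\<open>extend_tuple\<close> produces the vertices; after that the colours are
  independent and \<open>realize_edges\<close> gives one automorphism for each.\<close>

lemma realize:
  assumes fs: "set fs \<subseteq> C" and W: "tuple_graph m (length fs + M) W R"
    and t: "graph_map m (take (length fs)) W R (V fs) R0"
  shows "\<exists>gs h. set gs \<subseteq> C \<and> length gs = M \<and> h \<in> Gseq m \<and> V (fs @ gs) = W \<and> edge_rels m h (fs @ gs) = R"
proof -
  have "\<exists>gs. set gs \<subseteq> C \<and> length gs = M \<and> V (fs @ gs) = W"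
    by (rule extend_tuple[OF fs]) (use W t in \<open>simp_all add: tuple_graph_def graph_map_def\<close>)
  then obtain gs where gs: "set gs \<subseteq> C" "length gs = M" "V (fs @ gs) = W" by blast
  have fg: "set (fs @ gs) \<subseteq> C" "length (fs @ gs) = length fs + M" using fs gs by auto
  have "\<exists>h\<in>G. E h (fs @ gs) = R s" if s: "s < m" for s
  proof (rule realize_edges[OF fg(1)])
    show "Domain (R s) = V (fs @ gs)" "Range (R s) = V (fs @ gs)"
      using tuple_graph_surj[OF W] s gs(3) by (simp_all add: surj_graph_def)
    show "(map g u, map g v) \<in> R s" if "(u, v) \<in> R s" "g \<in> auts" for u v g
      using tuple_graph_edge_inv[OF W s] that by blast
    show "(replicate (length (fs @ gs)) e, replicate (length (fs @ gs)) e) \<in> R s" if "e \<in> set es" for e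
      unfolding fg(2) by (rule tuple_graph_loop[OF W s that])
  qed
  then obtain h where h: "\<And>s. s < m \<Longrightarrow> h s \<in> G \<and> E (h s) (fs @ gs) = R s" by metis
  have "edge_rels m (restrict h {..<m}) (fs @ gs) = R"
    using h tuple_graph_empty[OF W] by (auto simp: edge_rels_def fun_eq_iff)
  moreover have "restrict h {..<m} \<in> Gseq m" using h by auto
  ultimately show ?thesis using gs by blast
qed

lemma countable_params:
  "countable {(W, R). \<exists>n. tuple_graph m n W R}"
proof -
  define L where "L = {l. set l \<subseteq> A}"
  have cL: "countable L"
    using countable_lists[OF countable_finite[OF finA]] unfolding L_def lists_eq_set .
  have cW: "countable {W. finite W \<and> W \<subseteq> L}"
    using countable_Collect_finite_subset[OF cL] by (simp add: conj_commute)
  have cP: "countable {P. finite P \<and> P \<subseteq> L \<times> L}"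
    using countable_Collect_finite_subset[OF countable_SIGMA[OF cL cL]] by (simp add: conj_commute)
  define D where "D = (\<lambda>(W, l). (W :: 'a list set, \<lambda>s. if s < m then l ! s else ({} :: ('a list \<times> 'a list) set)))"
  have "{(W, R). \<exists>n. tuple_graph m n W R} \<subseteq> D ` ({W. finite W \<and> W \<subseteq> L} \<times> lists {P. finite P \<and> P \<subseteq> L \<times> L})"
  proof
    fix p assume "p \<in> {(W, R). \<exists>n. tuple_graph m n W R}"
    then obtain n W R where p: "p = (W, R)" and W: "tuple_graph m n W R" by blast
    have WL: "finite W" "W \<subseteq> L"
      using tuple_graph_tuples[OF W] finite_subset[OF _ finite_tuples] by (auto simp: L_def tuples_def)
    have RL: "finite (R s) \<and> R s \<subseteq> L \<times> L" if "s < m" for s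
    proof -
      have "R s \<subseteq> W \<times> W" using tuple_graph_surj[OF W] that by (auto simp: surj_graph_def)
      then show ?thesis using WL finite_subset[of "R s" "W \<times> W"] by blast
    qed
    have "p = D (W, map R [0..<m])"
      using tuple_graph_empty[OF W] by (auto simp: D_def p fun_eq_iff)
    moreover have "map R [0..<m] \<in> lists {P. finite P \<and> P \<subseteq> L \<times> L}" using RL by (simp add: in_lists_conv_set)
    ultimately show "p \<in> D ` ({W. finite W \<and> W \<subseteq> L} \<times> lists {P. finite P \<and> P \<subseteq> L \<times> L})"
      using WL by blast
  qed
  moreover have "countable (D ` ({W. finite W \<and> W \<subseteq> L} \<times> lists {P. finite P \<and> P \<subseteq> L \<times> L}))"
    by (intro countable_image countable_SIGMA countable_lists cW cP)
  ultimately show ?thesis by (rule countable_subset)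
qed

end

section \<open>Dense open conditions on tuples of automorphisms\<close>

context malcev_filtered_power
begin

text \<open>The description of homomorphisms onto A enters the combinatorics here: by
  \<open>automorphism_point\<close> every value of \<open>map h fs\<close> is, up to an automorphism
  of A, a value of fs. The inverse of h gives the other inclusion.\<close>

lemma V_automorphism:
  assumes h: "h \<in> G" and fs: "set fs \<subseteq> C"
  shows "V (map h fs) = V fs"
proof -
  have sub: "V (map h fs) \<subseteq> V fs" if h: "h \<in> G" and fs: "set fs \<subseteq> C" for h fs
  proof
    fix l assume "l \<in> V (map h fs)"
    then obtain g y where l: "g \<in> auts" "l = map g (vals y (map h fs))" by (auto simp: V_def)
    obtain y' k where k: "k \<in> auts" "\<forall>f\<in>C. h f y = k (f y')" using automorphism_point[OF h] by blast
    have "vals y (map h fs) = map k (vals y' fs)" using k(2) fs by (auto simp: vals_def)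
    then have "l = map (\<lambda>a. g (k a)) (vals y' fs)" using l by simp
    then show "l \<in> V fs" using V_I[OF auts_comp[OF l(1) k(1)]] by simp
  qed
  note inv = perm_inv_automorphism[OF h bops_C]
  have "map (perm_inv C h) (map h fs) = fs" using inv(2) fs by (auto intro!: map_idI)
  then have "V fs \<subseteq> V (map h fs)" using sub[OF inv(1) G_map_C[OF h fs]] by simp
  then show ?thesis using sub[OF h fs] by blast
qed

lemma edge_rels_tuple_graph:
  assumes h: "\<And>s. s < m \<Longrightarrow> h s \<in> G" and fs: "set fs \<subseteq> C"
  shows "tuple_graph m (length fs) (V fs) (edge_rels m h fs)"
  unfolding tuple_graph_def
proof (intro conjI)
  show "V fs \<subseteq> tuples (length fs)" by (rule V_tuples[OF fs])
  show "\<forall>l\<in>V fs. \<forall>g\<in>auts. map g l \<in> V fs" using V_inv by blast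
  show "\<forall>e\<in>set es. replicate (length fs) e \<in> V fs" using V_rep[OF fs] by blast
  show "surj_graph m (V fs) (edge_rels m h fs)"
    unfolding surj_graph_def
  proof (intro allI impI conjI)
    fix s assume s: "s < m"
    have "Domain (E (h s) fs) = V fs" unfolding E_def V_def by blast
    then show "Domain (edge_rels m h fs s) = V fs" using s by (simp add: edge_rels_def)
    have "Range (E (h s) fs) = V (map (h s) fs)" unfolding E_def V_def by blast
    then show "Range (edge_rels m h fs s) = V fs" using s V_automorphism[OF h[OF s] fs] by (simp add: edge_rels_def)
  qed
  show "\<forall>s<m. (\<forall>u v. (u, v) \<in> edge_rels m h fs s \<longrightarrow> (\<forall>g\<in>auts. (map g u, map g v) \<in> edge_rels m h fs s)) \<and>
     (\<forall>e\<in>set es. (replicate (length fs) e, replicate (length fs) e) \<in> edge_rels m h fs s)"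
  proof (intro allI impI conjI ballI)
    fix s u v g assume s: "s < m" and uv: "(u, v) \<in> edge_rels m h fs s" and g: "g \<in> auts"
    then obtain k y where k: "k \<in> auts" "u = map k (vals y fs)" "v = map k (vals y (map (h s) fs))"
      by (auto simp: edge_rels_def E_def)
    have "map g u = map (\<lambda>a. g (k a)) (vals y fs)" "map g v = map (\<lambda>a. g (k a)) (vals y (map (h s) fs))"
      using k by simp_all
    then show "(map g u, map g v) \<in> edge_rels m h fs s"
      using s auts_comp[OF g k(1)] unfolding edge_rels_def E_def by auto
  next
    fix s e assume s: "s < m" and "e \<in> set es"
    then obtain i where i: "i < length xs" "e = es ! i" using len_es by (metis in_set_conv_nth)
    have "(map (\<lambda>x. x) (vals (xs ! i) fs), map (\<lambda>x. x) (vals (xs ! i) (map (h s) fs))) \<in> E (h s) fs"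
      using auts_id unfolding E_def by blast
    then show "(replicate (length fs) e, replicate (length fs) e) \<in> edge_rels m h fs s"
      using s i vals_pt[OF fs i(1)] vals_pt[OF G_map_C[OF h[OF s] fs] i(1)] by (simp add: edge_rels_def)
  qed
qed (simp add: edge_rels_def)

definition base_set :: "nat \<Rightarrow> 'a cantor_fun list \<Rightarrow> (nat \<Rightarrow> ('a cantor_fun \<Rightarrow> 'a cantor_fun)) set" where
  "base_set m fs = {h \<in> Gseq m. \<exists>gs. set gs \<subseteq> C \<and> amalgamation_base m (V (fs @ gs)) (edge_rels m h (fs @ gs))}"

text \<open>An implication, so that the parameters range over a fixed countable set that does not
  depend on h. Its premise depends only on the values of h on fs, which keeps the condition
  open.\<close>

definition extension_set where
  "extension_set m fs M W R = {h \<in> Gseq m.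
     amalgamation_base m (V fs) (edge_rels m h fs) \<and> tuple_graph m (length fs + M) W R \<and>
     graph_map m (take (length fs)) W R (V fs) (edge_rels m h fs) \<longrightarrow>
     (\<exists>gs. set gs \<subseteq> C \<and> length gs = M \<and> V (fs @ gs) = W \<and> edge_rels m h (fs @ gs) = R)}"

text \<open>\<open>edge_rels\<close> on bs depends only on the values of h on bs, so a condition
  settled by the edges on finitely many elements is open.\<close>

lemma openI_edge_rels:
  assumes U: "U \<subseteq> Gseq m"
    and "\<And>h. h \<in> U \<Longrightarrow> \<exists>as. set as \<subseteq> C \<and> (\<forall>h'\<in>Gseq m.
      (\<forall>bs. set bs \<subseteq> set as \<longrightarrow> edge_rels m h' bs = edge_rels m h bs) \<longrightarrow> h' \<in> U)"
  shows "openin (tuple_top C G m) U"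
  unfolding openin_tuple_top[OF G_ext]
proof (intro conjI ballI)
  show "U \<subseteq> Gseq m" by (rule U)
  fix h assume "h \<in> U"
  from assms(2)[OF this] obtain as where as: "set as \<subseteq> C" "\<forall>h'\<in>Gseq m.
      (\<forall>bs. set bs \<subseteq> set as \<longrightarrow> edge_rels m h' bs = edge_rels m h bs) \<longrightarrow> h' \<in> U"
    by (elim exE conjE)
  show "\<exists>S. finite S \<and> S \<subseteq> C \<and> (\<forall>h'\<in>Gseq m. (\<forall>s<m. \<forall>c\<in>S. h' s c = h s c) \<longrightarrow> h' \<in> U)"
  proof (intro exI[of _ "set as"] conjI ballI impI)
    fix h' assume h': "h' \<in> Gseq m" and a: "\<forall>s<m. \<forall>c\<in>set as. h' s c = h s c"
    have "edge_rels m h' bs = edge_rels m h bs" if "set bs \<subseteq> set as" for bs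
      by (rule edge_rels_cong) (use a that in blast)
    then show "h' \<in> U" using as(2)[rule_format, OF h'] by simp
  qed (simp_all add: as(1))
qed

lemma base_set_open:
  assumes "set fs \<subseteq> C" shows "openin (tuple_top C G m) (base_set m fs)"
proof (rule openI_edge_rels)
  show "base_set m fs \<subseteq> Gseq m" by (auto simp: base_set_def)
  fix h assume "h \<in> base_set m fs"
  then obtain gs where gs: "set gs \<subseteq> C" "amalgamation_base m (V (fs @ gs)) (edge_rels m h (fs @ gs))"
    by (auto simp: base_set_def)
  show "\<exists>as. set as \<subseteq> C \<and> (\<forall>h'\<in>Gseq m.
      (\<forall>bs. set bs \<subseteq> set as \<longrightarrow> edge_rels m h' bs = edge_rels m h bs) \<longrightarrow> h' \<in> base_set m fs)"
  proof (intro exI[of _ "fs @ gs"] conjI ballI impI)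
    fix h' assume h': "h' \<in> Gseq m" and a: "\<forall>bs. set bs \<subseteq> set (fs @ gs) \<longrightarrow> edge_rels m h' bs = edge_rels m h bs"
    have "edge_rels m h' (fs @ gs) = edge_rels m h (fs @ gs)" using a by blast
    then have "amalgamation_base m (V (fs @ gs)) (edge_rels m h' (fs @ gs))" using gs(2) by simp
    then show "h' \<in> base_set m fs" using h' gs(1) unfolding base_set_def by blast
  qed (use gs assms in auto)
qed

lemma extension_set_open:
  assumes "set fs \<subseteq> C" shows "openin (tuple_top C G m) (extension_set m fs M W R)"
proof (rule openI_edge_rels)
  show "extension_set m fs M W R \<subseteq> Gseq m" by (auto simp: extension_set_def)
  fix h assume h: "h \<in> extension_set m fs M W R"
  show "\<exists>as. set as \<subseteq> C \<and> (\<forall>h'\<in>Gseq m.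
      (\<forall>bs. set bs \<subseteq> set as \<longrightarrow> edge_rels m h' bs = edge_rels m h bs) \<longrightarrow> h' \<in> extension_set m fs M W R)"
  proof (cases "\<exists>gs. set gs \<subseteq> C \<and> length gs = M \<and> V (fs @ gs) = W \<and> edge_rels m h (fs @ gs) = R")
    case True
    then obtain gs where gs: "set gs \<subseteq> C" "length gs = M" "V (fs @ gs) = W" "edge_rels m h (fs @ gs) = R" by blast
    show ?thesis
    proof (intro exI[of _ "fs @ gs"] conjI ballI impI)
      fix h' assume h': "h' \<in> Gseq m" and a: "\<forall>bs. set bs \<subseteq> set (fs @ gs) \<longrightarrow> edge_rels m h' bs = edge_rels m h bs"
      have "edge_rels m h' (fs @ gs) = R" using a gs(4) by blast
      then show "h' \<in> extension_set m fs M W R" using h' gs unfolding extension_set_def by blast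
    qed (use gs assms in auto)
  next
    case False
    show ?thesis
    proof (intro exI[of _ fs] conjI ballI impI)
      fix h' assume h': "h' \<in> Gseq m" and a: "\<forall>bs. set bs \<subseteq> set fs \<longrightarrow> edge_rels m h' bs = edge_rels m h bs"
      have qe: "edge_rels m h' fs = edge_rels m h fs" using a by blast
      have "\<not> (amalgamation_base m (V fs) (edge_rels m h fs) \<and> tuple_graph m (length fs + M) W R \<and>
          graph_map m (take (length fs)) W R (V fs) (edge_rels m h fs))"
        using h False unfolding extension_set_def by simp
      then show "h' \<in> extension_set m fs M W R"
        unfolding extension_set_def mem_Collect_eq qe using h' by blast
    qed (use assms in auto)
  qed
qed

lemma open_tupleD: "openin (tuple_top C G m) U \<Longrightarrow> h \<in> U \<Longrightarrow> h \<in> Gseq m"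
  using openin_subset[of "tuple_top C G m" U] by (auto simp only: topspace_tuple_top[OF G_ext])

lemma tuple_G: "h \<in> Gseq m \<Longrightarrow> s < m \<Longrightarrow> h s \<in> G"
  by (rule PiE_mem[of h "{..<m}" "\<lambda>_. G"]) simp_all

text \<open>ks lists the finite set S of a basic neighbourhood together with its images under h0.
  The equations fixing h0 on S are then equations between entries, and \<open>E_transfer\<close>
  imposes them on every h with the same edges.\<close>

lemma capture_open:
  assumes O: "openin (tuple_top C G m) U" and h0: "h0 \<in> U"
  shows "\<exists>ks. set ks \<subseteq> C \<and> (\<forall>fs. set fs \<subseteq> C \<longrightarrow> (\<forall>h\<in>Gseq m. edge_rels m h (fs @ ks) = edge_rels m h0 (fs @ ks) \<longrightarrow> h \<in> U))"
proof -
  obtain S where S: "finite S" "S \<subseteq> C"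
    "\<forall>h'\<in>Gseq m. (\<forall>s<m. \<forall>c\<in>S. h' s c = h0 s c) \<longrightarrow> h' \<in> U"
    using O[unfolded openin_tuple_top[OF G_ext], THEN conjunct2, rule_format, OF h0] by (elim exE conjE)
  have h0G: "h0 s \<in> G" if "s < m" for s
    by (rule tuple_G[OF open_tupleD[OF O h0] that])
  have "finite (S \<union> (\<Union>s<m. h0 s ` S))" using S(1) by auto
  from finite_list[OF this] obtain ks where ks: "set ks = S \<union> (\<Union>s<m. h0 s ` S)" by (elim exE)
  have ksC: "set ks \<subseteq> C" unfolding ks using S(2) G_C[OF h0G] by (auto dest: subsetD)
  show ?thesis
  proof (intro exI[of _ ks] conjI allI impI ballI ksC)
    fix fs h assume fs: "set fs \<subseteq> C" and h: "h \<in> Gseq m" and q: "edge_rels m h (fs @ ks) = edge_rels m h0 (fs @ ks)"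
    have eq: "h s c = h0 s c" if s: "s < m" and c: "c \<in> S" for s c
    proof -
      let ?l = "fs @ ks"
      have lC: "set ?l \<subseteq> C" using fs ksC by simp
      have "c \<in> set ?l" "h0 s c \<in> set ?l" using ks s c by auto
      then obtain i j where i: "i < length ?l" "?l ! i = c" and j: "j < length ?l" "?l ! j = h0 s c"
        by (metis in_set_conv_nth)
      have "E (h0 s) ?l = E (h s) ?l" using q s by (metis edge_rels_def)
      from E_transfer[OF lC h0G[OF s] this i(1) j(1) refl] show ?thesis using i j by simp
    qed
    show "h \<in> U" using S(3)[rule_format, OF h] eq by simp
  qed
qed

text \<open>Refine the graph of h0 on fs and ks to an amalgamation base by \<open>coinitial\<close>
  and realise it. The edges on fs and ks are unchanged, so the new tuple is still in U.\<close>

lemma base_set_dense: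
  assumes m: "0 < m" and fs: "set fs \<subseteq> C"
  shows "tuple_top C G m closure_of base_set m fs = topspace (tuple_top C G m)"
  unfolding dense_intersects_open
proof (intro allI impI)
  fix U assume a: "openin (tuple_top C G m) U \<and> U \<noteq> {}"
  then obtain h0 where h0: "h0 \<in> U" by blast
  have h0G: "h0 s \<in> G" if "s < m" for s
    by (rule tuple_G[OF open_tupleD[OF conjunct1[OF a] h0] that])
  obtain ks where ks: "set ks \<subseteq> C" "\<And>h. h\<in>Gseq m \<Longrightarrow> edge_rels m h (fs @ ks) = edge_rels m h0 (fs @ ks) \<Longrightarrow> h \<in> U"
    using capture_open[of m U h0] a h0 fs by blast
  have l: "set (fs @ ks) \<subseteq> C" using fs ks by simp
  have vg: "tuple_graph m (length (fs @ ks)) (V (fs @ ks)) (edge_rels m h0 (fs @ ks))"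
    by (rule edge_rels_tuple_graph) (use h0G l in auto)
  obtain M W R where W: "tuple_graph m (length (fs @ ks) + M) W R" "amalgamation_base m W R"
    "graph_map m (take (length (fs @ ks))) W R (V (fs @ ks)) (edge_rels m h0 (fs @ ks))"
    using coinitial[OF m vg] by blast
  obtain gs h where h: "set gs \<subseteq> C" "length gs = M" "h \<in> Gseq m"
    "V ((fs @ ks) @ gs) = W" "edge_rels m h ((fs @ ks) @ gs) = R"
    using realize[OF l W(1,3)] by blast
  have "edge_rels m h (fs @ ks) = edge_rels m h0 (fs @ ks)"
    using edge_rels_graph_map_take[of m "fs @ ks" gs h] unfolding h(4,5)
    by (rule graph_map_unique(2)[OF _ W(3)]) (simp_all add: edge_rels_empty)
  then have "h \<in> U" using ks(2) h(3) by blast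
  moreover have "h \<in> base_set m fs"
    unfolding base_set_def using h(1,3) W(2) ks(1) h(4,5)
    by (intro CollectI conjI exI[of _ "ks @ gs"]) auto
  ultimately show "base_set m fs \<inter> U \<noteq> {}" by blast
qed

text \<open>Unless h0 already belongs to the set, the graph on fs is an amalgamation base. Its
  refinement by the elements ks that pin down U is amalgamated with the required extension, and the
  amalgam is realised by new elements gs: with ks it stays in U, without ks it gives (W, R).\<close>

lemma extension_set_dense:
  assumes fs: "set fs \<subseteq> C"
  shows "tuple_top C G m closure_of extension_set m fs M W R = topspace (tuple_top C G m)"
  unfolding dense_intersects_open
proof (intro allI impI)
  fix U assume a: "openin (tuple_top C G m) U \<and> U \<noteq> {}"
  then obtain h0 where h0: "h0 \<in> U" by blast
  have h0E: "h0 \<in> Gseq m" by (rule open_tupleD[OF conjunct1[OF a] h0])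
  have h0G: "h0 s \<in> G" if "s < m" for s by (rule tuple_G[OF h0E that])
  show "extension_set m fs M W R \<inter> U \<noteq> {}"
  proof (cases "h0 \<in> extension_set m fs M W R")
    case True
    then show ?thesis using h0 by blast
  next
    case False
    have hyp: "amalgamation_base m (V fs) (edge_rels m h0 fs)" "tuple_graph m (length fs + M) W R"
       "graph_map m (take (length fs)) W R (V fs) (edge_rels m h0 fs)"
      using False h0E unfolding extension_set_def by simp_all
    obtain ks where ks: "set ks \<subseteq> C" "\<And>h. h\<in>Gseq m \<Longrightarrow> edge_rels m h (fs @ ks) = edge_rels m h0 (fs @ ks) \<Longrightarrow> h \<in> U"
      using capture_open[of m U h0] a h0 fs by blast
    have l: "set (fs @ ks) \<subseteq> C" using fs ks by simp
    have vg: "tuple_graph m (length (fs @ ks)) (V (fs @ ks)) (edge_rels m h0 (fs @ ks))"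
      by (rule edge_rels_tuple_graph) (use h0G l in auto)
    obtain WD RD where D: "tuple_graph m (length (fs @ ks) + (length fs + M - length fs)) WD RD"
      "graph_map m (take (length (fs @ ks))) WD RD (V (fs @ ks)) (edge_rels m h0 (fs @ ks))"
      "graph_map m (\<lambda>l. take (length fs) l @ drop (length (fs @ ks)) l) WD RD W R"
      using amalgam[OF vg hyp(2) _ _ edge_rels_graph_map_take hyp(3,1)] by auto
    have D1: "tuple_graph m (length (fs @ ks) + M) WD RD" using D(1) by simp
    obtain gs h where h: "set gs \<subseteq> C" "length gs = M" "h \<in> Gseq m"
      "V ((fs @ ks) @ gs) = WD" "edge_rels m h ((fs @ ks) @ gs) = RD"
      using realize[OF l D1 D(2)] by blast
    have "edge_rels m h (fs @ ks) = edge_rels m h0 (fs @ ks)"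
      using edge_rels_graph_map_take[of m "fs @ ks" gs h] unfolding h(4,5)
      by (rule graph_map_unique(2)[OF _ D(2)]) (simp_all add: edge_rels_empty)
    then have "h \<in> U" using ks(2) h(3) by blast
    moreover have "V (fs @ gs) = W" "edge_rels m h (fs @ gs) = R"
    proof -
      have g1: "graph_map m (\<lambda>l. take (length fs) l @ drop (length (fs @ ks)) l) WD RD (V (fs @ gs)) (edge_rels m h (fs @ gs))"
        using edge_rels_graph_map_skip[of m fs ks gs h] h(4,5) by simp
      show "V (fs @ gs) = W" by (rule graph_map_unique(1)[OF g1 D(3)]) (simp_all add: edge_rels_empty tuple_graph_empty[OF hyp(2)])
      show "edge_rels m h (fs @ gs) = R" by (rule graph_map_unique(2)[OF g1 D(3)]) (simp_all add: edge_rels_empty tuple_graph_empty[OF hyp(2)])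
    qed
    ultimately show ?thesis using h(1-3) unfolding extension_set_def by blast
  qed
qed

section \<open>Conjugacy of generic tuples and the category argument\<close>

definition generic :: "nat \<Rightarrow> (nat \<Rightarrow> ('a cantor_fun \<Rightarrow> 'a cantor_fun)) \<Rightarrow> bool" where
  "generic m h \<longleftrightarrow> h \<in> Gseq m \<and> (\<forall>fs. set fs \<subseteq> C \<longrightarrow> h \<in> base_set m fs \<and>
      (\<forall>M W R. tuple_graph m (length fs + M) W R \<longrightarrow> h \<in> extension_set m fs M W R))"

text \<open>P keeps the graphs on both sides equal and an amalgamation base. After adding c, more
  elements gs are added on the same side to reach a base again (\<open>base_set\<close>); being over
  a base, the other side must realise the result (\<open>extension_set\<close>).\<close>

lemma generic_conjugate:
  assumes h: "generic m h" and k: "generic m k"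
  shows "\<exists>g\<in>G. \<forall>s<m. \<forall>c\<in>C. k s (g c) = g (h s c)"
proof -
  define P where "P = (\<lambda>h k as bs. set as \<subseteq> C \<and> set bs \<subseteq> C \<and> length as = length bs \<and> V as = V bs \<and>
     edge_rels m h as = edge_rels m k bs \<and> amalgamation_base m (V as) (edge_rels m h as))"
  have sym: "P k h bs as" if "P h k as bs" for h k as bs using that unfolding P_def by metis
  have ext: "\<exists>as' bs'. P h k (as @ as') (bs @ bs') \<and> c \<in> set as'"
    if h: "generic m h" and k: "generic m k" and P: "P h k as bs" and c: "c \<in> C" for h k as bs c
  proof -
    have ac: "set (as @ [c]) \<subseteq> C" using P c by (simp add: P_def)
    then obtain gs where gs: "set gs \<subseteq> C" "amalgamation_base m (V ((as @ [c]) @ gs)) (edge_rels m h ((as @ [c]) @ gs))"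
      using h unfolding generic_def base_set_def by blast
    define as' where "as' = [c] @ gs"
    have a': "set (as @ as') \<subseteq> C" "amalgamation_base m (V (as @ as')) (edge_rels m h (as @ as'))" "c \<in> set as'"
      using gs ac by (simp_all add: as'_def)
    have hE: "h \<in> Gseq m" using h by (simp add: generic_def)
    have hG: "h s \<in> G" if "s < m" for s by (rule tuple_G[OF hE that])
    have vg: "tuple_graph m (length bs + length as') (V (as @ as')) (edge_rels m h (as @ as'))"
      using edge_rels_tuple_graph[of m h "as @ as'", OF hG a'(1)] P by (simp add: P_def)
    have gm: "graph_map m (take (length bs)) (V (as @ as')) (edge_rels m h (as @ as')) (V bs) (edge_rels m k bs)"
      using edge_rels_graph_map_take[of m as as' h] P by (simp add: P_def)
    have eqs: "V as = V bs" "edge_rels m h as = edge_rels m k bs" "amalgamation_base m (V as) (edge_rels m h as)" using P unfolding P_def by blast+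
    have gd: "amalgamation_base m (V bs) (edge_rels m k bs)" using eqs(3) unfolding eqs(1,2) .
    have bC: "set bs \<subseteq> C" using P by (simp add: P_def)
    have "k \<in> extension_set m bs (length as') (V (as @ as')) (edge_rels m h (as @ as'))"
      using k bC vg unfolding generic_def by blast
    then obtain bs' where "set bs' \<subseteq> C" "length bs' = length as'" "V (bs @ bs') = V (as @ as')"
       "edge_rels m k (bs @ bs') = edge_rels m h (as @ as')"
      using gd vg gm unfolding extension_set_def by blast
    then have "P h k (as @ as') (bs @ bs')" using a' bC P by (simp add: P_def)
    then show ?thesis using a'(3) by blast
  qed
  have "\<exists>g\<in>G. map g [] = [] \<and>
    (\<forall>S. finite S \<and> S \<subseteq> C \<longrightarrow> (\<exists>as bs. P h k as bs \<and> S \<subseteq> set as \<and> map g as = bs))"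
  proof (rule back_and_forth)
    have V0: "V [] = {[]}" using auts_id by (auto simp: V_def vals_def)
    have E0: "E f [] = {([], [])}" for f using auts_id by (auto simp: E_def vals_def)
    have q: "edge_rels m h [] = edge_rels m k []" by (rule edge_rels_cong) simp
    \<comment> \<open>The empty tuple has a single vertex with loops, so nothing branches and the
      back-and-forth can start.\<close>
    have "branching m (V []) (edge_rels m h []) (\<lambda>_. None)"
      by (auto simp: branching_def V0 nbr_def edge_rels_def E0 split: if_splits)
    then have "amalgamation_base m (V []) (edge_rels m h [])" unfolding amalgamation_base_def by blast
    then show "P h k [] []" using q by (simp add: P_def)
    show "\<exists>as' bs'. P h k (as @ as') (bs @ bs') \<and> c \<in> set bs'" if "P h k as bs" "c \<in> C" for as bs c
    proof -
      from ext[OF k h sym[OF that(1)] that(2)]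
      obtain bs' as' where "P k h (bs @ bs') (as @ as')" "c \<in> set bs'" by (elim exE conjE)
      then show ?thesis using sym[of k h "bs @ bs'" "as @ as'"] by (intro exI conjI)
    qed
    show "\<exists>as' bs'. P h k (as @ as') (bs @ bs') \<and> c \<in> set as'" if "P h k as bs" "c \<in> C" for as bs c
      by (rule ext[OF h k that])
  qed (simp add: P_def)
  then obtain g where g: "g \<in> G" "\<forall>S. finite S \<and> S \<subseteq> C \<longrightarrow> (\<exists>as bs. P h k as bs \<and> S \<subseteq> set as \<and> map g as = bs)"
    by (elim bexE conjE)
  have "k s (g c) = g (h s c)" if s: "s < m" and c: "c \<in> C" for s c
  proof -
    have hE: "h \<in> Gseq m" using h by (simp add: generic_def)
    have hs: "h s \<in> G" by (rule tuple_G[OF hE s])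
    \<comment> \<open>A stage containing both c and its image under h s; there
      \<open>E_transfer\<close> carries the equation between them to k s.\<close>
    obtain as bs where ab: "P h k as bs" "{c, h s c} \<subseteq> set as" "map g as = bs"
      using g(2)[rule_format, of "{c, h s c}"] c G_C[OF hs c] by auto
    obtain i j where i: "i < length as" "as ! i = c" and j: "j < length as" "as ! j = h s c"
      using ab(2) by (metis in_set_conv_nth insert_subset)
    have "edge_rels m h as = edge_rels m k bs" using ab(1) unfolding P_def by blast
    then have "edge_rels m h as s = edge_rels m k bs s" by (rule fun_cong)
    then have e: "E (h s) as = E (k s) bs" using s by (simp add: edge_rels_def)
    have "set as \<subseteq> C" "length bs = length as" using ab(1) unfolding P_def by simp_all
    then have "k s (bs ! i) = bs ! j"
      using E_transfer[OF _ hs e i(1) j(1)] i(2) j(2) by simp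
    then show ?thesis using ab(3) i j by auto
  qed
  then show ?thesis using g(1) by blast
qed

lemma C_nonempty: "C \<noteq> {}" using C_interpolate[of "{}"] by auto

lemma conj_orbit_subset:
  assumes "h \<in> Gseq m"
  shows "conj_orbit C G m h \<subseteq> Gseq m"
proof
  fix k assume "k \<in> conj_orbit C G m h"
  then obtain g where g: "g \<in> G" "k = (\<lambda>i\<in>{..<m}. compose C (perm_inv C g) (compose C (h i) g))"
    by (auto simp: conj_orbit_def)
  have "compose C (perm_inv C g) (compose C (h i) g) \<in> G" if "i < m" for i
    by (rule compose_automorphism[OF perm_inv_automorphism(1)[OF g(1) bops_C]
        compose_automorphism[OF tuple_G[OF assms that] g(1) bops_C] bops_C])
  then show "k \<in> Gseq m" unfolding g(2) by simp
qed

lemma generic_orbit: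
  assumes h: "generic m h" and k: "generic m k"
  shows "k \<in> conj_orbit C G m h"
proof -
  \<comment> \<open>Taken in the order k, h because the orbit consists of the tuples
    \<open>g^-1 h g\<close>.\<close>
  obtain g where g: "g \<in> G" "\<forall>s<m. \<forall>c\<in>C. h s (g c) = g (k s c)"
    using generic_conjugate[OF k h] by blast
  have kE: "k \<in> Gseq m" using k by (simp add: generic_def)
  have "k s = compose C (perm_inv C g) (compose C (h s) g)" if s: "s < m" for s
  proof
    fix c
    have ks: "k s \<in> G" by (rule tuple_G[OF kE s])
    show "k s c = compose C (perm_inv C g) (compose C (h s) g) c"
    proof (cases "c \<in> C")
      case True
      then show ?thesis
        using g(2) s perm_inv_automorphism(2)[OF g(1) bops_C] G_C[OF ks] by (simp add: compose_eq)
    next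
      case False
      then show ?thesis using ks G_ext by (auto simp: compose_def PiE_def extensional_def)
    qed
  qed
  then have "k = (\<lambda>i\<in>{..<m}. compose C (perm_inv C g) (compose C (h i) g))"
    using kE by (auto simp: fun_eq_iff PiE_def extensional_def)
  then show ?thesis unfolding conj_orbit_def using g(1) by blast
qed

lemma id_G: "restrict (\<lambda>x. x) C \<in> G"
proof -
  have "bij_betw (restrict (\<lambda>x. x) C) C C" by (auto simp: bij_betw_def inj_on_def)
  moreover have "restrict (\<lambda>x. x) C (bops f l) = bops f (map (restrict (\<lambda>x. x) C) l)"
    if "length l = ar f" "set l \<subseteq> C" for f l
  proof -
    have "map (restrict (\<lambda>x. x) C) l = l" using that by (auto intro!: map_idI)
    moreover have "bops f l \<in> C" using bops_C that unfolding is_algebra_def by blast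
    ultimately show ?thesis by simp
  qed
  ultimately show ?thesis unfolding automorphisms_def by auto
qed

theorem ample_generics_automorphisms: "ample_generics C G"
  unfolding ample_generics_def
proof
  fix m :: nat
  let ?T = "tuple_top C G m"
  have ts: "topspace ?T = Gseq m" by (rule topspace_tuple_top[OF G_ext])
  show "\<exists>h. generic_tuple C G m h"
  proof (cases "m = 0")
    case True
    have "conj_orbit C G m (\<lambda>_. undefined) = topspace ?T"
    proof -
      have r: "(\<lambda>i\<in>{..<m}. f i) = (\<lambda>_. undefined)" for f :: "nat \<Rightarrow> 'z" using True by auto
      have "\<exists>g. g \<in> G" using id_G by blast
      then have "conj_orbit C G m (\<lambda>_. undefined) = {\<lambda>_. undefined}"
        unfolding conj_orbit_def r by simp
      then show ?thesis unfolding ts using True by simp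
    qed
    then have "comeagre_in ?T (conj_orbit C G m (\<lambda>_. undefined))"
      unfolding comeagre_in_def by (simp add: exI[of _ "\<lambda>_. topspace ?T"])
    moreover have "(\<lambda>_. undefined) \<in> topspace ?T" unfolding ts using True by simp
    ultimately have "generic_tuple C G m (\<lambda>_. undefined)" by (simp only: generic_tuple_def)
    then show ?thesis by blast
  next
    case False
    then have m: "0 < m" by simp
    \<comment> \<open>Countably many conditions, as C is countable and so are the finite graphs on
      tuples over A; their intersection is the set of generic tuples.\<close>
    define \<U> where "\<U> = base_set m ` lists C \<union>
      (\<lambda>(fs, M, W, R). extension_set m fs M W R) ` (lists C \<times> UNIV \<times> {(W, R). \<exists>n. tuple_graph m n W R})"
    have cU: "countable \<U>"
      unfolding \<U>_def
      by (intro countable_Un countable_image countable_SIGMA countable_lists C_countable countable_params countableI_type)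
    have ne: "\<U> \<noteq> {}" by (auto simp: \<U>_def)
    have od: "openin ?T U \<and> ?T closure_of U = topspace ?T" if U: "U \<in> \<U>" for U
      using U unfolding \<U>_def
    proof (elim UnE imageE)
      fix fs assume U': "U = base_set m fs" and "fs \<in> lists C"
      then have "set fs \<subseteq> C" by (simp add: lists_eq_set)
      then show ?thesis using base_set_open base_set_dense[OF m] unfolding U' by simp
    next
      fix p assume U': "U = (case p of (fs, M, W, R) \<Rightarrow> extension_set m fs M W R)"
        and p: "p \<in> lists C \<times> UNIV \<times> {(W, R). \<exists>n. tuple_graph m n W R}"
      obtain fs M W R where q: "p = (fs, M, W, R)" by (cases p)
      then have "set fs \<subseteq> C" using p by (simp add: lists_eq_set)
      then show ?thesis using extension_set_open extension_set_dense unfolding U' q by simp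
    qed
    have gen: "generic m h \<longleftrightarrow> h \<in> \<Inter>\<U>" for h
    proof
      assume "generic m h"
      then show "h \<in> \<Inter>\<U>"
        by (auto simp: generic_def \<U>_def extension_set_def)
    next
      assume hU: "h \<in> \<Inter>\<U>"
      have b: "h \<in> base_set m fs" if "set fs \<subseteq> C" for fs using hU that by (auto simp: \<U>_def)
      have e: "h \<in> extension_set m fs M W R" if "set fs \<subseteq> C" "tuple_graph m (length fs + M) W R" for fs M W R
      proof -
        have "(fs, M, W, R) \<in> lists C \<times> UNIV \<times> {(W, R). \<exists>n. tuple_graph m n W R}" using that by auto
        then have "extension_set m fs M W R \<in> \<U>" unfolding \<U>_def by force
        then show ?thesis using hU by blast
      qed
      have "h \<in> Gseq m" using b[of "[]"] by (simp add: base_set_def)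
      then show "generic m h" unfolding generic_def using b e by blast
    qed
    have "completely_metrizable_space ?T"
      by (intro completely_metrizable_tuple_top completely_metrizable_automorphisms C_countable C_nonempty bops_C)
    then have "?T closure_of \<Inter>\<U> = topspace ?T" using Baire_category[OF disjI1 cU od] by blast
    moreover have "topspace ?T \<noteq> {}" unfolding ts using id_G by (auto simp: PiE_eq_empty_iff)
    ultimately have "\<Inter>\<U> \<noteq> {}" by (metis closure_of_empty)
    then obtain h where h: "generic m h" using gen by blast
    have hE: "h \<in> Gseq m" using h by (simp add: generic_def)
    have "comeagre_in ?T (conj_orbit C G m h)"
      unfolding comeagre_in_def
    proof (intro conjI exI[of _ "from_nat_into \<U>"] allI)
      show "conj_orbit C G m h \<subseteq> topspace ?T" unfolding ts by (rule conj_orbit_subset[OF hE])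
      show "openin ?T (from_nat_into \<U> k)" "?T closure_of from_nat_into \<U> k = topspace ?T" for k
        using od[OF from_nat_into[OF ne]] by auto
      show "topspace ?T \<inter> (\<Inter>k. from_nat_into \<U> k) \<subseteq> conj_orbit C G m h"
        using generic_orbit[OF h] gen range_from_nat_into[OF ne cU] by auto
    qed
    then have "generic_tuple C G m h" using hE ts by (simp add: generic_tuple_def)
    then show ?thesis by blast
  qed
qed

end

theorem theorem1p1:
  fixes A :: "'a set" and ar :: "'f \<Rightarrow> nat" and ops :: "'f \<Rightarrow> 'a list \<Rightarrow> 'a"
    and xs :: "(nat \<Rightarrow> bool) list" and es :: "'a list"
  assumes "is_algebra A ar ops"
    and "finite A"
    and "simple_alg A ar ops"
    and "malcev_alg A ar ops"
    and "\<not> abelian_alg A ar ops"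
    and "length es = length xs"
    and "\<forall>e\<in>set es. idempotent_el A ar ops e"
    and "distinct xs"
  shows "ample_generics (filtered_bpower A xs es)
           (automorphisms (filtered_bpower A xs es) ar (bpower_ops ops))"
proof -
  have "\<exists>a\<in>A. \<exists>b\<in>A. a \<noteq> b" using assms(3) by (simp add: simple_alg_def)
  then interpret malcev_filtered_power A ar ops xs es
    using assms by unfold_locales
  show ?thesis by (rule ample_generics_automorphisms)
qed

end
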